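(* Let $\Omega\subset\mathbb R^d$ be a bounded and connected Lipschitz domain with $\partial\Omega=\partial\Omega_{\rm Dir}\cup\partial\Omega_{\rm flux}$, where $\partial\Omega_{\rm Dir}$ has positive $(d-1)$-dimensional Hausdorff measure, with flux boundary conditions on $\partial\Omega_{\rm flux}$ and homogeneous pressure boundary conditions on $\partial\Omega_{\rm Dir}$: $$\mathbb K\nabla p|_{\partial\Omega_{\rm flux}}\cdot\nu=g_{\rm flux}\in L^2(\partial\Omega_{\rm flux}),\qquad p=0\in H^{1/2}(\partial\Omega_{\rm Dir}).$$ Let $\mathbb K_1,\mathbb K_2\in(L^\infty(\Omega))^{d\times d}$ be (symmetric) permeability tensor fields which are uniformly $\lambda$-coercive with $\lambda>0$ and uniformly bounded in the Frobenius norm a.e. by $K_{max}$, and let $\tilde f\in L^2(\Omega)$. Denote by $(v_1,p_1),(v_2,p_2)\in L^2(\Omega)\times H^1(\Omega)$ the respective solutions to Darcy's equation. Then $$\|p_2-p_1\|_{H^1(\Omega)}\le C\|\mathbb K_2-\mathbb K_1\|_{L^\infty(\Omega)},\qquad \|v_2-v_1\|_{L^2(\Omega)}\le C\|\mathbb K_2-\mathbb K_1\|_{L^\infty(\Omega)},$$ where the constant $C$ only depends on $\lambda$, $K_{max}$, $\Omega$ and the Darcy data $g_{\rm flux},\tilde f$.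
   Context: Here $d\in\{2,3\}$. The solution of Darcy's equation with coefficient $\mathbb K$ and data $\tilde f,g_{\rm flux}$ is the pair $(v,p)$ with $v=-\mathbb K\nabla p$ and $p\in H^1_{\rm Dir}(\Omega)=\{q\in H^1(\Omega):q=0\text{ on }\partial\Omega_{\rm Dir}\}$ satisfying $$\int_\Omega\mathbb K\nabla p\cdot\nabla q\,dx-(g_{\rm flux},q)_{L^2(\partial\Omega_{\rm flux})}=\int_\Omega\tilde f q\,dx\qquad\forall q\in H^1_{\rm Dir}(\Omega);$$ this is the weak form of $v=-\mathbb K\nabla p$, $\nabla\cdot v=\tilde f$ with the stated boundary conditions. $\lambda$-coercive means $\mathbb K(x)\xi\cdot\xi\ge\lambda|\xi|^2$ for all $\xi\in\mathbb R^d$ and a.e. $x$. $\|\cdot\|_{L^\infty(\Omega)}$ of a matrix field is the essential supremum of its Frobenius norm. Dependence of $C$ on $\Omega$ includes the splitting of $\partial\Omega$. *)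

theory Defs
  imports "HOL-Probability.Probability"
begin

section \<open>Hausdorff measure and surface measure\<close>

text \<open>
  The \<open>k\<close>-dimensional Hausdorff measure, normalised so that it agrees with Lebesgue measure in
  dimension \<open>k\<close>. The covering sets have to be bounded because \<^const>\<open>diameter\<close> is meaningless on
  unbounded sets; the case distinction on \<open>U i = {}\<close> only matters for \<open>k = 0\<close>.
\<close>

definition hausdorff_pre :: "nat \<Rightarrow> real \<Rightarrow> 'a::metric_space set \<Rightarrow> ennreal" where
  "hausdorff_pre k \<delta> A =
     (INF U \<in> {U :: nat \<Rightarrow> 'a set. A \<subseteq> (\<Union>i. U i) \<and> (\<forall>i. bounded (U i) \<and> diameter (U i) \<le> \<delta>)}.
        \<Sum>i. ennreal (if U i = {} then 0
                       else unit_ball_vol (real k) * (diameter (U i) / 2) ^ k))"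

definition hausdorff_outer :: "nat \<Rightarrow> 'a::metric_space set \<Rightarrow> ennreal" where
  "hausdorff_outer k A = (SUP \<delta> \<in> {0<..}. hausdorff_pre k \<delta> A)"

text \<open>The measurable sets are those in the sense of Caratheodory.\<close>

definition hausdorff_measure :: "nat \<Rightarrow> 'a::metric_space measure" where
  "hausdorff_measure k =
     measure_of UNIV (lambda_system UNIV (Pow UNIV) (hausdorff_outer k)) (hausdorff_outer k)"

abbreviation boundary_measure :: "(real^'n) measure" where
  "boundary_measure \<equiv> hausdorff_measure (CARD('n) - 1)"

abbreviation boundary_measure_on :: "(real^'n) set \<Rightarrow> (real^'n) measure" where
  "boundary_measure_on \<Gamma> \<equiv> restrict_space boundary_measure \<Gamma>"


section \<open>Lipschitz domains\<close>

text \<open>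
  Near each boundary point, \<open>\<Omega>\<close> is the set of points lying above a Lipschitz graph in some unit
  direction \<open>e\<close>; the graph function is evaluated at the projection onto the hyperplane
  orthogonal to \<open>e\<close>.
\<close>

definition lipschitz_boundary :: "(real^'n) set \<Rightarrow> bool" where
  "lipschitz_boundary \<Omega> \<longleftrightarrow>
     (\<forall>x0 \<in> frontier \<Omega>. \<exists>r > 0. \<exists>e. \<exists>\<gamma> :: real^'n \<Rightarrow> real. \<exists>L.
        norm e = 1 \<and> L-lipschitz_on {z. z \<bullet> e = 0} \<gamma> \<and>
        \<Omega> \<inter> ball x0 r = {y \<in> ball x0 r. \<gamma> (y - (y \<bullet> e) *\<^sub>R e) < y \<bullet> e})"

definition lipschitz_domain :: "(real^'n) set \<Rightarrow> bool" where
  "lipschitz_domain \<Omega> \<longleftrightarrow>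
     open \<Omega> \<and> \<Omega> \<noteq> {} \<and> bounded \<Omega> \<and> connected \<Omega> \<and> lipschitz_boundary \<Omega>"


section \<open>Lebesgue spaces\<close>

text \<open>
  Elements are represented by functions, not by classes modulo null sets. On \<^typ>\<open>real^'n^'n\<close>,
  \<^const>\<open>norm\<close> is the Frobenius norm.
\<close>

definition L2 :: "'a measure \<Rightarrow> ('a \<Rightarrow> 'b::euclidean_space) set" where
  "L2 M = {f \<in> borel_measurable M. integrable M (\<lambda>x. (norm (f x))\<^sup>2)}"

definition L2_norm :: "'a measure \<Rightarrow> ('a \<Rightarrow> 'b::euclidean_space) \<Rightarrow> real" where
  "L2_norm M f = sqrt (\<integral>x. (norm (f x))\<^sup>2 \<partial>M)"

definition Linfty :: "'a measure \<Rightarrow> ('a \<Rightarrow> 'b::euclidean_space) set" where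
  "Linfty M = {f \<in> borel_measurable M. esssup M (\<lambda>x. ereal (norm (f x))) < \<infinity>}"

definition Linfty_norm :: "'a measure \<Rightarrow> ('a \<Rightarrow> 'b::euclidean_space) \<Rightarrow> real" where
  "Linfty_norm M f = real_of_ereal (esssup M (\<lambda>x. ereal (norm (f x))))"


section \<open>Sobolev space and traces\<close>

fun C_k :: "nat \<Rightarrow> (real^'n \<Rightarrow> real) \<Rightarrow> bool" where
  "C_k 0 \<phi> \<longleftrightarrow> continuous_on UNIV \<phi>"
| "C_k (Suc k) \<phi> \<longleftrightarrow>
     (\<forall>x. \<phi> differentiable (at x)) \<and>
     (\<forall>i. C_k k (\<lambda>x. frechet_derivative \<phi> (at x) (axis i 1)))"

definition smooth :: "(real^'n \<Rightarrow> real) \<Rightarrow> bool" where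
  "smooth \<phi> \<longleftrightarrow> (\<forall>k. C_k k \<phi>)"

definition gradient :: "(real^'n \<Rightarrow> real) \<Rightarrow> real^'n \<Rightarrow> real^'n" where
  "gradient \<phi> x = (\<chi> i. frechet_derivative \<phi> (at x) (axis i 1))"

definition test_functions :: "(real^'n) set \<Rightarrow> (real^'n \<Rightarrow> real) set" where
  "test_functions \<Omega> =
     {\<phi>. smooth \<phi> \<and> (\<exists>C. compact C \<and> C \<subseteq> \<Omega> \<and> (\<forall>x. x \<notin> C \<longrightarrow> \<phi> x = 0))}"

definition locally_integrable :: "(real^'n) set \<Rightarrow> (real^'n \<Rightarrow> 'b::euclidean_space) \<Rightarrow> bool" where
  "locally_integrable \<Omega> u \<longleftrightarrow> (\<forall>C. compact C \<and> C \<subseteq> \<Omega> \<longrightarrow> u absolutely_integrable_on C)"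

definition has_weak_gradient ::
    "(real^'n) set \<Rightarrow> (real^'n \<Rightarrow> real) \<Rightarrow> (real^'n \<Rightarrow> real^'n) \<Rightarrow> bool" where
  "has_weak_gradient \<Omega> u G \<longleftrightarrow>
     locally_integrable \<Omega> u \<and> locally_integrable \<Omega> G \<and>
     (\<forall>\<phi> \<in> test_functions \<Omega>.
        (\<integral>x. u x *\<^sub>R gradient \<phi> x \<partial>lebesgue_on \<Omega>) = - (\<integral>x. \<phi> x *\<^sub>R G x \<partial>lebesgue_on \<Omega>))"

text \<open>The weak gradient is unique up to null sets; any representative may be chosen.\<close>

definition wgrad :: "(real^'n) set \<Rightarrow> (real^'n \<Rightarrow> real) \<Rightarrow> real^'n \<Rightarrow> real^'n" where
  "wgrad \<Omega> u = (SOME G. has_weak_gradient \<Omega> u G)"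

definition H1 :: "(real^'n) set \<Rightarrow> (real^'n \<Rightarrow> real) set" where
  "H1 \<Omega> = {u \<in> L2 (lebesgue_on \<Omega>). \<exists>G \<in> L2 (lebesgue_on \<Omega>). has_weak_gradient \<Omega> u G}"

definition H1_norm :: "(real^'n) set \<Rightarrow> (real^'n \<Rightarrow> real) \<Rightarrow> real" where
  "H1_norm \<Omega> u =
     sqrt ((L2_norm (lebesgue_on \<Omega>) u)\<^sup>2 + (L2_norm (lebesgue_on \<Omega>) (wgrad \<Omega> u))\<^sup>2)"

text \<open>
  The trace operator from \<open>H1 \<Omega>\<close> to \<open>L2\<close> of the boundary is the extension by continuity of
  the restriction map on smooth functions, which are dense in \<open>H1 \<Omega>\<close> for a bounded Lipschitz
  domain. \<open>has_trace \<Omega> u w\<close> says that \<open>w\<close> is (a representative of) the trace of \<open>u\<close>.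
\<close>

definition has_trace ::
    "(real^'n) set \<Rightarrow> (real^'n \<Rightarrow> real) \<Rightarrow> (real^'n \<Rightarrow> real) \<Rightarrow> bool" where
  "has_trace \<Omega> u w \<longleftrightarrow>
     u \<in> H1 \<Omega> \<and> w \<in> L2 (boundary_measure_on (frontier \<Omega>)) \<and>
     (\<exists>\<phi> :: nat \<Rightarrow> real^'n \<Rightarrow> real.
        (\<forall>k. smooth (\<phi> k)) \<and>
        (\<lambda>k. H1_norm \<Omega> (\<lambda>x. \<phi> k x - u x)) \<longlonglongrightarrow> 0 \<and>
        (\<lambda>k. L2_norm (boundary_measure_on (frontier \<Omega>)) (\<lambda>x. \<phi> k x - w x)) \<longlonglongrightarrow> 0)"

definition boundary_trace :: "(real^'n) set \<Rightarrow> (real^'n \<Rightarrow> real) \<Rightarrow> real^'n \<Rightarrow> real" where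
  "boundary_trace \<Omega> u = (SOME w. has_trace \<Omega> u w)"

definition H1_Dir :: "(real^'n) set \<Rightarrow> (real^'n) set \<Rightarrow> (real^'n \<Rightarrow> real) set" where
  "H1_Dir \<Omega> \<Gamma>D =
     {q \<in> H1 \<Omega>. \<exists>w. has_trace \<Omega> q w \<and> (AE x in boundary_measure_on \<Gamma>D. w x = 0)}"


section \<open>Darcy's equation\<close>

definition permeability ::
    "(real^'n) set \<Rightarrow> real \<Rightarrow> real \<Rightarrow> (real^'n \<Rightarrow> real^'n^'n) \<Rightarrow> bool" where
  "permeability \<Omega> lam Kmax K \<longleftrightarrow>
     K \<in> Linfty (lebesgue_on \<Omega>) \<and>
     (AE x in lebesgue_on \<Omega>. transpose (K x) = K x) \<and>
     (AE x in lebesgue_on \<Omega>. \<forall>\<xi>. (K x *v \<xi>) \<bullet> \<xi> \<ge> lam * (norm \<xi>)\<^sup>2) \<and>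
     (AE x in lebesgue_on \<Omega>. norm (K x) \<le> Kmax)"

definition darcy_solution ::
    "(real^'n) set \<Rightarrow> (real^'n) set \<Rightarrow> (real^'n) set \<Rightarrow> (real^'n \<Rightarrow> real^'n^'n) \<Rightarrow>
     (real^'n \<Rightarrow> real) \<Rightarrow> (real^'n \<Rightarrow> real) \<Rightarrow>
     (real^'n \<Rightarrow> real^'n) \<Rightarrow> (real^'n \<Rightarrow> real) \<Rightarrow> bool" where
  "darcy_solution \<Omega> \<Gamma>D \<Gamma>flux K f g v p \<longleftrightarrow>
     v \<in> L2 (lebesgue_on \<Omega>) \<and> p \<in> H1_Dir \<Omega> \<Gamma>D \<and>
     (AE x in lebesgue_on \<Omega>. v x = - (K x *v wgrad \<Omega> p x)) \<and>
     (\<forall>q \<in> H1_Dir \<Omega> \<Gamma>D.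
        (\<integral>x. (K x *v wgrad \<Omega> p x) \<bullet> wgrad \<Omega> q x \<partial>lebesgue_on \<Omega>)
          - (\<integral>x. g x * boundary_trace \<Omega> q x \<partial>boundary_measure_on \<Gamma>flux)
        = (\<integral>x. f x * q x \<partial>lebesgue_on \<Omega>))"

end

theory Submission
  imports Defs
begin

text \<open>
  Testing the two weak formulations with \<open>p2 - p1\<close> gives
  \<open>lam \<parallel>\<nabla>(p2 - p1)\<parallel>\<^sup>2 \<le> \<integral> (K1 - K2) \<nabla>p1 \<bullet> \<nabla>(p2 - p1)\<close>, so that everything reduces to a bound
  on \<open>\<nabla>p1\<close> uniform in \<open>K1\<close> and to a Poincare inequality on \<open>H1_Dir\<close>. For the former, one fixed
  solution bounds the load functional.

  The Poincare inequality is proved for smooth functions by translations. If \<open>S\<close> can be moved along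
  a vector inside \<open>\<Omega>\<close> into a set on which the \<open>L2\<close> norm is controlled by the gradient and the
  boundary values, then the \<open>L2\<close> norm is controlled on \<open>S\<close>. This spreads control over the connected
  set \<open>\<Omega>\<close> and, along the chart direction, up to its boundary. A first controlled ball is obtained by
  averaging over all translations of a piece of \<open>\<Gamma>D\<close> by the vectors of a small ball: each point of
  \<open>\<Omega>\<close> is swept with bounded multiplicity, because the surface measure of the boundary in a ball of
  radius \<open>\<delta>\<close> is at most a constant times \<open>\<delta>\<close> to the power \<open>n - 1\<close>.
\<close>

section \<open>Hausdorff measure as a metric outer measure\<close>

text \<open>The definitions leave two gaps to close before any estimate. \<open>wgrad\<close> is an
  arbitrary choice of weak gradient, so its linearity holds only almost everywhere and rests on
  uniqueness, that is, on the fundamental lemma of the calculus of variations. The surface measure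
  is given by coverings alone: that Borel sets are measurable and that a Lipschitz boundary has
  finite measure must be derived before boundary norms of smooth functions carry information. The
  Poincare estimate is stated with a boundary term because the smooth functions approximating an
  element of \<open>H1_Dir\<close> need not vanish on \<open>\<Gamma>D\<close>; the term disappears
  only in the limit. The average over a ball of vectors answers a mismatch of dimensions: the
  endpoints reached from a piece of \<open>\<Gamma>D\<close> along a single vector form a null set,
  which says nothing about an \<open>L2\<close> norm on a ball. Substituting for the vector costs a
  Jacobian \<open>1 / t ^ n\<close>; the growth of order \<open>n - 1\<close> of the surface measure
  cancels all of it but one factor \<open>1 / t\<close>.\<close>

lemma outer_measure_spaceD:
  assumes "outer_measure_space (Pow UNIV) \<mu>"
  shows "\<mu> {} = 0" "A \<subseteq> B \<Longrightarrow> \<mu> A \<le> \<mu> B" "\<mu> (A \<union> B) \<le> \<mu> A + \<mu> B"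
proof -
  have p: "positive (Pow UNIV) \<mu>" and i: "increasing (Pow UNIV) \<mu>" and c: "countably_subadditive (Pow UNIV) \<mu>"
    using assms by (auto simp: outer_measure_space_def)
  show "\<mu> {} = 0" using p by (simp add: positive_def)
  show "A \<subseteq> B \<Longrightarrow> \<mu> A \<le> \<mu> B" using i by (simp add: increasing_def)
  have "subadditive (Pow UNIV) \<mu>"
  proof -
    interpret ring_of_sets UNIV "Pow UNIV" by (rule ring_of_sets_Pow)
    show ?thesis by (rule countably_subadditive_subadditive[OF p c])
  qed
  hence s: "X \<inter> Y = {} \<Longrightarrow> \<mu> (X \<union> Y) \<le> \<mu> X + \<mu> Y" for X Y
    by (auto simp: subadditive_def)
  have "\<mu> (A \<union> B) = \<mu> (A \<union> (B - A))" by (simp add: Un_Diff_cancel)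
  also have "\<dots> \<le> \<mu> A + \<mu> (B - A)" by (rule s) auto
  also have "\<dots> \<le> \<mu> A + \<mu> B" using i by (intro add_mono) (auto simp: increasing_def)
  finally show "\<mu> (A \<union> B) \<le> \<mu> A + \<mu> B" .
qed

text \<open>\<open>countably_subadditive\<close> speaks of disjoint families only, so the sets are
  first made disjoint; monotonicity brings the original ones back.\<close>

lemma outer_measure_space_UN:
  assumes om: "outer_measure_space (Pow UNIV) \<mu>"
  shows "\<mu> (\<Union>i::nat. A i) \<le> (\<Sum>i. \<mu> (A i))"
proof -
  have c: "countably_subadditive (Pow UNIV) \<mu>"
    using assms by (auto simp: outer_measure_space_def)
  have "\<mu> (\<Union>i. A i) = \<mu> (\<Union>i. disjointed A i)" by (simp add: UN_disjointed_eq)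
  also have "\<dots> \<le> (\<Sum>i. \<mu> (disjointed A i))"
    using c disjoint_family_disjointed by (auto simp: countably_subadditive_def)
  also have "\<dots> \<le> (\<Sum>i. \<mu> (A i))"
    by (intro suminf_le outer_measure_spaceD(2)[OF om] disjointed_subset) auto
  finally show ?thesis .
qed

text \<open>The gaps \<open>\<epsilon> i\<close> may tend to 0. When \<open>S n\<close> is appended,
  only the finitely many gaps below \<open>n\<close> matter, and their minimum is positive;
  \<open>n = 0\<close> is separate because that minimum would run over the empty set.\<close>

lemma metric_outer_measure_sum:
  fixes \<mu> :: "'a::metric_space set \<Rightarrow> ennreal"
  assumes om: "outer_measure_space (Pow UNIV) \<mu>"
    and metric: "\<And>A B d. d > 0 \<Longrightarrow> (\<And>x y. x \<in> A \<Longrightarrow> y \<in> B \<Longrightarrow> d \<le> dist x y) \<Longrightarrow> \<mu> A + \<mu> B \<le> \<mu> (A \<union> B)"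
    and sep: "\<And>i j x y. (i::nat) < j \<Longrightarrow> x \<in> S i \<Longrightarrow> y \<in> S j \<Longrightarrow> \<epsilon> i \<le> dist x y"
    and pos: "\<And>i. \<epsilon> i > 0"
  shows "(\<Sum>i<n. \<mu> (S i)) \<le> \<mu> (\<Union>i<n. S i)"
proof (induction n)
  case 0 show ?case by (simp add: outer_measure_spaceD(1)[OF om])
next
  case (Suc n)
  show ?case
  proof (cases "n = 0")
    case True
    thus ?thesis by (simp add: lessThan_Suc)
  next
    case False
    define d where "d = Min (\<epsilon> ` {..<n})"
    have d: "d > 0" unfolding d_def using False pos by (subst Min_gr_iff) auto
    have "(\<Sum>i<Suc n. \<mu> (S i)) \<le> \<mu> (\<Union>i<n. S i) + \<mu> (S n)"
      using Suc.IH by (simp add: add_right_mono)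
    also have "\<dots> \<le> \<mu> ((\<Union>i<n. S i) \<union> S n)"
    proof (rule metric[OF d])
      fix x y assume "x \<in> (\<Union>i<n. S i)" "y \<in> S n"
      then obtain i where i: "i < n" "x \<in> S i" by auto
      have "d \<le> \<epsilon> i" unfolding d_def using i by (intro Min_le) auto
      also have "\<dots> \<le> dist x y" using sep i \<open>y \<in> S n\<close> by blast
      finally show "d \<le> dist x y" .
    qed
    also have "((\<Union>i<n. S i) \<union> S n) = (\<Union>i<Suc n. S i)" by (auto simp: less_Suc_eq)
    finally show ?thesis .
  qed
qed

text \<open>The shells \<open>R n\<close> of \<open>T - F\<close> with even index are mutually separated, and so are those with odd
  index. Hence the sum of their measures is at most \<open>2 \<mu> T\<close> and its tails vanish.\<close>

lemma metric_outer_measure_closed: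
  fixes \<mu> :: "'a::metric_space set \<Rightarrow> ennreal"
  assumes om: "outer_measure_space (Pow UNIV) \<mu>"
    and metric: "\<And>A B d. d > 0 \<Longrightarrow> (\<And>x y. x \<in> A \<Longrightarrow> y \<in> B \<Longrightarrow> d \<le> dist x y) \<Longrightarrow> \<mu> A + \<mu> B \<le> \<mu> (A \<union> B)"
    and F: "closed F"
  shows "F \<in> lambda_system UNIV (Pow UNIV) \<mu>"
proof -
  note mono = outer_measure_spaceD(2)[OF om]
  have main: "\<mu> (T \<inter> F) + \<mu> (T - F) \<le> \<mu> T" for T
  \<comment> \<open>\<open>infdist\<close> to the empty set is 0 by convention, so for
    \<open>F = {}\<close> the sets \<open>A n\<close> below would be empty and miss all of
    \<open>T\<close>.\<close>
  proof (cases "\<mu> T = \<infinity> \<or> F = {}")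
    case True thus ?thesis by (auto simp: outer_measure_spaceD(1)[OF om])
  next
    case False
    hence fin: "\<mu> T < \<infinity>" and ne: "F \<noteq> {}" by (auto simp: top.not_eq_extremum)
    define A where "A n = {x \<in> T. 1 / real (n+1) \<le> infdist x F}" for n
    define R where "R n = A (Suc n) - A n" for n
    have AT: "A n \<subseteq> T" for n by (auto simp: A_def)
    have A_mono: "A n \<subseteq> A (Suc n)" for n
    proof -
      have "1 / real (Suc n + 1) \<le> 1 / real (n+1)" by (simp add: field_simps)
      thus ?thesis by (auto simp: A_def intro: order_trans)
    qed
    have infd: "infdist x F - infdist y F \<le> dist x y" for x y
      using infdist_triangle[of x F y] by simp
    \<comment> \<open>Neighbouring shells can touch, hence the gap of two indices:
      \<open>R i\<close> stays at distance at least \<open>1 / (i + 2)\<close> from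
      \<open>F\<close>, while \<open>R j\<close> stays below \<open>1 / (i + 3)\<close>.\<close>
    have sepR: "1 / real (i+2) - 1 / real (i+3) \<le> dist x y" if "i + 2 \<le> j" "x \<in> R i" "y \<in> R j" for i j x y
    proof -
      have 1: "1 / real (i+2) \<le> infdist x F" using that by (auto simp: R_def A_def)
      have "infdist y F < 1 / real (j+1)" using that by (auto simp: R_def A_def)
      also have "\<dots> \<le> 1 / real (i+3)" using that by (intro divide_left_mono) auto
      finally show ?thesis using 1 infd[of x y] by linarith
    qed
    have posR: "1 / real (i+2) - 1 / real (i+3) > 0" for i
      using divide_strict_left_mono[of "real (i+2)" "real (i+3)" 1] by simp
    have half: "(\<Sum>i<n. \<mu> (R (2*i+c))) \<le> \<mu> T" for n c
    proof -
      have "(\<Sum>i<n. \<mu> (R (2*i+c))) \<le> \<mu> (\<Union>i<n. R (2*i+c))"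
      proof (rule metric_outer_measure_sum[OF om, where S = "\<lambda>i. R (2*i+c)" and
          \<epsilon> = "\<lambda>i. 1 / real ((2*i+c)+2) - 1 / real ((2*i+c)+3)"])
        show "i < j \<Longrightarrow> x \<in> R (2*i+c) \<Longrightarrow> y \<in> R (2*j+c) \<Longrightarrow>
          1 / real ((2*i+c)+2) - 1 / real ((2*i+c)+3) \<le> dist x y" for i j x y
          by (rule sepR[of _ "2*j+c"]) auto
        show "1 / real ((2*i+c)+2) - 1 / real ((2*i+c)+3) > 0" for i by (rule posR)
      qed (fact metric)
      also have "\<dots> \<le> \<mu> T" by (rule mono) (auto simp: R_def A_def)
      finally show ?thesis .
    qed
    have part: "(\<Sum>i<n. \<mu> (R i)) \<le> \<mu> T + \<mu> T" for n
    proof -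
      have "(\<Sum>i<n. \<mu> (R i)) \<le> (\<Sum>i<2*n. \<mu> (R i))" by (intro sum_mono2) auto
      also have "\<dots> = (\<Sum>i<n. \<mu> (R (2*i+0))) + (\<Sum>i<n. \<mu> (R (2*i+1)))"
        by (induction n) (auto simp: algebra_simps)
      also have "\<dots> \<le> \<mu> T + \<mu> T" by (intro add_mono half)
      finally show ?thesis .
    qed
    have sumfin: "(\<Sum>i. \<mu> (R i)) \<le> \<mu> T + \<mu> T"
      by (intro suminf_le_const summableI part)
    hence lt: "(\<Sum>i. \<mu> (R i)) < \<infinity>" using fin by (simp add: order.strict_trans1 ennreal_add_less_top)
    define r where "r i = enn2real (\<mu> (R i))" for i
    have r: "\<mu> (R i) = ennreal (r i)" for i
    proof -
      have "\<mu> (R i) \<le> \<mu> T" by (rule mono) (auto simp: R_def A_def)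
      thus ?thesis using fin unfolding r_def by (simp add: ennreal_enn2real order.strict_trans1)
    qed
    have r0: "r i \<ge> 0" for i by (simp add: r_def)
    have sr: "summable r"
    proof (rule summable_suminf_not_top)
      show "(\<Sum>i. ennreal (r i)) \<noteq> top" using lt by (simp add: r)
    qed (use r0 in auto)
    show ?thesis
    proof (rule ennreal_le_epsilon)
      fix e :: real assume e: "e > 0"
      obtain N where N: "norm (\<Sum>i. r (i + N)) < e"
        using suminf_exist_split[OF e sr] by blast
      \<comment> \<open>Closedness of \<open>F\<close> enters here: a point outside has positive
        distance to \<open>F\<close>, so it lies in some \<open>A n\<close>, and the least such
        index names its shell.\<close>
      have TF: "T - F \<subseteq> A N \<union> (\<Union>i. R (i + N))"
      proof
        fix x assume x: "x \<in> T - F"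
        have "infdist x F > 0" using x F ne
          by (metis DiffD2 in_closed_iff_infdist_zero infdist_nonneg order_le_less)
        then obtain n where n: "inverse (real (Suc n)) < infdist x F" using reals_Archimedean by blast
        hence "x \<in> A n" using x by (auto simp: A_def field_simps)
        hence ex: "\<exists>n. x \<in> A n" by blast
        define m where "m = (LEAST n. x \<in> A n)"
        have m: "x \<in> A m" unfolding m_def using ex by (rule LeastI_ex)
        have lm: "k < m \<Longrightarrow> x \<notin> A k" for k unfolding m_def by (rule not_less_Least)
        show "x \<in> A N \<union> (\<Union>i. R (i + N))"
        proof (cases "m \<le> N")
          case True
          have "A m \<subseteq> A N" using True by (rule lift_Suc_mono_le[of A, OF A_mono])
          thus ?thesis using m by auto
        next
          case False
          then obtain k where k: "m = Suc k" "k \<ge> N" by (cases m) auto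
          hence "x \<in> R ((k - N) + N)" using m lm[of k] by (auto simp: R_def)
          thus ?thesis by blast
        qed
      qed
      have "\<mu> (T - F) \<le> \<mu> (A N) + \<mu> (\<Union>i. R (i + N))"
        by (rule order_trans[OF mono[OF TF] outer_measure_spaceD(3)[OF om]])
      also have "\<mu> (\<Union>i. R (i + N)) \<le> (\<Sum>i. \<mu> (R (i + N)))" by (rule outer_measure_space_UN[OF om])
      also have "\<dots> = ennreal (\<Sum>i. r (i + N))"
        unfolding r using r0 sr by (intro suminf_ennreal2) (auto simp: summable_iff_shift)
      also have "\<dots> \<le> ennreal e" using N by (intro ennreal_leI) auto
      finally have 1: "\<mu> (T - F) \<le> \<mu> (A N) + ennreal e" by (simp add: add_left_mono)
      have "\<mu> (T \<inter> F) + \<mu> (A N) \<le> \<mu> (T \<inter> F \<union> A N)"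
      proof (rule metric[of "1 / real (N+1)"])
        fix x y assume "x \<in> T \<inter> F" "y \<in> A N"
        thus "1 / real (N+1) \<le> dist x y"
          using infd[of y x] by (auto simp: A_def dist_commute)
      qed auto
      also have "\<dots> \<le> \<mu> T" by (rule mono) (auto simp: A_def)
      finally have 2: "\<mu> (T \<inter> F) + \<mu> (A N) \<le> \<mu> T" .
      have "\<mu> (T \<inter> F) + \<mu> (T - F) \<le> \<mu> (T \<inter> F) + \<mu> (A N) + ennreal e"
        using 1 by (simp add: add.assoc add_left_mono)
      also have "\<dots> \<le> \<mu> T + ennreal e" using 2 by (rule add_right_mono)
      finally show "\<mu> (T \<inter> F) + \<mu> (T - F) \<le> \<mu> T + ennreal e" .
    qed
  qed
  have "\<mu> (T \<inter> F) + \<mu> (T - F) = \<mu> T" for T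
  proof (rule antisym[OF main])
    have "\<mu> T = \<mu> ((T \<inter> F) \<union> (T - F))" by (rule arg_cong[of _ _ \<mu>]) auto
    thus "\<mu> T \<le> \<mu> (T \<inter> F) + \<mu> (T - F)" using outer_measure_spaceD(3)[OF om] by simp
  qed
  thus ?thesis by (subst algebra.lambda_system_eq[OF algebra_Pow]) auto
qed

section \<open>Hausdorff outer measure and its Borel sets\<close>

definition hausdorff_weight :: "nat \<Rightarrow> 'a::metric_space set \<Rightarrow> ennreal" where
  "hausdorff_weight k U =
     ennreal (if U = {} then 0 else unit_ball_vol (real k) * (diameter U / 2) ^ k)"

lemma hausdorff_weight_empty [simp]: "hausdorff_weight k {} = 0"
  by (simp add: hausdorff_weight_def)

lemma hausdorff_pre_le:
  assumes "A \<subseteq> (\<Union>i. U i)" "\<And>i. bounded (U i)" "\<And>i. diameter (U i) \<le> \<delta>"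
  shows "hausdorff_pre k \<delta> A \<le> (\<Sum>i. hausdorff_weight k (U i))"
  unfolding hausdorff_pre_def hausdorff_weight_def using assms by (intro INF_lower) auto

lemma le_hausdorff_preI:
  assumes "\<And>U. A \<subseteq> (\<Union>i. U i) \<Longrightarrow> (\<And>i. bounded (U i)) \<Longrightarrow> (\<And>i. diameter (U i) \<le> \<delta>) \<Longrightarrow>
    x \<le> (\<Sum>i. hausdorff_weight k (U i))"
  shows "x \<le> hausdorff_pre k \<delta> A"
  unfolding hausdorff_pre_def using assms
  by (intro INF_greatest) (auto simp: hausdorff_weight_def)

lemma hausdorff_pre_close:
  assumes "hausdorff_pre k \<delta> A < x"
  obtains U where "A \<subseteq> (\<Union>i. U i)" "\<And>i. bounded (U i)" "\<And>i. diameter (U i) \<le> \<delta>"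
    "(\<Sum>i. hausdorff_weight k (U i)) < x"
  using assms unfolding hausdorff_pre_def INF_less_iff hausdorff_weight_def by auto

lemma hausdorff_pre_mono: "A \<subseteq> B \<Longrightarrow> hausdorff_pre k \<delta> A \<le> hausdorff_pre k \<delta> B"
  by (rule le_hausdorff_preI, rule hausdorff_pre_le) auto

lemma hausdorff_pre_antimono: "\<delta> \<le> \<delta>' \<Longrightarrow> hausdorff_pre k \<delta>' A \<le> hausdorff_pre k \<delta> A"
  by (rule le_hausdorff_preI, rule hausdorff_pre_le) (auto intro: order_trans)

lemma hausdorff_pre_empty: "\<delta> > 0 \<Longrightarrow> hausdorff_pre k \<delta> {} = 0"
  using hausdorff_pre_le[of "{}" "\<lambda>_. {}" \<delta> k] by simp

text \<open>Near-optimal covers of the \<open>A n\<close> with excess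
  \<open>e * (1/2) ^ Suc n\<close> are merged into one sequence by \<open>prod_decode\<close>; the
  excesses add up to \<open>e\<close>.\<close>

lemma hausdorff_pre_UN:
  "hausdorff_pre k \<delta> (\<Union>i::nat. A i) \<le> (\<Sum>i. hausdorff_pre k \<delta> (A i))"
proof (rule ennreal_le_epsilon)
  let ?O = "hausdorff_pre k \<delta>"
  fix e :: real assume e: "0 < e" and "(\<Sum>n. ?O (A n)) < top"
  then have *: "\<And>n. ?O (A n) < ?O (A n) + e * (1/2)^Suc n"
    by (auto simp add: less_top dest!: ennreal_suminf_lessD)
  have "\<exists>U. A n \<subseteq> (\<Union>i. U i) \<and> (\<forall>i. bounded (U i)) \<and> (\<forall>i. diameter (U i) \<le> \<delta>) \<and>
    (\<Sum>i. hausdorff_weight k (U i)) \<le> ?O (A n) + e * (1/2)^Suc n" for n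
    by (rule hausdorff_pre_close[OF *[of n]]) (auto intro: less_imp_le)
  then obtain B where B: "\<And>n. A n \<subseteq> (\<Union>i. B n i)" "\<And>n i. bounded (B n i)" "\<And>n i. diameter (B n i) \<le> \<delta>"
    "\<And>n. (\<Sum>i. hausdorff_weight k (B n i)) \<le> ?O (A n) + e * (1/2)^Suc n"
    by metis
  define C where "C = case_prod B o prod_decode"
  have A_C: "(\<Union>i. A i) \<subseteq> (\<Union>i. C i)"
    using B(1) by (auto simp add: C_def subset_eq) (metis prod.case prod_encode_inverse)
  have "?O (\<Union>i. A i) \<le> (\<Sum>i. hausdorff_weight k (C i))"
    using A_C B by (intro hausdorff_pre_le) (auto simp: C_def split_def)
  also have "\<dots> = (\<Sum>n. \<Sum>i. hausdorff_weight k (B n i))"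
  proof -
    have "(\<Sum>i. (\<lambda>(m,n). hausdorff_weight k (B m n)) (prod_decode i)) = (\<Sum>n. \<Sum>i. hausdorff_weight k (B n i))"
      by (rule suminf_ennreal_2dimen) auto
    thus ?thesis by (simp add: C_def split_def)
  qed
  also have "\<dots> \<le> (\<Sum>n. ?O (A n) + e * (1/2) ^ Suc n)"
    by (intro suminf_le B summableI)
  also have "... = (\<Sum>n. ?O (A n)) + (\<Sum>n. ennreal e * ennreal ((1/2) ^ Suc n))"
    using \<open>0 < e\<close> by (subst suminf_add[symmetric])
                     (auto simp del: ennreal_suminf_cmult simp add: ennreal_mult[symmetric])
  also have "\<dots> = (\<Sum>n. ?O (A n)) + e"
    unfolding ennreal_suminf_cmult
    by (subst suminf_ennreal_eq[OF zero_le_power power_half_series]) auto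
  finally show "?O (\<Union>i. A i) \<le> (\<Sum>n. ?O (A n)) + e" .
qed

lemma outer_measure_space_hausdorff:
  "outer_measure_space (Pow UNIV) (hausdorff_outer k :: 'a::metric_space set \<Rightarrow> ennreal)"
proof -
  have "hausdorff_outer k ({} :: 'a set) = 0"
    unfolding hausdorff_outer_def by (simp add: hausdorff_pre_empty bot_ennreal)
  moreover have "hausdorff_outer k A \<le> hausdorff_outer k B" if "A \<subseteq> B" for A B :: "'a set"
    unfolding hausdorff_outer_def using that by (intro SUP_mono) (auto intro: hausdorff_pre_mono)
  moreover have "hausdorff_outer k (\<Union>i. A i) \<le> (\<Sum>i. hausdorff_outer k (A i))" for A :: "nat \<Rightarrow> 'a set"
    unfolding hausdorff_outer_def[of k "\<Union>i. A i"]
  proof (rule SUP_least)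
    fix \<delta> :: real assume "\<delta> \<in> {0<..}"
    thus "hausdorff_pre k \<delta> (\<Union>i. A i) \<le> (\<Sum>i. hausdorff_outer k (A i))"
      by (intro order_trans[OF hausdorff_pre_UN] suminf_le summableI)
         (auto simp: hausdorff_outer_def intro: SUP_upper)
  qed
  ultimately show ?thesis
    by (auto simp: outer_measure_space_def positive_def increasing_def countably_subadditive_def)
qed

text \<open>For a mesh below \<open>d\<close> no covering set meets both \<open>A\<close> and
  \<open>B\<close>, so a cover of the union contains two covers that share no nonempty set.
  \<open>hausdorff_pre\<close> grows as the mesh shrinks, which reduces any pair of meshes to one
  small common mesh before the two suprema are taken.\<close>

lemma hausdorff_outer_separated:
  fixes A B :: "'a::metric_space set"
  assumes d: "d > 0" and sep: "\<And>x y. x \<in> A \<Longrightarrow> y \<in> B \<Longrightarrow> d \<le> dist x y"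
  shows "hausdorff_outer k A + hausdorff_outer k B \<le> hausdorff_outer k (A \<union> B)"
proof -
  have small: "hausdorff_pre k \<delta> A + hausdorff_pre k \<delta> B \<le> hausdorff_pre k \<delta> (A \<union> B)" if \<delta>: "0 < \<delta>" "\<delta> < d" for \<delta>
  proof (rule le_hausdorff_preI)
    fix U :: "nat \<Rightarrow> 'a set"
    assume U: "A \<union> B \<subseteq> (\<Union>i. U i)" "\<And>i. bounded (U i)" "\<And>i. diameter (U i) \<le> \<delta>"
    define V where "V S i = (if U i \<inter> S = {} then {} else U i)" for S i
    have "hausdorff_pre k \<delta> S \<le> (\<Sum>i. hausdorff_weight k (V S i))" if "S \<subseteq> A \<union> B" for S
      using U that \<delta> by (intro hausdorff_pre_le) (auto simp: V_def, blast)
    hence "hausdorff_pre k \<delta> A + hausdorff_pre k \<delta> B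
        \<le> (\<Sum>i. hausdorff_weight k (V A i)) + (\<Sum>i. hausdorff_weight k (V B i))"
      by (intro add_mono) auto
    also have "\<dots> = (\<Sum>i. hausdorff_weight k (V A i) + hausdorff_weight k (V B i))"
      by (intro suminf_add summableI)
    also have "\<dots> \<le> (\<Sum>i. hausdorff_weight k (U i))"
    proof (intro suminf_le summableI)
      fix i
      have "U i \<inter> A = {} \<or> U i \<inter> B = {}"
      proof (rule ccontr)
        assume "\<not> ?thesis"
        then obtain x y where "x \<in> U i" "x \<in> A" "y \<in> U i" "y \<in> B" by auto
        hence "d \<le> dist x y" "dist x y \<le> diameter (U i)"
          using sep diameter_bounded_bound[OF U(2)] by auto
        thus False using U(3)[of i] \<delta> by linarith
      qed
      thus "hausdorff_weight k (V A i) + hausdorff_weight k (V B i) \<le> hausdorff_weight k (U i)"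
        by (auto simp: V_def)
    qed
    finally show "hausdorff_pre k \<delta> A + hausdorff_pre k \<delta> B \<le> (\<Sum>i. hausdorff_weight k (U i))" .
  qed
  have "hausdorff_pre k \<delta> A + hausdorff_pre k \<delta>' B \<le> hausdorff_outer k (A \<union> B)" if "\<delta> > 0" "\<delta>' > 0" for \<delta> \<delta>'
  proof -
    define \<eta> where "\<eta> = min (min \<delta> \<delta>') (d/2)"
    have \<eta>: "0 < \<eta>" "\<eta> < d" "\<eta> \<le> \<delta>" "\<eta> \<le> \<delta>'" using that d by (auto simp: \<eta>_def)
    have "hausdorff_pre k \<delta> A + hausdorff_pre k \<delta>' B \<le> hausdorff_pre k \<eta> A + hausdorff_pre k \<eta> B"
      using \<eta> by (intro add_mono hausdorff_pre_antimono) auto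
    also have "\<dots> \<le> hausdorff_pre k \<eta> (A \<union> B)" using \<eta> by (intro small) auto
    also have "\<dots> \<le> hausdorff_outer k (A \<union> B)" using \<eta> by (auto simp: hausdorff_outer_def intro: SUP_upper)
    finally show ?thesis .
  qed
  note both = this
  have "hausdorff_pre k \<delta> A + hausdorff_outer k B \<le> hausdorff_outer k (A \<union> B)" if "\<delta> > 0" for \<delta>
    unfolding hausdorff_outer_def[of k B]
    using both[OF that] by (subst ennreal_SUP_add_right) (auto intro!: SUP_least)
  thus ?thesis
    unfolding hausdorff_outer_def[of k A]
    by (subst ennreal_SUP_add_left[symmetric]) (auto intro!: SUP_least)
qed

text \<open>\<open>measure_of\<close> enlarges the given family to a sigma-algebra and falls back to
  the zero measure if the given function is not a measure on it; Caratheodory's theorem rules out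
  both changes.\<close>

lemma
  shows space_hausdorff_measure [simp]: "space (hausdorff_measure k :: 'a::metric_space measure) = UNIV"
    and sets_hausdorff_measure: "sets (hausdorff_measure k :: 'a measure) =
      lambda_system UNIV (Pow UNIV) (hausdorff_outer k)"
    and emeasure_hausdorff_measure: "A \<in> sets (hausdorff_measure k :: 'a measure) \<Longrightarrow>
      emeasure (hausdorff_measure k) A = hausdorff_outer k A"
proof -
  let ?L = "lambda_system UNIV (Pow UNIV) (hausdorff_outer k :: 'a set \<Rightarrow> ennreal)"
  interpret P: sigma_algebra "UNIV :: 'a set" "Pow UNIV" by (rule sigma_algebra_Pow)
  have m: "measure_space UNIV ?L (hausdorff_outer k)"
    by (rule P.caratheodory_lemma[OF outer_measure_space_hausdorff])
  hence sa: "sigma_algebra UNIV ?L" by (simp add: measure_space_def)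
  show "space (hausdorff_measure k :: 'a measure) = UNIV"
    by (simp add: hausdorff_measure_def space_measure_of_conv)
  show s: "sets (hausdorff_measure k :: 'a measure) = ?L"
    unfolding hausdorff_measure_def by (rule sigma_algebra.sets_measure_of_eq[OF sa])
  show "A \<in> sets (hausdorff_measure k :: 'a measure) \<Longrightarrow>
      emeasure (hausdorff_measure k) A = hausdorff_outer k A"
    using m sa unfolding s unfolding hausdorff_measure_def measure_space_def
    by (intro emeasure_measure_of_sigma) auto
qed

lemma borel_subset_hausdorff: "sets borel \<subseteq> sets (hausdorff_measure k :: 'a::metric_space measure)"
proof -
  have "sigma_sets UNIV (Collect closed) \<subseteq> sets (hausdorff_measure k :: 'a measure)"
  proof (rule sets.sigma_sets_subset[of _ "hausdorff_measure k :: 'a measure", simplified])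
    show "Collect closed \<subseteq> sets (hausdorff_measure k :: 'a measure)"
      unfolding sets_hausdorff_measure
    proof
      fix F :: "'a set" assume "F \<in> Collect closed"
      hence F: "closed F" by simp
      show "F \<in> lambda_system UNIV (Pow UNIV) (hausdorff_outer k)"
        by (rule metric_outer_measure_closed[OF outer_measure_space_hausdorff _ F])
           (rule hausdorff_outer_separated)
    qed
  qed
  thus ?thesis by (simp add: borel_eq_closed)
qed

section \<open>Hausdorff measure of Lipschitz graphs\<close>

text \<open>Says that \<open>S\<close> lies in an \<open>L\<close>-Lipschitz graph over the
  hyperplane orthogonal to \<open>e\<close>, without naming a graph function: chords of
  \<open>S\<close> have slope at most \<open>L\<close>. The condition passes to subsets, and packing
  arguments use it in this form.\<close>

definition cone_set :: "'a::real_inner \<Rightarrow> real \<Rightarrow> 'a set \<Rightarrow> bool" where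
  "cone_set e L S \<longleftrightarrow> norm e = 1 \<and> 0 \<le> L \<and>
     (\<forall>x\<in>S. \<forall>y\<in>S. \<bar>(x - y) \<bullet> e\<bar> \<le> L * norm ((x - y) - ((x - y) \<bullet> e) *\<^sub>R e))"

lemma norm_orthogonal_part_le:
  fixes a e :: "'a::real_inner"
  assumes "norm e = 1"
  shows "norm (a - (a \<bullet> e) *\<^sub>R e) \<le> norm a"
proof -
  have ee: "e \<bullet> e = 1" using assms by (simp add: dot_square_norm)
  have "(norm (a - (a \<bullet> e) *\<^sub>R e))\<^sup>2 = (norm a)\<^sup>2 - (a \<bullet> e)\<^sup>2"
    unfolding power2_norm_eq_inner
    by (simp add: inner_diff inner_commute ee algebra_simps power2_eq_square)
  also have "\<dots> \<le> (norm a)\<^sup>2" by simp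
  finally show ?thesis by (rule power2_le_imp_le) auto
qed

text \<open>Translating each of the separated points \<open>M\<close> times in direction \<open>e\<close> gives a separated
  family of full dimension, whose size is bounded by comparing volumes.\<close>

lemma cone_set_packing:
  fixes S :: "'a::euclidean_space set"
  assumes cs: "cone_set e L S" and \<delta>: "\<delta> > 0" and M: "M \<ge> (1::nat)"
    and X: "finite X" "X \<subseteq> S \<inter> ball z \<delta>"
    and sep: "\<And>x y. x \<in> X \<Longrightarrow> y \<in> X \<Longrightarrow> x \<noteq> y \<Longrightarrow> \<delta> / M \<le> dist x y"
  shows "real (card X) * real M \<le> (6 * (1 + L) * M) ^ DIM('a)"
proof -
  define \<epsilon> where "\<epsilon> = \<delta> / M"
  \<comment> \<open>The cone condition turns a distance of at least \<epsilon> between points of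
    \<open>S\<close> into a distance of at least \<open>\<epsilon> / (1 + L) = 2 * \<rho>\<close>
    between their projections along \<open>e\<close>. Shifts along \<open>e\<close> leave
    projections alone, so balls of radius \<rho> about shifts of different points are
    disjoint.\<close>
  define \<rho> where "\<rho> = \<epsilon> / (2 * (1 + L))"
  have e: "norm e = 1" and L: "L \<ge> 0"
    and cone: "\<And>x y. x \<in> S \<Longrightarrow> y \<in> S \<Longrightarrow> \<bar>(x - y) \<bullet> e\<bar> \<le> L * norm ((x - y) - ((x - y) \<bullet> e) *\<^sub>R e)"
    using cs by (auto simp: cone_set_def)
  have ee: "e \<bullet> e = 1" using e by (simp add: dot_square_norm)
  have \<epsilon>: "\<epsilon> > 0" "M * \<epsilon> = \<delta>" using \<delta> M by (auto simp: \<epsilon>_def)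
  have \<rho>: "\<rho> > 0" using \<epsilon> L by (simp add: \<rho>_def)
  have \<rho>2: "2 * \<rho> \<le> \<epsilon>"
  proof -
    have "2 * \<rho> = \<epsilon> / (1 + L)" using L by (simp add: \<rho>_def field_simps)
    also have "\<dots> \<le> \<epsilon>" using \<epsilon> L by (simp add: field_simps)
    finally show ?thesis .
  qed
  have "\<epsilon> * 1 \<le> \<epsilon> * real M" using \<epsilon>(1) M by (intro mult_left_mono) auto
  hence \<epsilon>\<delta>: "\<epsilon> \<le> \<delta>" using \<epsilon>(2) by (simp only: mult.commute mult_1)
  define c where "c = (\<lambda>(x, m). x + (real m * \<epsilon>) *\<^sub>R e)"
  have far: "2 * \<rho> \<le> dist (c p) (c q)" if p: "p \<in> X \<times> {..<M}" and q: "q \<in> X \<times> {..<M}" and ne: "p \<noteq> q" for p q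
  proof -
    obtain x m where pp: "p = (x, m)" "x \<in> X" using p by auto
    obtain y l where qq: "q = (y, l)" "y \<in> X" using q by auto
    show ?thesis
    proof (cases "x = y")
      case True
      have "dist (c p) (c q) = norm ((real m * \<epsilon> - real l * \<epsilon>) *\<^sub>R e)"
        by (simp add: c_def pp qq dist_norm True scaleR_diff_left)
      also have "\<dots> = \<bar>(real m - real l) * \<epsilon>\<bar>"
        unfolding norm_scaleR e by (simp add: left_diff_distrib)
      also have "\<dots> = \<bar>real m - real l\<bar> * \<epsilon>" using \<epsilon> by (simp add: abs_mult)
      also have "\<bar>real m - real l\<bar> \<ge> 1" using ne True pp qq by auto
      hence "\<bar>real m - real l\<bar> * \<epsilon> \<ge> 1 * \<epsilon>" using \<epsilon> by (intro mult_right_mono) auto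
      finally show ?thesis using \<rho>2 by linarith
    next
      case False
      define a where "a = x - y"
      define N where "N = norm (a - (a \<bullet> e) *\<^sub>R e)"
      have "\<epsilon> \<le> norm a" using sep[of x y] False pp qq by (simp add: \<epsilon>_def a_def dist_norm)
      also have "norm a \<le> N + norm ((a \<bullet> e) *\<^sub>R e)"
        unfolding N_def using norm_triangle_ineq[of "a - (a \<bullet> e) *\<^sub>R e" "(a \<bullet> e) *\<^sub>R e"] by simp
      also have "\<dots> = N + \<bar>a \<bullet> e\<bar>" by (simp add: e)
      also have "\<dots> \<le> N + L * N" using cone[of x y] pp qq X(2) by (auto simp: a_def N_def)
      finally have "\<epsilon> \<le> (1 + L) * N" by (simp add: algebra_simps)
      hence "2 * \<rho> \<le> N" using L by (simp add: \<rho>_def field_simps)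
      also have "N \<le> dist (c p) (c q)"
      proof -
        define b where "b = c p - c q"
        have b: "b = a + (real m * \<epsilon> - real l * \<epsilon>) *\<^sub>R e"
          by (simp add: b_def c_def pp qq a_def algebra_simps)
        have "a - (a \<bullet> e) *\<^sub>R e = b - (b \<bullet> e) *\<^sub>R e"
          unfolding b by (simp add: inner_add inner_diff ee algebra_simps)
        thus ?thesis unfolding N_def dist_norm b_def[symmetric]
          using norm_orthogonal_part_le[OF e, of b] by simp
      qed
      finally show ?thesis .
    qed
  qed
  have disj: "disjoint_family_on (\<lambda>p. ball (c p) \<rho>) (X \<times> {..<M})"
    unfolding disjoint_family_on_def
  proof (intro ballI impI)
    fix p q assume "p \<in> X \<times> {..<M}" "q \<in> X \<times> {..<M}" "p \<noteq> q"
    from far[OF this] show "ball (c p) \<rho> \<inter> ball (c q) \<rho> = {}"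
      by (intro disjoint_ballI) auto
  qed
  \<comment> \<open>Three lengths of at most \<delta> add up: from \<open>z\<close> to
    \<open>x\<close>, the shift by at most \<open>M * \<epsilon> = \<delta>\<close>, and the radius
    \<rho>. This 3 and the factor \<open>2 * (1 + L)\<close> in \<rho> make the
    \<open>6 * (1 + L)\<close> of the bound.\<close>
  have inside: "ball (c p) \<rho> \<subseteq> ball z (3 * \<delta>)" if p: "p \<in> X \<times> {..<M}" for p
  proof
    fix u assume u: "u \<in> ball (c p) \<rho>"
    obtain x m where pp: "p = (x, m)" "x \<in> X" "m < M" using p by auto
    have "dist (c p) x = real m * \<epsilon>" using \<epsilon> by (simp add: c_def pp dist_norm e)
    also have "\<dots> \<le> real M * \<epsilon>" using pp \<epsilon> by (intro mult_right_mono) auto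
    finally have 1: "dist (c p) x \<le> \<delta>" using \<epsilon> by simp
    have 2: "dist z x < \<delta>" using pp X(2) by auto
    have "dist z u \<le> dist z x + dist x (c p) + dist (c p) u"
      using dist_triangle[of z u x] dist_triangle[of x u "c p"] by linarith
    also have "\<dots> < \<delta> + \<delta> + \<rho>" using 1 2 u by (simp add: dist_commute)
    finally show "u \<in> ball z (3 * \<delta>)" using \<rho>2 \<epsilon>\<delta> \<rho> by simp
  qed
  define V where "V = unit_ball_vol (real DIM('a))"
  have V: "V > 0" by (simp add: V_def)
  have "(\<Sum>p\<in>X \<times> {..<M}. emeasure lborel (ball (c p) \<rho>)) = emeasure lborel (\<Union>p\<in>X \<times> {..<M}. ball (c p) \<rho>)"
    using X disj by (intro sum_emeasure) auto
  also have "\<dots> \<le> emeasure lborel (ball z (3 * \<delta>))"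
    using inside by (intro emeasure_mono) auto
  finally have "ennreal (real (card X * M) * (V * \<rho> ^ DIM('a))) \<le> ennreal (V * (3 * \<delta>) ^ DIM('a))"
    using \<rho> \<delta> V by (simp add: emeasure_ball V_def card_cartesian_product ennreal_mult ennreal_of_nat_eq_real_of_nat)
  hence "real (card X * M) * (V * \<rho> ^ DIM('a)) \<le> V * (3 * \<delta>) ^ DIM('a)"
    using V \<delta> by (subst (asm) ennreal_le_iff) auto
  hence "real (card X * M) * \<rho> ^ DIM('a) \<le> (3 * \<delta>) ^ DIM('a)"
    using V by (simp add: ac_simps)
  hence "real (card X * M) \<le> (3 * \<delta>) ^ DIM('a) / \<rho> ^ DIM('a)"
    using \<rho> by (simp add: pos_le_divide_eq)
  also have "\<dots> = (3 * \<delta> / \<rho>) ^ DIM('a)" by (simp add: power_divide)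
  also have "3 * \<delta> / \<rho> = 6 * (1 + L) * M"
    using \<epsilon>(1) L by (simp add: \<rho>_def \<epsilon>(2)[symmetric] field_simps)
  finally show ?thesis by simp
qed

text \<open>A separated set of largest cardinality is automatically an \<epsilon>-net, since a point
  outside the balls could be added to it. The a priori bound \<open>N\<close> makes the largest
  cardinality exist.\<close>

lemma ex_maximal_separated:
  fixes A :: "'a::metric_space set"
  assumes bound: "\<And>X. finite X \<Longrightarrow> X \<subseteq> A \<Longrightarrow> (\<And>x y. x \<in> X \<Longrightarrow> y \<in> X \<Longrightarrow> x \<noteq> y \<Longrightarrow> \<epsilon> \<le> dist x y) \<Longrightarrow>
      card X \<le> N"
    and \<epsilon>: "\<epsilon> > 0"
  obtains X where "finite X" "X \<subseteq> A" "\<And>x y. x \<in> X \<Longrightarrow> y \<in> X \<Longrightarrow> x \<noteq> y \<Longrightarrow> \<epsilon> \<le> dist x y"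
    "A \<subseteq> (\<Union>x\<in>X. ball x \<epsilon>)"
proof -
  let ?P = "\<lambda>X. finite X \<and> X \<subseteq> A \<and> (\<forall>x\<in>X. \<forall>y\<in>X. x \<noteq> y \<longrightarrow> \<epsilon> \<le> dist x y)"
  have "\<exists>X. ?P X \<and> (\<forall>Y. ?P Y \<longrightarrow> card Y \<le> card X)"
  proof (rule ex_has_greatest_nat[of ?P "{}" card "Suc N"])
    show "\<forall>y. ?P y \<longrightarrow> card y < Suc N"
    proof (intro allI impI)
      fix Y assume Y: "?P Y"
      have "card Y \<le> N" by (rule bound) (use Y in blast)+
      thus "card Y < Suc N" by simp
    qed
  qed auto
  then obtain X where X_max: "?P X \<and> (\<forall>Y. ?P Y \<longrightarrow> card Y \<le> card X)" by (rule exE)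
  hence X: "?P X" by (rule conjunct1)
  have max: "card Y \<le> card X" if "?P Y" for Y
    using X_max[THEN conjunct2, THEN spec, THEN mp, OF that] .
  have "A \<subseteq> (\<Union>x\<in>X. ball x \<epsilon>)"
  proof (rule ccontr)
    assume "\<not> ?thesis"
    then obtain a where "a \<in> A" "a \<notin> (\<Union>x\<in>X. ball x \<epsilon>)" by blast
    hence a: "a \<in> A" "\<forall>x\<in>X. \<epsilon> \<le> dist x a" by (auto simp: not_less)
    have "a \<notin> X" using a(2) \<epsilon> by force
    hence "card (insert a X) = Suc (card X)" using X by simp
    moreover have "?P (insert a X)" using X a by (auto simp: dist_commute)
    ultimately show False using max[of "insert a X"] by simp
  qed
  thus ?thesis using X by (intro that[of X]) auto
qed

text \<open>Balls of radius \<open>\<epsilon> = \<delta> / M\<close> about a maximal separated set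
  form the cover. By packing there are at most \<open>(6 * (1 + L)) ^ n * M ^ (n - 1)\<close> of
  them, exactly the power of \<open>M\<close> that cancels against
  \<open>\<epsilon> ^ (n - 1)\<close>, so the bound does not depend on the mesh.\<close>

lemma cone_set_hausdorff:
  fixes S :: "'a::euclidean_space set"
  assumes cs: "cone_set e L S" and \<delta>: "\<delta> > 0"
  shows "hausdorff_outer (DIM('a) - 1) (S \<inter> ball z \<delta>)
    \<le> ennreal (unit_ball_vol (real (DIM('a) - 1)) * (6 * (1 + L)) ^ DIM('a) * \<delta> ^ (DIM('a) - 1))"
  unfolding hausdorff_outer_def
proof (rule SUP_least)
  fix \<eta> :: real assume "\<eta> \<in> {0<..}"
  hence \<eta>: "\<eta> > 0" by simp
  define n where "n = DIM('a)"
  define k where "k = n - 1"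
  have n: "n = Suc k" by (simp add: n_def k_def)
  \<comment> \<open>Large enough that balls of radius \<open>\<delta> / M\<close> have diameter at
    most the prescribed mesh \<eta>.\<close>
  define M where "M = nat \<lceil>2 * \<delta> / \<eta>\<rceil> + 1"
  have M: "M \<ge> 1" "2 * \<delta> / \<eta> \<le> real M" unfolding M_def by linarith+
  define \<epsilon> where "\<epsilon> = \<delta> / M"
  have \<epsilon>: "\<epsilon> > 0" "2 * \<epsilon> \<le> \<eta>" using M \<eta> \<delta> by (auto simp: \<epsilon>_def field_simps)
  have L: "L \<ge> 0" using cs by (simp add: cone_set_def)
  let ?B = "(6 * (1 + L)) ^ n * real M ^ k"
  have bnd: "real (card X) \<le> ?B"
    if "finite X" "X \<subseteq> S \<inter> ball z \<delta>" "\<And>x y. x \<in> X \<Longrightarrow> y \<in> X \<Longrightarrow> x \<noteq> y \<Longrightarrow> \<epsilon> \<le> dist x y" for X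
  proof -
    have "real (card X) * real M \<le> (6 * (1 + L) * M) ^ n"
      unfolding n_def by (rule cone_set_packing[OF cs \<delta> M(1) that(1,2)]) (use that(3) in \<open>auto simp: \<epsilon>_def\<close>)
    also have "\<dots> = ?B * M" by (simp add: n power_mult_distrib)
    finally show ?thesis using M by simp
  qed
  obtain X where X: "finite X" "X \<subseteq> S \<inter> ball z \<delta>" "\<And>x y. x \<in> X \<Longrightarrow> y \<in> X \<Longrightarrow> x \<noteq> y \<Longrightarrow> \<epsilon> \<le> dist x y"
    and cov: "S \<inter> ball z \<delta> \<subseteq> (\<Union>x\<in>X. ball x \<epsilon>)"
  proof (rule ex_maximal_separated[of "S \<inter> ball z \<delta>" \<epsilon> "nat \<lfloor>?B\<rfloor>"])
    fix X assume "finite X" "X \<subseteq> S \<inter> ball z \<delta>" "\<And>x y. x \<in> X \<Longrightarrow> y \<in> X \<Longrightarrow> x \<noteq> y \<Longrightarrow> \<epsilon> \<le> dist x y"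
    from bnd[OF this] show "card X \<le> nat \<lfloor>?B\<rfloor>" by (simp add: le_nat_floor)
  qed (use \<epsilon> in auto)
  obtain h where h: "bij_betw h {0..<card X} X" using ex_bij_betw_nat_finite[OF X(1)] by blast
  \<comment> \<open>Padding the finite cover to a sequence is free: the empty set has weight 0, also
    for \<open>k = 0\<close>, where every nonempty set weighs 1.\<close>
  define U where "U i = (if i < card X then ball (h i) \<epsilon> else {})" for i
  have dU: "diameter (U i) \<le> 2 * \<epsilon>" for i
    using \<epsilon> by (auto simp: U_def)
  have "hausdorff_pre k \<eta> (S \<inter> ball z \<delta>) \<le> (\<Sum>i. hausdorff_weight k (U i))"
  proof (rule hausdorff_pre_le)
    show "S \<inter> ball z \<delta> \<subseteq> (\<Union>i. U i)"
    proof
      fix u assume "u \<in> S \<inter> ball z \<delta>"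
      then obtain x where "x \<in> X" "u \<in> ball x \<epsilon>" using cov by blast
      moreover have "x \<in> h ` {0..<card X}" using h \<open>x \<in> X\<close> by (simp add: bij_betw_def)
      then obtain i where "i < card X" "h i = x" by auto
      ultimately show "u \<in> (\<Union>i. U i)" by (intro UN_I[of i]) (simp_all add: U_def)
    qed
    show "diameter (U i) \<le> \<eta>" for i using dU[of i] \<epsilon> by linarith
  qed (auto simp: U_def)
  also have "\<dots> = (\<Sum>i<card X. hausdorff_weight k (U i))"
    by (rule suminf_finite) (auto simp: U_def)
  also have "\<dots> \<le> (\<Sum>i<card X. ennreal (unit_ball_vol (real k) * \<epsilon> ^ k))"
  proof (rule sum_mono)
    fix i
    have "unit_ball_vol (real k) * (diameter (U i) / 2) ^ k \<le> unit_ball_vol (real k) * \<epsilon> ^ k"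
      using dU[of i] by (intro mult_left_mono power_mono) (auto intro: diameter_ge_0 simp: U_def)
    thus "hausdorff_weight k (U i) \<le> ennreal (unit_ball_vol (real k) * \<epsilon> ^ k)"
      unfolding hausdorff_weight_def using \<epsilon> by (intro ennreal_leI) auto
  qed
  also have "\<dots> = ennreal (real (card X) * (unit_ball_vol (real k) * \<epsilon> ^ k))"
    using \<epsilon> by (simp add: ennreal_mult ennreal_of_nat_eq_real_of_nat)
  also have "\<dots> \<le> ennreal (?B * (unit_ball_vol (real k) * \<epsilon> ^ k))"
    using bnd[OF X] \<epsilon> by (intro ennreal_leI mult_right_mono) auto
  also have "?B * (unit_ball_vol (real k) * \<epsilon> ^ k) = unit_ball_vol (real k) * (6 * (1 + L)) ^ n * \<delta> ^ k"
    using M by (simp add: \<epsilon>_def power_divide)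
  finally show "hausdorff_pre (DIM('a) - 1) \<eta> (S \<inter> ball z \<delta>)
    \<le> ennreal (unit_ball_vol (real (DIM('a) - 1)) * (6 * (1 + L)) ^ DIM('a) * \<delta> ^ (DIM('a) - 1))"
    by (simp add: n_def k_def)
qed

section \<open>Smooth bump functions\<close>

lemma C_k_SucD: "C_k (Suc k) \<phi> \<Longrightarrow> C_k k \<phi>"
proof (induction k arbitrary: \<phi>)
  case 0
  thus ?case
    by (auto intro!: continuous_at_imp_continuous_on differentiable_imp_continuous_within)
next
  case (Suc k)
  thus ?case by (metis C_k.simps(2))
qed

lemma frechet_derivative_eqI: "(\<phi> has_derivative D) (at x) \<Longrightarrow> frechet_derivative \<phi> (at x) = D"
  using frechet_derivative_at by metis

lemma C_k_add: "C_k k f \<Longrightarrow> C_k k g \<Longrightarrow> C_k k (\<lambda>x. f x + g x)"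
proof (induction k arbitrary: f g)
  case 0 thus ?case by (auto intro: continuous_intros)
next
  case (Suc k)
  have d: "((\<lambda>x. f x + g x) has_derivative
      (\<lambda>h. frechet_derivative f (at x) h + frechet_derivative g (at x) h)) (at x)" for x
    using Suc.prems by (intro has_derivative_add) (simp_all add: frechet_derivative_works)
  have "(\<lambda>x. f x + g x) differentiable (at x)" for x using d differentiable_def by blast
  thus ?case using Suc by (simp add: frechet_derivative_eqI[OF d])
qed

lemma C_k_mult: "C_k k f \<Longrightarrow> C_k k g \<Longrightarrow> C_k k (\<lambda>x. f x * g x)"
proof (induction k arbitrary: f g)
  case 0 thus ?case by (auto intro: continuous_intros)
next
  case (Suc k)
  have d: "((\<lambda>x. f x * g x) has_derivative
      (\<lambda>h. f x * frechet_derivative g (at x) h + frechet_derivative f (at x) h * g x)) (at x)" for x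
    using Suc.prems by (intro has_derivative_mult) (simp_all add: frechet_derivative_works)
  have "(\<lambda>x. f x * g x) differentiable (at x)" for x using d differentiable_def by blast
  moreover have "C_k k f" "C_k k g" using Suc.prems by (blast intro: C_k_SucD)+
  ultimately show ?case using Suc by (simp add: frechet_derivative_eqI[OF d] C_k_add)
qed

lemma C_k_const: "C_k k (\<lambda>x. c)"
proof (induction k arbitrary: c)
  case (Suc k) thus ?case by (simp add: frechet_derivative_const)
qed simp

lemma smooth_add: "smooth f \<Longrightarrow> smooth g \<Longrightarrow> smooth (\<lambda>x. f x + g x)"
  by (simp add: smooth_def C_k_add)

lemma smooth_mult: "smooth f \<Longrightarrow> smooth g \<Longrightarrow> smooth (\<lambda>x. f x * g x)"
  by (simp add: smooth_def C_k_mult)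

lemma smooth_const: "smooth (\<lambda>x. c)"
  by (simp add: smooth_def C_k_const)

lemma smooth_diff: "smooth f \<Longrightarrow> smooth g \<Longrightarrow> smooth (\<lambda>x. f x - g x)"
  using smooth_add[OF _ smooth_mult[OF smooth_const[of "-1"]], of f g] by simp

lemma smooth_prod: "finite I \<Longrightarrow> (\<And>i. i \<in> I \<Longrightarrow> smooth (f i)) \<Longrightarrow> smooth (\<lambda>x. \<Prod>i\<in>I. f i x)"
  by (induction I rule: finite_induct) (simp_all add: smooth_const smooth_mult)

lemma smooth_differentiable: "smooth \<phi> \<Longrightarrow> \<phi> differentiable (at x)"
  unfolding smooth_def by (metis C_k.simps(2))

lemma smooth_has_gradient:
  assumes "smooth \<phi>" shows "(\<phi> has_derivative (\<lambda>h. gradient \<phi> x \<bullet> h)) (at x)"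
proof -
  have d: "(\<phi> has_derivative frechet_derivative \<phi> (at x)) (at x)"
    using smooth_differentiable[OF assms] by (simp add: frechet_derivative_works)
  interpret linear "frechet_derivative \<phi> (at x)"
    using d by (rule has_derivative_linear)
  have "frechet_derivative \<phi> (at x) h = gradient \<phi> x \<bullet> h" for h
  proof -
    have "frechet_derivative \<phi> (at x) h = frechet_derivative \<phi> (at x) (\<Sum>i\<in>UNIV. h $ i *\<^sub>R axis i 1)"
      using basis_expansion[of h] by (simp add: scalar_mult_eq_scaleR)
    also have "\<dots> = gradient \<phi> x \<bullet> h"
      by (simp add: sum scale inner_vec_def gradient_def mult.commute)
    finally show ?thesis .
  qed
  thus ?thesis using d by (metis (no_types, lifting) ext)
qed

lemma gradient_eqI: "(\<phi> has_derivative (\<lambda>h. g \<bullet> h)) (at x) \<Longrightarrow> gradient \<phi> x = g"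
  by (simp add: gradient_def frechet_derivative_eqI inner_axis vec_eq_iff)

lemma smooth_continuous_on: "smooth \<phi> \<Longrightarrow> continuous_on A \<phi>"
  unfolding smooth_def using C_k.simps(1) continuous_on_subset by blast

lemma smooth_continuous_on_gradient:
  assumes "smooth \<phi>" shows "continuous_on A (gradient \<phi>)"
proof -
  have "C_k (Suc 0) \<phi>" using assms unfolding smooth_def by blast
  hence "continuous_on UNIV (\<lambda>x. gradient \<phi> x $ i)" for i by (simp add: gradient_def)
  hence "continuous_on UNIV (gradient \<phi>)"
    by (subst continuous_on_componentwise) (auto simp: Basis_vec_def inner_axis)
  thus ?thesis using continuous_on_subset by blast
qed

text \<open>This family is closed under differentiation, which gives smoothness by induction.\<close>

definition exp_kernel :: "real poly \<Rightarrow> real \<Rightarrow> real" where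
  "exp_kernel P t = (if t > 0 then poly P (inverse t) * exp (- inverse t) else 0)"

lemma tendsto_poly_exp: "((\<lambda>x. poly P x * exp (- x :: real)) \<longlongrightarrow> 0) at_top"
proof -
  have "((\<lambda>x. \<Sum>i\<le>degree P. coeff P i * (x ^ i / exp x)) \<longlongrightarrow> (\<Sum>i\<le>degree P. coeff P i * 0)) at_top"
    by (intro tendsto_intros tendsto_power_div_exp_0)
  thus ?thesis
    by (simp add: poly_altdef sum_distrib_left sum_distrib_right exp_minus divide_inverse mult.assoc)
qed

text \<open>With \<open>s = 1 / t\<close> the chain rule multiplies the derivative of
  \<open>poly P s * exp (- s)\<close> by \<open>- s ^ 2\<close>, which gives the polynomial
  \<open>monom 1 2 * (P - pderiv P)\<close>. At 0 the right difference quotient is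
  \<open>s * poly P s * exp (- s)\<close>, again a kernel of this kind, with polynomial
  \<open>pCons 0 P\<close>, and it tends to 0.\<close>

lemma exp_kernel_has_derivative:
  "(exp_kernel P has_real_derivative exp_kernel (monom 1 2 * (P - pderiv P)) t) (at t)"
proof (cases t "0::real" rule: linorder_cases)
  case greater
  have "((\<lambda>t. poly P (inverse t) * exp (- inverse t)) has_real_derivative
      exp_kernel (monom 1 2 * (P - pderiv P)) t) (at t)"
    using greater by (auto intro!: derivative_eq_intros DERIV_chain2[where f="poly P"] poly_DERIV
      simp: exp_kernel_def poly_monom algebra_simps power2_eq_square)
  moreover have "\<forall>\<^sub>F s in nhds t. exp_kernel P s = poly P (inverse s) * exp (- inverse s)"
    using eventually_nhds_in_open[of "{0<..}" t] greater
    by (auto simp: exp_kernel_def elim!: eventually_mono)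
  ultimately show ?thesis by (subst DERIV_cong_ev) auto
next
  case less
  have "\<forall>\<^sub>F s in nhds t. exp_kernel P s = 0"
    using eventually_nhds_in_open[of "{..<0}" t] less
    by (auto simp: exp_kernel_def elim!: eventually_mono)
  thus ?thesis using less by (subst DERIV_cong_ev[where g="\<lambda>_. 0"]) (auto simp: exp_kernel_def)
next
  case equal
  have "((\<lambda>h. (exp_kernel P (0 + h) - exp_kernel P 0) / h) \<longlongrightarrow> 0) (at 0)"
    unfolding filterlim_at_split
  proof
    show "((\<lambda>h. (exp_kernel P (0 + h) - exp_kernel P 0) / h) \<longlongrightarrow> 0) (at_left 0)"
      by (rule tendsto_eventually)
         (auto simp: eventually_at_filter exp_kernel_def)
    have "((\<lambda>h. poly (pCons 0 P) (inverse h) * exp (- inverse h :: real)) \<longlongrightarrow> 0) (at_right 0)"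
      by (rule filterlim_compose[OF tendsto_poly_exp filterlim_inverse_at_top_right])
    moreover have "\<forall>\<^sub>F h in at_right 0. poly (pCons 0 P) (inverse h) * exp (- inverse h :: real)
        = (exp_kernel P (0 + h) - exp_kernel P 0) / h"
      by (simp add: eventually_at_filter exp_kernel_def divide_inverse)
    ultimately show "((\<lambda>h. (exp_kernel P (0 + h) - exp_kernel P 0) / h) \<longlongrightarrow> 0) (at_right 0)"
      using tendsto_cong by force
  qed
  thus ?thesis using equal by (simp add: DERIV_def exp_kernel_def)
qed

lemma exp_kernel_smult: "exp_kernel (smult c P) t = c * exp_kernel P t"
  by (simp add: exp_kernel_def)

lemma smooth_exp_kernel: "smooth (\<lambda>x::real^'n. exp_kernel P (s * (x $ i) + d))"
proof -
  have "C_k k (\<lambda>x::real^'n. exp_kernel P (s * (x $ i) + d))" for k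
  proof (induction k arbitrary: P)
    case 0
    have "continuous_on UNIV (exp_kernel P)"
      using exp_kernel_has_derivative
      by (intro continuous_at_imp_continuous_on ballI) (metis DERIV_isCont)
    thus ?case by (auto intro!: continuous_intros continuous_on_compose2[of UNIV "exp_kernel P"])
  next
    case (Suc k)
    define Q where "Q = monom 1 2 * (P - pderiv P)"
    have d: "((\<lambda>x::real^'n. exp_kernel P (s * (x $ i) + d)) has_derivative
      (\<lambda>h. (s * (h $ i)) * exp_kernel Q (s * (x $ i) + d))) (at x)" for x
    proof (rule has_derivative_compose[where f="\<lambda>x::real^'n. s * (x $ i) + d" and g="exp_kernel P",
        THEN has_derivative_eq_rhs])
      show "((\<lambda>x::real^'n. s * (x $ i) + d) has_derivative (\<lambda>h. s * (h $ i))) (at x)"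
        by (intro has_derivative_add_const has_derivative_mult_right bounded_linear_imp_has_derivative
            bounded_linear_vec_nth)
      show "(exp_kernel P has_derivative (*) (exp_kernel Q (s * (x $ i) + d))) (at (s * (x $ i) + d))"
        using exp_kernel_has_derivative[of P "s * (x $ i) + d"] by (simp add: has_field_derivative_def Q_def)
    qed (auto simp: mult.commute)
    \<comment> \<open>The constant from the chain rule is absorbed into the polynomial, so that the
      induction hypothesis, general in \<open>P\<close>, applies.\<close>
    have "C_k k (\<lambda>x. (s * (axis j 1 $ i)) * exp_kernel Q (s * (x $ i) + d))" for j
      using Suc.IH[of "smult (s * (axis j 1 $ i)) Q"] by (simp add: exp_kernel_smult)
    moreover have "(\<lambda>x::real^'n. exp_kernel P (s * (x $ i) + d)) differentiable (at x)" for x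
      using d differentiable_def by blast
    ultimately show ?case by (simp add: frechet_derivative_eqI[OF d])
  qed
  thus ?thesis by (simp add: smooth_def)
qed

text \<open>Each coordinate carries two one-sided cut-offs \<open>exp (- 1 / t)\<close>, one per
  face. The scale \<open>Suc m\<close> steepens them, so that for growing \<open>m\<close> the bumps
  stay in [0, 1] and tend to the indicator of the open box. The arguments are written to match
  \<open>smooth_exp_kernel\<close>.\<close>

definition box_bump :: "nat \<Rightarrow> real^'n \<Rightarrow> real^'n \<Rightarrow> real^'n \<Rightarrow> real" where
  "box_bump m a b x = (\<Prod>i\<in>UNIV. exp_kernel 1 (real (Suc m) * (x $ i) + - (real (Suc m) * (a $ i))) *
      exp_kernel 1 (- real (Suc m) * (x $ i) + real (Suc m) * (b $ i)))"

lemma smooth_box_bump: "smooth (box_bump m a b)"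
  unfolding box_bump_def by (intro smooth_prod smooth_mult smooth_exp_kernel) auto

lemma exp_kernel_1: "0 \<le> exp_kernel 1 t" "exp_kernel 1 t \<le> 1" "t \<le> 0 \<Longrightarrow> exp_kernel 1 t = 0"
  by (auto simp: exp_kernel_def)

lemma box_bump_bounds: "0 \<le> box_bump m a b x" "box_bump m a b x \<le> 1"
  unfolding box_bump_def by (auto intro!: prod_nonneg prod_le_1 mult_nonneg_nonneg mult_le_one exp_kernel_1)

lemma box_bump_outside: "x \<notin> box a b \<Longrightarrow> box_bump m a b x = 0"
proof -
  assume "x \<notin> box a b"
  then obtain i where i: "x $ i \<le> a $ i \<or> b $ i \<le> x $ i" by (auto simp: mem_box_cart not_less)
  have m: "real (Suc m) \<ge> 0" by simp
  have "real (Suc m) * (x $ i) \<le> real (Suc m) * (a $ i) \<or> real (Suc m) * (b $ i) \<le> real (Suc m) * (x $ i)"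
    using i mult_left_mono[OF _ m] by blast
  hence "exp_kernel 1 (real (Suc m) * (x $ i) + - (real (Suc m) * (a $ i))) = 0 \<or>
      exp_kernel 1 (- real (Suc m) * (x $ i) + real (Suc m) * (b $ i)) = 0"
  proof (elim disjE)
    assume "real (Suc m) * (x $ i) \<le> real (Suc m) * (a $ i)"
    thus ?thesis by (intro disjI1 exp_kernel_1(3)) simp
  next
    assume "real (Suc m) * (b $ i) \<le> real (Suc m) * (x $ i)"
    hence "- real (Suc m) * (x $ i) + real (Suc m) * (b $ i) \<le> 0" by (simp only: minus_mult_left[symmetric])
    thus ?thesis by (intro disjI2 exp_kernel_1(3))
  qed
  thus ?thesis unfolding box_bump_def by (intro prod_zero) auto
qed

lemma box_bump_tendsto: "(\<lambda>m. box_bump m a b x) \<longlonglongrightarrow> indicator (box a b) x"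
proof (cases "x \<in> box a b")
  case False thus ?thesis by (simp add: box_bump_outside)
next
  case True
  have k: "(\<lambda>m. exp_kernel 1 (real (Suc m) * s)) \<longlonglongrightarrow> 1" if "s > 0" for s
  proof -
    have "(\<lambda>m. exp (- (inverse (real (Suc m)) * inverse s))) \<longlonglongrightarrow> exp (- (0 * inverse s))"
      by (intro tendsto_intros LIMSEQ_inverse_real_of_nat)
    moreover have "exp_kernel 1 (real (Suc m) * s) = exp (- (inverse (real (Suc m)) * inverse s))" for m
      using that by (simp add: exp_kernel_def zero_less_mult_iff)
    ultimately show ?thesis by simp
  qed
  have "(\<lambda>m. box_bump m a b x) \<longlonglongrightarrow> (\<Prod>i\<in>(UNIV::'a set). 1 * 1)"
    unfolding box_bump_def
  proof (intro tendsto_prod tendsto_mult)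
    fix i
    have "a $ i < x $ i" "x $ i < b $ i" using True by (auto simp: mem_box_cart)
    thus "(\<lambda>m. exp_kernel 1 (real (Suc m) * (x $ i) + - (real (Suc m) * (a $ i)))) \<longlonglongrightarrow> 1"
      "(\<lambda>m. exp_kernel 1 (- real (Suc m) * (x $ i) + real (Suc m) * (b $ i))) \<longlonglongrightarrow> 1"
      using k[of "x $ i - a $ i"] k[of "b $ i - x $ i"] by (simp_all add: algebra_simps)
  qed
  thus ?thesis using True by simp
qed

lemma box_bump_test_function: "cbox a b \<subseteq> \<Omega> \<Longrightarrow> box_bump m a b \<in> test_functions \<Omega>"
proof -
  assume "cbox a b \<subseteq> \<Omega>"
  moreover have "box_bump m a b x = 0" if "x \<notin> cbox a b" for x
    using that box_subset_cbox[of a b] by (intro box_bump_outside) blast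
  ultimately show ?thesis
    unfolding test_functions_def using smooth_box_bump[of m a b] compact_cbox[of a b] by blast
qed

section \<open>The fundamental lemma of the calculus of variations\<close>

text \<open>Boxes are stable under intersection and generate the Borel sets, so Dynkin induction
  applies; the vanishing total integral serves the complement step.\<close>

lemma integral_Borel_sets_eq_0:
  fixes h :: "'a::euclidean_space \<Rightarrow> 'b::euclidean_space"
  assumes int: "integrable lebesgue h"
    and box: "\<And>a b. set_lebesgue_integral lebesgue (box a b) h = 0"
    and all: "integral\<^sup>L lebesgue h = 0"
    and A: "A \<in> sets borel"
  shows "set_lebesgue_integral lebesgue A h = 0"
proof -
  let ?E = "range (\<lambda>(a, b). box a b :: 'a set)"
  have si: "set_integrable lebesgue A h" if "A \<in> sets lebesgue" for A
    unfolding set_integrable_def using int that by (intro integrable_mult_indicator)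
  have sb: "A \<in> sets lebesgue" if "A \<in> sigma_sets UNIV ?E" for A
  proof -
    have "A \<in> sets borel" using that by (simp add: borel_eq_box)
    thus ?thesis by simp
  qed
  have "A \<in> sigma_sets UNIV ?E" using A by (simp add: borel_eq_box)
  have Int_stable: "Int_stable ?E" by (auto simp: Int_stable_def box_Int_box)
  have "?E \<subseteq> Pow UNIV" by simp
  from Int_stable this \<open>A \<in> sigma_sets UNIV ?E\<close> show ?thesis
  proof (induction A rule: sigma_sets_induct_disjoint)
    case (basic A) thus ?case using box by auto
  next
    case empty show ?case by (simp add: set_lebesgue_integral_def)
  next
    case (compl A)
    have "set_lebesgue_integral lebesgue (UNIV - A) h =
        set_lebesgue_integral lebesgue UNIV h - set_lebesgue_integral lebesgue A h"
    proof -
      have "set_lebesgue_integral lebesgue ((UNIV - A) \<union> A) h =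
        set_lebesgue_integral lebesgue (UNIV - A) h + set_lebesgue_integral lebesgue A h"
        using sb[OF compl(1)] by (intro set_integral_Un si) auto
      thus ?thesis by simp
    qed
    thus ?case using compl all by (simp add: set_lebesgue_integral_def)
  next
    case (union A)
    have m: "A i \<in> sets lebesgue" for i using sb union(2) by auto
    have "set_lebesgue_integral lebesgue (\<Union>i. A i) h = (\<Sum>i. set_lebesgue_integral lebesgue (A i) h)"
    proof (rule lebesgue_integral_countable_add)
      show "A i \<inter> A j = {}" if "i \<noteq> j" for i j using union(1) that by (auto simp: disjoint_family_on_def)
      show "set_integrable lebesgue (\<Union>i. A i) h" using m by (intro si) auto
    qed (rule m)
    thus ?case using union by simp
  qed
qed

lemma sigma_finite_lebesgue: "sigma_finite_measure (lebesgue :: 'a::euclidean_space measure)"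
proof
  obtain A :: "'a set set" where A: "countable A" "A \<subseteq> sets lborel" "\<Union>A = space lborel"
      "\<forall>a\<in>A. emeasure lborel a \<noteq> \<infinity>"
    using lborel.sigma_finite_countable by blast
  show "\<exists>A::'a set set. countable A \<and> A \<subseteq> sets lebesgue \<and> \<Union>A = space lebesgue \<and>
      (\<forall>a\<in>A. emeasure lebesgue a \<noteq> \<infinity>)"
    using A by (intro exI[of _ A]) auto
qed

text \<open>A Lebesgue measurable set differs from a Borel set by a null set, so \<open>h\<close>
  integrates to 0 over all measurable sets, and densities with respect to a sigma-finite measure are
  unique.\<close>

lemma AE_zero_if_integral_boxes_zero:
  fixes h :: "'a::euclidean_space \<Rightarrow> 'b::euclidean_space"
  assumes int: "integrable lebesgue h"
    and box: "\<And>a b. set_lebesgue_integral lebesgue (box a b) h = 0"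
    and all: "integral\<^sup>L lebesgue h = 0"
  shows "AE x in lebesgue. h x = 0"
proof (rule sigma_finite_measure.density_unique_banach[OF sigma_finite_lebesgue, of h "\<lambda>_. 0"])
  fix A :: "'a set" assume "A \<in> sets lebesgue"
  then obtain S N N' where A: "A = S \<union> N" "N \<subseteq> N'" "N' \<in> null_sets lborel" "S \<in> sets lborel"
    by (rule sets_completionE)
  have "AE x in lborel. x \<notin> N'" using A(3) by (rule AE_not_in)
  hence ae: "AE x in lebesgue. x \<notin> N'" by (rule AE_completion)
  have "set_lebesgue_integral lebesgue A h = set_lebesgue_integral lebesgue S h"
    unfolding set_lebesgue_integral_def
  proof (rule integral_cong_AE)
    show "AE x in lebesgue. indicat_real A x *\<^sub>R h x = indicat_real S x *\<^sub>R h x"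
      using ae by (rule eventually_mono) (use A(1,2) in \<open>auto simp: indicator_def\<close>)
  qed (use \<open>A \<in> sets lebesgue\<close> A(4) int in \<open>auto intro!: borel_measurable_scaleR borel_measurable_indicator\<close>)
  also have "\<dots> = 0" using A(4) by (intro integral_Borel_sets_eq_0[OF int box all]) simp
  finally show "set_lebesgue_integral lebesgue A h = set_lebesgue_integral lebesgue A (\<lambda>_. 0)"
    by (simp add: set_lebesgue_integral_def)
qed (use int in auto)

lemma integral_lebesgue_on_supported:
  fixes F :: "'a::euclidean_space \<Rightarrow> 'b::euclidean_space"
  assumes "\<Omega> \<in> sets lebesgue" "\<And>x. x \<notin> \<Omega> \<Longrightarrow> F x = 0"
  shows "integral\<^sup>L (lebesgue_on \<Omega>) F = integral\<^sup>L lebesgue F"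
  using assms by (subst integral_restrict_space) (auto intro!: Bochner_Integration.integral_cong simp: indicator_def)

text \<open>Bumps tend boundedly to the indicator of a box, so \<open>G\<close> integrates to 0 over
  every open box whose closed box lies in \<Omega>. Inside one such box all smaller boxes qualify,
  which makes \<open>G\<close> vanish there almost everywhere; countably many of these boxes exhaust
  \<Omega>.\<close>

theorem fundamental_lemma_variations:
  fixes G :: "real^'n \<Rightarrow> 'b::euclidean_space"
  assumes \<Omega>: "open \<Omega>" and G: "locally_integrable \<Omega> G"
    and zero: "\<And>\<phi>. \<phi> \<in> test_functions \<Omega> \<Longrightarrow> (\<integral>x. \<phi> x *\<^sub>R G x \<partial>lebesgue_on \<Omega>) = 0"
  shows "AE x in lebesgue_on \<Omega>. G x = 0"
proof -
  have \<Omega>s: "\<Omega> \<in> sets lebesgue" using \<Omega> by simp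
  have Gint: "integrable lebesgue (\<lambda>x. indicator (cbox a b) x *\<^sub>R G x)" if "cbox a b \<subseteq> \<Omega>" for a b
    using G that unfolding locally_integrable_def set_integrable_def by (metis compact_cbox)
  have box0: "set_lebesgue_integral lebesgue (box a b) G = 0" if sub: "cbox a b \<subseteq> \<Omega>" for a b
  proof -
    \<comment> \<open>\<open>G\<close> is only locally integrable; its restriction to the compact
      box supplies the dominating function.\<close>
    define H where "H x = indicator (cbox a b) x *\<^sub>R G x" for x
    have Hint: "integrable lebesgue H" using Gint[OF sub] by (simp add: H_def[abs_def])
    have "(\<lambda>m. \<integral>x. box_bump m a b x *\<^sub>R H x \<partial>lebesgue)
        \<longlonglongrightarrow> (\<integral>x. indicator (box a b) x *\<^sub>R H x \<partial>lebesgue)"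
    proof (rule integral_dominated_convergence[where w="\<lambda>x. norm (H x)"])
      have bb: "box_bump m a b \<in> borel_measurable lebesgue" for m
        by (intro measurable_completion) (auto intro!: borel_measurable_continuous_onI smooth_continuous_on smooth_box_bump)
      show "(\<lambda>x. box_bump m a b x *\<^sub>R H x) \<in> borel_measurable lebesgue" for m
        by (rule borel_measurable_scaleR[OF bb borel_measurable_integrable[OF Hint]])
      show "(\<lambda>x. indicator (box a b) x *\<^sub>R H x) \<in> borel_measurable lebesgue"
        by (rule borel_measurable_scaleR[OF _ borel_measurable_integrable[OF Hint]])
           (rule borel_measurable_indicator, simp)
      show "AE x in lebesgue. (\<lambda>m. box_bump m a b x *\<^sub>R H x)
          \<longlonglongrightarrow> indicator (box a b) x *\<^sub>R H x"
        by (intro AE_I2 tendsto_scaleR box_bump_tendsto tendsto_const)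
      show "AE x in lebesgue. norm (box_bump m a b x *\<^sub>R H x)
          \<le> norm (H x)" for m
      proof (rule AE_I2)
        fix x
        have "\<bar>box_bump m a b x\<bar> * norm (H x) \<le> norm (H x)"
          using box_bump_bounds[of m a b x] by (intro mult_left_le_one_le) auto
        thus "norm (box_bump m a b x *\<^sub>R H x)
            \<le> norm (H x)"
          by (subst norm_scaleR)
      qed
    next
      show "integrable lebesgue (\<lambda>x. norm (H x))"
        by (rule integrable_norm[OF Hint])
    qed
    moreover have "(\<integral>x. box_bump m a b x *\<^sub>R H x \<partial>lebesgue) = 0" for m
    proof -
      have 1: "box_bump m a b x *\<^sub>R H x = box_bump m a b x *\<^sub>R G x" for x
        using box_bump_outside[of x a b m] box_subset_cbox[of a b] by (auto simp: indicator_def H_def)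
      have "(\<integral>x. box_bump m a b x *\<^sub>R G x \<partial>lebesgue) = (\<integral>x. box_bump m a b x *\<^sub>R G x \<partial>lebesgue_on \<Omega>)"
        using box_bump_outside[of _ a b m] box_subset_cbox[of a b] sub \<Omega>s
        by (intro integral_lebesgue_on_supported[symmetric]) auto
      also have "\<dots> = 0" using sub by (intro zero box_bump_test_function)
      finally show ?thesis by (simp only: 1)
    qed
    ultimately have 0: "(\<integral>x. indicator (box a b) x *\<^sub>R H x \<partial>lebesgue) = 0"
      by (simp add: LIMSEQ_const_iff)
    have "indicator (box a b) x *\<^sub>R H x = indicator (box a b) x *\<^sub>R G x" for x
      using box_subset_cbox[of a b] by (auto simp: indicator_def H_def)
    with 0 show ?thesis unfolding set_lebesgue_integral_def by (simp only:)
  qed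
  have AEbox: "AE x in lebesgue. x \<in> box c d \<longrightarrow> G x = 0" if sub: "cbox c d \<subseteq> \<Omega>" for c d
  proof -
    define h where "h x = indicator (box c d) x *\<^sub>R G x" for x
    have inth: "integrable lebesgue h"
    proof -
      have "integrable lebesgue (\<lambda>x. indicator (box c d) x *\<^sub>R (indicator (cbox c d) x *\<^sub>R G x))"
        by (intro integrable_mult_indicator Gint sub) auto
      moreover have "indicator (box c d) x *\<^sub>R (indicator (cbox c d) x *\<^sub>R G x) = h x" for x
        using box_subset_cbox[of c d] by (auto simp: indicator_def h_def)
      ultimately show ?thesis by simp
    qed
    have "AE x in lebesgue. h x = 0"
    proof (rule AE_zero_if_integral_boxes_zero[OF inth])
      fix a b
      obtain a' b' where ab: "box a b \<inter> box c d = box a' b'" unfolding box_Int_box by blast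
      have "set_lebesgue_integral lebesgue (box a b) h = set_lebesgue_integral lebesgue (box a' b') G"
        unfolding set_lebesgue_integral_def h_def ab[symmetric]
        by (intro Bochner_Integration.integral_cong) (auto simp: indicator_def)
      also have "\<dots> = 0"
      \<comment> \<open>If the open box is empty, the closed box \<open>cbox a' b'\<close> may be
        degenerate and lie outside \<Omega>, so \<open>box0\<close> cannot be used.\<close>
      proof (cases "box a' b' = {}")
        case True thus ?thesis by (simp add: set_lebesgue_integral_def)
      next
        case False
        have "cbox a' b' = closure (box a' b')" using False by (simp add: closure_box)
        also have "\<dots> \<subseteq> closure (box c d)" using ab by (intro closure_mono) blast
        also have "\<dots> \<subseteq> cbox c d" by (intro closure_minimal box_subset_cbox closed_cbox)
        finally show ?thesis using sub by (intro box0) blast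
      qed
      finally show "set_lebesgue_integral lebesgue (box a b) h = 0" .
    next
      show "integral\<^sup>L lebesgue h = 0"
        using box0[OF sub] by (simp add: set_lebesgue_integral_def h_def[abs_def])
    qed
    thus ?thesis by (auto simp: h_def elim!: eventually_mono)
  qed
  obtain \<D> where D: "countable \<D>" "\<D> \<subseteq> Pow \<Omega>" "\<And>X. X \<in> \<D> \<Longrightarrow> \<exists>a b. X = box a b \<and> cbox a b \<subseteq> \<Omega>" "\<Union>\<D> = \<Omega>"
  proof -
    let ?F = "{box a b | a b :: real^'n. cbox a b \<subseteq> \<Omega>}"
    obtain \<D> where D: "\<D> \<subseteq> ?F" "countable \<D>" "\<Union>\<D> = \<Union>?F"
      by (rule Lindelof[of ?F]) auto
    have "\<Union>?F \<subseteq> \<Omega>" using box_subset_cbox by blast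
    moreover have "\<Omega> \<subseteq> \<Union>?F"
    proof
      fix x assume "x \<in> \<Omega>"
      then obtain a b where "cbox a b \<subseteq> \<Omega>" "x \<in> box a b" using open_contains_cbox[OF \<Omega>] by metis
      thus "x \<in> \<Union>?F" by blast
    qed
    ultimately have U: "\<Union>\<D> = \<Omega>" using D(3) by (metis subset_antisym)
    show ?thesis
    proof (rule that[OF D(2) _ _ U])
      show "\<D> \<subseteq> Pow \<Omega>" using U by blast
      show "X \<in> \<D> \<Longrightarrow> \<exists>a b. X = box a b \<and> cbox a b \<subseteq> \<Omega>" for X using D(1) by blast
    qed
  qed
  have "AE x in lebesgue. \<forall>X\<in>\<D>. x \<in> X \<longrightarrow> G x = 0"
  proof (subst AE_ball_countable[OF D(1)], rule ballI)
    fix X assume "X \<in> \<D>"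
    then obtain a b where "X = box a b" "cbox a b \<subseteq> \<Omega>" using D(3) by blast
    thus "AE x in lebesgue. x \<in> X \<longrightarrow> G x = 0" using AEbox by simp
  qed
  hence "AE x in lebesgue. x \<in> \<Omega> \<longrightarrow> G x = 0"
    using D(4) by (auto elim!: eventually_mono)
  thus ?thesis using \<Omega>s by (simp add: AE_restrict_space_iff)
qed

section \<open>Square integrable functions and weak gradients\<close>

lemma L2_D:
  assumes "f \<in> L2 M"
  shows "f \<in> borel_measurable M" "integrable M (\<lambda>x. (norm (f x))\<^sup>2)"
  using assms by (auto simp: L2_def)

lemma L2_norm_nonneg [simp]: "0 \<le> L2_norm M f"
  by (simp add: L2_norm_def)

lemma L2_norm_power2: "(L2_norm M f)\<^sup>2 = (\<integral>x. (norm (f x))\<^sup>2 \<partial>M)"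
  by (simp add: L2_norm_def)

lemma L2_norm_cong_AE:
  assumes "f \<in> borel_measurable M" "g \<in> borel_measurable M" "AE x in M. f x = g x"
  shows "L2_norm M f = L2_norm M g"
proof -
  have "(\<integral>x. (norm (f x))\<^sup>2 \<partial>M) = (\<integral>x. (norm (g x))\<^sup>2 \<partial>M)"
    using assms(1,2) by (intro integral_cong_AE) (auto intro: eventually_mono[OF assms(3)])
  thus ?thesis by (simp add: L2_norm_def)
qed

text \<open>Cauchy-Schwarz is taken from \<open>nn_integral\<close>. Integrability of the product,
  from \<open>a * b \<le> a^2 + b^2\<close>, comes first because it is what carries the inequality
  over to the Bochner integral.\<close>

lemma L2_mult_bound:
  fixes f :: "'a \<Rightarrow> 'b::euclidean_space" and g :: "'a \<Rightarrow> 'c::euclidean_space"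
  assumes f: "f \<in> L2 M" and g: "g \<in> L2 M"
  shows "integrable M (\<lambda>x. norm (f x) * norm (g x))"
    and "(\<integral>x. norm (f x) * norm (g x) \<partial>M) \<le> L2_norm M f * L2_norm M g"
proof -
  note [measurable] = L2_D(1)[OF f] L2_D(1)[OF g]
  show int: "integrable M (\<lambda>x. norm (f x) * norm (g x))"
  proof (rule Bochner_Integration.integrable_bound)
    show "integrable M (\<lambda>x. (norm (f x))\<^sup>2 + (norm (g x))\<^sup>2)"
      using f g by (intro Bochner_Integration.integrable_add) (auto simp: L2_def)
    have "norm (f x) * norm (g x) \<le> (norm (f x))\<^sup>2 + (norm (g x))\<^sup>2" for x
    proof -
      have "0 \<le> norm (f x) * norm (g x)" by simp
      moreover have "2 * (norm (f x) * norm (g x)) \<le> (norm (f x))\<^sup>2 + (norm (g x))\<^sup>2"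
        using sum_squares_bound[of "norm (f x)" "norm (g x)"] by (simp only: mult.assoc)
      ultimately show ?thesis by linarith
    qed
    thus "AE x in M. norm (norm (f x) * norm (g x)) \<le> norm ((norm (f x))\<^sup>2 + (norm (g x))\<^sup>2)"
      by (intro AE_I2) simp
  qed measurable
  have "(\<integral>\<^sup>+x. ennreal (norm (f x)) * ennreal (norm (g x)) \<partial>M)\<^sup>2
      \<le> (\<integral>\<^sup>+x. (ennreal (norm (f x)))\<^sup>2 \<partial>M) * (\<integral>\<^sup>+x. (ennreal (norm (g x)))\<^sup>2 \<partial>M)"
    by (rule Cauchy_Schwarz_nn_integral) measurable
  also have "(\<integral>\<^sup>+x. ennreal (norm (f x)) * ennreal (norm (g x)) \<partial>M) = ennreal (\<integral>x. norm (f x) * norm (g x) \<partial>M)"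
    using int by (subst nn_integral_eq_integral[symmetric]) (auto simp: ennreal_mult)
  also have "(\<integral>\<^sup>+x. (ennreal (norm (f x)))\<^sup>2 \<partial>M) = ennreal ((L2_norm M f)\<^sup>2)"
    unfolding L2_norm_power2 using L2_D(2)[OF f]
    by (subst nn_integral_eq_integral[symmetric]) (auto simp: ennreal_power)
  also have "(\<integral>\<^sup>+x. (ennreal (norm (g x)))\<^sup>2 \<partial>M) = ennreal ((L2_norm M g)\<^sup>2)"
    unfolding L2_norm_power2 using L2_D(2)[OF g]
    by (subst nn_integral_eq_integral[symmetric]) (auto simp: ennreal_power)
  finally have "ennreal ((\<integral>x. norm (f x) * norm (g x) \<partial>M)\<^sup>2) \<le> ennreal ((L2_norm M f * L2_norm M g)\<^sup>2)"
    by (simp add: ennreal_power ennreal_mult power_mult_distrib)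
  hence "(\<integral>x. norm (f x) * norm (g x) \<partial>M)\<^sup>2 \<le> (L2_norm M f * L2_norm M g)\<^sup>2"
    by simp
  thus "(\<integral>x. norm (f x) * norm (g x) \<partial>M) \<le> L2_norm M f * L2_norm M g"
    by (rule power2_le_imp_le) simp
qed

lemma L2_inner:
  fixes f g :: "'a \<Rightarrow> 'b::euclidean_space"
  assumes f: "f \<in> L2 M" and g: "g \<in> L2 M"
  shows "integrable M (\<lambda>x. f x \<bullet> g x)"
    and "\<bar>\<integral>x. f x \<bullet> g x \<partial>M\<bar> \<le> L2_norm M f * L2_norm M g"
proof -
  note [measurable] = L2_D(1)[OF f] L2_D(1)[OF g]
  show int: "integrable M (\<lambda>x. f x \<bullet> g x)"
    by (rule Bochner_Integration.integrable_bound[OF L2_mult_bound(1)[OF f g]])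
       (auto intro!: AE_I2 simp: Cauchy_Schwarz_ineq2)
  have "\<bar>\<integral>x. f x \<bullet> g x \<partial>M\<bar> \<le> (\<integral>x. \<bar>f x \<bullet> g x\<bar> \<partial>M)"
    using integral_norm_bound[of M "\<lambda>x. f x \<bullet> g x"] by simp
  also have "\<dots> \<le> (\<integral>x. norm (f x) * norm (g x) \<partial>M)"
    using int L2_mult_bound(1)[OF f g] by (intro integral_mono) (auto simp: Cauchy_Schwarz_ineq2)
  also have "\<dots> \<le> L2_norm M f * L2_norm M g" by (rule L2_mult_bound(2)[OF f g])
  finally show "\<bar>\<integral>x. f x \<bullet> g x \<partial>M\<bar> \<le> L2_norm M f * L2_norm M g" .
qed

lemma L2_bounded_by:
  fixes f :: "'a \<Rightarrow> 'b::euclidean_space" and F :: "'a \<Rightarrow> 'c::euclidean_space"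
  assumes f: "f \<in> L2 M" and F: "F \<in> borel_measurable M" and c: "c \<ge> 0"
    and le: "AE x in M. norm (F x) \<le> c * norm (f x)"
  shows "F \<in> L2 M" "L2_norm M F \<le> c * L2_norm M f"
proof -
  have le2: "AE x in M. (norm (F x))\<^sup>2 \<le> c\<^sup>2 * (norm (f x))\<^sup>2"
    using le by (rule eventually_mono) (metis norm_ge_zero power_mono power_mult_distrib)
  have int: "integrable M (\<lambda>x. c\<^sup>2 * (norm (f x))\<^sup>2)" using L2_D(2)[OF f] by simp
  have intF: "integrable M (\<lambda>x. (norm (F x))\<^sup>2)"
    using F le2 by (intro Bochner_Integration.integrable_bound[OF int]) auto
  thus "F \<in> L2 M" using F by (simp add: L2_def)
  have "(L2_norm M F)\<^sup>2 \<le> (c * L2_norm M f)\<^sup>2"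
    unfolding power_mult_distrib L2_norm_power2
    using integral_mono_AE[OF intF int le2] by simp
  thus "L2_norm M F \<le> c * L2_norm M f"
    by (rule power2_le_imp_le) (simp add: c)
qed

lemma L2_diff:
  fixes f g :: "'a \<Rightarrow> 'b::euclidean_space"
  assumes f: "f \<in> L2 M" and g: "g \<in> L2 M"
  shows "(\<lambda>x. f x - g x) \<in> L2 M" "L2_norm M (\<lambda>x. f x - g x) \<le> L2_norm M f + L2_norm M g"
proof -
  note [measurable] = L2_D(1)[OF f] L2_D(1)[OF g]
  have eq: "(norm (f x - g x))\<^sup>2 = (norm (f x))\<^sup>2 + (norm (g x))\<^sup>2 - 2 * (f x \<bullet> g x)" for x
    unfolding power2_norm_eq_inner by (simp add: inner_diff inner_commute)
  show "(\<lambda>x. f x - g x) \<in> L2 M"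
    unfolding L2_def mem_Collect_eq eq using L2_D(2)[OF f] L2_D(2)[OF g] L2_inner(1)[OF f g]
    by (intro conjI Bochner_Integration.integrable_diff Bochner_Integration.integrable_add
        integrable_mult_right) measurable
  have "(L2_norm M (\<lambda>x. f x - g x))\<^sup>2 = (L2_norm M f)\<^sup>2 + (L2_norm M g)\<^sup>2 - 2 * (\<integral>x. f x \<bullet> g x \<partial>M)"
    unfolding L2_norm_power2 eq using L2_D(2)[OF f] L2_D(2)[OF g] L2_inner(1)[OF f g] by simp
  also have "\<dots> \<le> (L2_norm M f + L2_norm M g)\<^sup>2"
    using L2_inner(2)[OF f g] by (simp add: power2_sum)
  finally show "L2_norm M (\<lambda>x. f x - g x) \<le> L2_norm M f + L2_norm M g"
    by (rule power2_le_imp_le) simp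
qed

lemma L2_norm_triangle:
  fixes f g :: "'a \<Rightarrow> 'b::euclidean_space"
  assumes f: "f \<in> L2 M" and g: "g \<in> L2 M"
  shows "L2_norm M f \<le> L2_norm M (\<lambda>x. f x - g x) + L2_norm M g"
proof -
  have "(\<lambda>x. - g x) \<in> L2 M" using g by (simp add: L2_def)
  from L2_diff(2)[OF L2_diff(1)[OF f g] this] show ?thesis
    by (simp add: L2_norm_def)
qed

lemma L2_norm_commute: "L2_norm M (\<lambda>x. f x - g x) = L2_norm M (\<lambda>x. g x - f x)"
  by (simp add: L2_norm_def norm_minus_commute)

text \<open>Completeness of Lebesgue measure is the point: preimages under \<open>F\<close> and
  \<open>G\<close> differ only inside a null set, all of whose subsets are measurable. It lets a
  function chosen arbitrarily in its class, such as \<open>wgrad\<close>, inherit membership in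
  \<open>L2\<close>.\<close>

lemma borel_measurable_lebesgue_cong_AE:
  fixes F G :: "'a::euclidean_space \<Rightarrow> 'b::euclidean_space"
  assumes F: "F \<in> borel_measurable lebesgue" and ae: "AE x in lebesgue. F x = G x"
  shows "G \<in> borel_measurable lebesgue"
proof (rule measurableI)
  fix S :: "'b set" assume S: "S \<in> sets borel"
  obtain N where N: "{x \<in> space lebesgue. F x \<noteq> G x} \<subseteq> N" "N \<in> null_sets lebesgue"
    using ae by (auto elim!: AE_E simp: null_sets_def)
  have "negligible (G -` S \<inter> N)"
    by (rule negligible_subset[of N]) (use N(2) in \<open>auto simp: negligible_iff_null_sets\<close>)
  hence "G -` S \<inter> N \<in> sets lebesgue" by (rule negligible_imp_sets)
  moreover have "F -` S - N \<in> sets lebesgue"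
    using measurable_sets[OF F S] N(2) by auto
  moreover have "G x = F x" if "x \<notin> N" for x
    using subsetD[OF N(1), of x] that by (cases "F x = G x") auto
  hence "G -` S = (F -` S - N) \<union> (G -` S \<inter> N)" by auto
  ultimately have "G -` S \<in> sets lebesgue" by (metis sets.Un)
  thus "G -` S \<inter> space lebesgue \<in> sets lebesgue" by simp
qed auto

lemma L2_cong_AE_lebesgue_on:
  fixes f g :: "'a::euclidean_space \<Rightarrow> 'b::euclidean_space"
  assumes \<Omega>: "\<Omega> \<in> sets lebesgue" and f: "f \<in> L2 (lebesgue_on \<Omega>)" and ae: "AE x in lebesgue_on \<Omega>. g x = f x"
  shows "g \<in> L2 (lebesgue_on \<Omega>)" "L2_norm (lebesgue_on \<Omega>) g = L2_norm (lebesgue_on \<Omega>) f"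
proof -
  have m: "g \<in> borel_measurable (lebesgue_on \<Omega>)"
  proof -
    have "AE x in lebesgue. indicator \<Omega> x *\<^sub>R f x = indicator \<Omega> x *\<^sub>R g x"
    proof -
      have "AE x in lebesgue. x \<in> \<Omega> \<longrightarrow> g x = f x" using ae \<Omega> by (simp add: AE_restrict_space_iff)
      thus ?thesis by (rule eventually_mono) (auto simp: indicator_def)
    qed
    moreover have "(\<lambda>x. indicator \<Omega> x *\<^sub>R f x) \<in> borel_measurable lebesgue"
      using L2_D(1)[OF f] \<Omega> by (simp add: borel_measurable_restrict_space_iff)
    ultimately have "(\<lambda>x. indicator \<Omega> x *\<^sub>R g x) \<in> borel_measurable lebesgue"
      by (rule borel_measurable_lebesgue_cong_AE[rotated])
    thus ?thesis using \<Omega> by (simp add: borel_measurable_restrict_space_iff)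
  qed
  show "g \<in> L2 (lebesgue_on \<Omega>)"
    by (rule L2_bounded_by[OF f m, of 1]) (use ae in \<open>auto elim!: eventually_mono\<close>)
  show "L2_norm (lebesgue_on \<Omega>) g = L2_norm (lebesgue_on \<Omega>) f"
    by (rule L2_norm_cong_AE[OF m L2_D(1)[OF f] ae])
qed

section \<open>Weak gradients and their uniqueness\<close>

lemma test_function_support:
  assumes "\<phi> \<in> test_functions \<Omega>"
  obtains C where "compact C" "C \<subseteq> \<Omega>" "\<And>x. x \<notin> C \<Longrightarrow> \<phi> x = 0" "\<And>x. x \<notin> C \<Longrightarrow> gradient \<phi> x = 0"
proof -
  from assms obtain C where C: "compact C" "C \<subseteq> \<Omega>" "\<And>x. x \<notin> C \<Longrightarrow> \<phi> x = 0"
    by (auto simp: test_functions_def)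
  have "gradient \<phi> x = 0" if x: "x \<notin> C" for x
  proof (rule gradient_eqI)
    have "open (- C)" using C(1) by (simp add: compact_imp_closed open_Compl)
    show "(\<phi> has_derivative (\<lambda>h. 0 \<bullet> h)) (at x)"
      by (rule has_derivative_transform_within_open[of "\<lambda>_. 0", OF _ \<open>open (- C)\<close>]) (use x C(3) in auto)
  qed
  thus ?thesis using C that by blast
qed

text \<open>A general bilinear \<open>h\<close> treats both sides of the definition of a weak
  gradient at once: in one the test function contributes the vector, in the other the
  scalar.\<close>

lemma integrable_supported_bilinear:
  fixes u :: "real^'n \<Rightarrow> 'b::euclidean_space" and c :: "real^'n \<Rightarrow> 'c::euclidean_space"
    and h :: "'c \<Rightarrow> 'b \<Rightarrow> 'd::euclidean_space"
  assumes \<Omega>: "open \<Omega>" and u: "locally_integrable \<Omega> u" and h: "bilinear h"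
    and C: "compact C" "C \<subseteq> \<Omega>" and c: "continuous_on UNIV c" "\<And>x. x \<notin> C \<Longrightarrow> c x = 0"
  shows "integrable (lebesgue_on \<Omega>) (\<lambda>x. h (c x) (u x))"
proof -
  have cC: "continuous_on C c" using c(1) by (rule continuous_on_subset) simp
  have Cs: "C \<in> sets lebesgue" using C(1) by (simp add: compact_imp_closed)
  have "(\<lambda>x. h (c x) (u x)) absolutely_integrable_on C"
  proof (rule absolutely_integrable_bounded_measurable_product[OF h _ Cs])
    show "c \<in> borel_measurable (lebesgue_on C)"
      by (rule continuous_imp_measurable_on_sets_lebesgue[OF cC Cs])
    show "bounded (c ` C)" by (rule compact_imp_bounded[OF compact_continuous_image[OF cC C(1)]])
    show "u absolutely_integrable_on C" using u C by (simp add: locally_integrable_def)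
  qed
  moreover have "indicator C x *\<^sub>R h (c x) (u x) = indicator \<Omega> x *\<^sub>R h (c x) (u x)" for x
    using c(2)[of x] C(2) bilinear_lzero[OF h] by (cases "x \<in> C") auto
  ultimately show ?thesis using \<Omega> by (subst integrable_restrict_space) (auto simp: set_integrable_def)
qed

lemma integrable_weak_gradient_terms:
  assumes \<Omega>: "open \<Omega>" and \<phi>: "\<phi> \<in> test_functions \<Omega>"
  shows "locally_integrable \<Omega> u \<Longrightarrow> integrable (lebesgue_on \<Omega>) (\<lambda>x. u x *\<^sub>R gradient \<phi> x)"
    and "locally_integrable \<Omega> G \<Longrightarrow> integrable (lebesgue_on \<Omega>) (\<lambda>x. \<phi> x *\<^sub>R (G x :: 'b::euclidean_space))"
proof -
  have s: "smooth \<phi>" using \<phi> by (simp add: test_functions_def)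
  obtain C where C: "compact C" "C \<subseteq> \<Omega>" "\<And>x. x \<notin> C \<Longrightarrow> \<phi> x = 0" "\<And>x. x \<notin> C \<Longrightarrow> gradient \<phi> x = 0"
    using test_function_support[OF \<phi>] by metis
  show "integrable (lebesgue_on \<Omega>) (\<lambda>x. u x *\<^sub>R gradient \<phi> x)" if "locally_integrable \<Omega> u"
    by (rule integrable_supported_bilinear[OF \<Omega> that, of "\<lambda>a b. b *\<^sub>R a" C])
       (use C s in \<open>auto intro!: smooth_continuous_on_gradient linearI simp: bilinear_def algebra_simps\<close>)
  show "integrable (lebesgue_on \<Omega>) (\<lambda>x. \<phi> x *\<^sub>R G x)" if "locally_integrable \<Omega> G"
    by (rule integrable_supported_bilinear[OF \<Omega> that, of scaleR C])
       (use C s in \<open>auto intro!: smooth_continuous_on linearI simp: bilinear_def algebra_simps\<close>)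
qed

lemma locally_integrable_diff:
  "locally_integrable \<Omega> u \<Longrightarrow> locally_integrable \<Omega> v \<Longrightarrow> locally_integrable \<Omega> (\<lambda>x. u x - v x)"
  unfolding locally_integrable_def by (auto intro: set_integral_diff)

lemma has_weak_gradient_diff:
  assumes \<Omega>: "open \<Omega>" and u: "has_weak_gradient \<Omega> u G" and v: "has_weak_gradient \<Omega> v H"
  shows "has_weak_gradient \<Omega> (\<lambda>x. u x - v x) (\<lambda>x. G x - H x)"
proof -
  have l: "locally_integrable \<Omega> u" "locally_integrable \<Omega> G" "locally_integrable \<Omega> v" "locally_integrable \<Omega> H"
    using u v by (auto simp: has_weak_gradient_def)
  have "(\<integral>x. (u x - v x) *\<^sub>R gradient \<phi> x \<partial>lebesgue_on \<Omega>) = - (\<integral>x. \<phi> x *\<^sub>R (G x - H x) \<partial>lebesgue_on \<Omega>)"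
    if \<phi>: "\<phi> \<in> test_functions \<Omega>" for \<phi>
  proof -
    note i = integrable_weak_gradient_terms[OF \<Omega> \<phi>]
    have "(\<integral>x. (u x - v x) *\<^sub>R gradient \<phi> x \<partial>lebesgue_on \<Omega>)
      = (\<integral>x. u x *\<^sub>R gradient \<phi> x \<partial>lebesgue_on \<Omega>) - (\<integral>x. v x *\<^sub>R gradient \<phi> x \<partial>lebesgue_on \<Omega>)"
      unfolding scaleR_diff_left using i l by (intro Bochner_Integration.integral_diff)
    also have "\<dots> = - ((\<integral>x. \<phi> x *\<^sub>R G x \<partial>lebesgue_on \<Omega>) - (\<integral>x. \<phi> x *\<^sub>R H x \<partial>lebesgue_on \<Omega>))"
      using u v \<phi> by (simp add: has_weak_gradient_def)
    also have "(\<integral>x. \<phi> x *\<^sub>R G x \<partial>lebesgue_on \<Omega>) - (\<integral>x. \<phi> x *\<^sub>R H x \<partial>lebesgue_on \<Omega>)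
      = (\<integral>x. \<phi> x *\<^sub>R (G x - H x) \<partial>lebesgue_on \<Omega>)"
      unfolding scaleR_diff_right using i l by (intro Bochner_Integration.integral_diff[symmetric])
    finally show ?thesis .
  qed
  thus ?thesis using l by (simp add: has_weak_gradient_def locally_integrable_diff)
qed

text \<open>The difference of two weak gradients of \<open>u\<close> is a weak gradient of the zero
  function, so its integral against every test function vanishes.\<close>

lemma has_weak_gradient_unique:
  assumes \<Omega>: "open \<Omega>" and u: "has_weak_gradient \<Omega> u G" and v: "has_weak_gradient \<Omega> u H"
  shows "AE x in lebesgue_on \<Omega>. G x = H x"
proof -
  have d: "has_weak_gradient \<Omega> (\<lambda>x. u x - u x) (\<lambda>x. G x - H x)"
    by (rule has_weak_gradient_diff[OF \<Omega> u v])
  have "AE x in lebesgue_on \<Omega>. G x - H x = 0"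
  proof (rule fundamental_lemma_variations[OF \<Omega>])
    show "locally_integrable \<Omega> (\<lambda>x. G x - H x)" using d by (simp add: has_weak_gradient_def)
    fix \<phi> assume "\<phi> \<in> test_functions \<Omega>"
    thus "(\<integral>x. \<phi> x *\<^sub>R (G x - H x) \<partial>lebesgue_on \<Omega>) = 0"
      using d by (simp add: has_weak_gradient_def)
  qed
  thus ?thesis by simp
qed

lemma wgrad_eq_AE:
  assumes "open \<Omega>" "has_weak_gradient \<Omega> u G"
  shows "AE x in lebesgue_on \<Omega>. wgrad \<Omega> u x = G x"
proof -
  have "has_weak_gradient \<Omega> u (wgrad \<Omega> u)"
    unfolding wgrad_def using assms(2) someI[of "has_weak_gradient \<Omega> u"] by blast
  thus ?thesis using has_weak_gradient_unique assms by blast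
qed

section \<open>Differences in H1\<close>

lemma H1_D:
  assumes \<Omega>: "open \<Omega>" and u: "u \<in> H1 \<Omega>"
  shows "u \<in> L2 (lebesgue_on \<Omega>)" "has_weak_gradient \<Omega> u (wgrad \<Omega> u)"
    "wgrad \<Omega> u \<in> L2 (lebesgue_on \<Omega>)"
proof -
  obtain G where G: "G \<in> L2 (lebesgue_on \<Omega>)" "has_weak_gradient \<Omega> u G"
    using u by (auto simp: H1_def)
  show "u \<in> L2 (lebesgue_on \<Omega>)" using u by (simp add: H1_def)
  show "has_weak_gradient \<Omega> u (wgrad \<Omega> u)"
    unfolding wgrad_def using G(2) someI[of "has_weak_gradient \<Omega> u"] by blast
  show "wgrad \<Omega> u \<in> L2 (lebesgue_on \<Omega>)"
    using \<Omega> by (intro L2_cong_AE_lebesgue_on(1)[OF _ G(1) wgrad_eq_AE[OF \<Omega> G(2)]]) auto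
qed

lemma H1_diff:
  assumes \<Omega>: "open \<Omega>" and u: "u \<in> H1 \<Omega>" and v: "v \<in> H1 \<Omega>"
  shows "(\<lambda>x. u x - v x) \<in> H1 \<Omega>"
    and "AE x in lebesgue_on \<Omega>. wgrad \<Omega> (\<lambda>x. u x - v x) x = wgrad \<Omega> u x - wgrad \<Omega> v x"
proof -
  have w: "has_weak_gradient \<Omega> (\<lambda>x. u x - v x) (\<lambda>x. wgrad \<Omega> u x - wgrad \<Omega> v x)"
    using H1_D[OF \<Omega> u] H1_D[OF \<Omega> v] by (intro has_weak_gradient_diff[OF \<Omega>])
  show "(\<lambda>x. u x - v x) \<in> H1 \<Omega>"
    unfolding H1_def mem_Collect_eq
    by (intro conjI bexI[where x = "\<lambda>x. wgrad \<Omega> u x - wgrad \<Omega> v x"] w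
        L2_diff(1) H1_D(1,3)[OF \<Omega> u] H1_D(1,3)[OF \<Omega> v])
  show "AE x in lebesgue_on \<Omega>. wgrad \<Omega> (\<lambda>x. u x - v x) x = wgrad \<Omega> u x - wgrad \<Omega> v x"
    by (rule wgrad_eq_AE[OF \<Omega> w])
qed

text \<open>Serves only to see that a norm tends to 0, so the crude factor 2, from bounding the two
  parts of the norm separately, does no harm.\<close>

lemma H1_norm_diff_le:
  assumes \<Omega>: "open \<Omega>" and u: "u \<in> H1 \<Omega>" and v: "v \<in> H1 \<Omega>"
  shows "H1_norm \<Omega> (\<lambda>x. u x - v x) \<le> 2 * (H1_norm \<Omega> u + H1_norm \<Omega> v)"
proof -
  let ?M = "lebesgue_on \<Omega>"
  have \<Omega>s: "\<Omega> \<in> sets lebesgue" using \<Omega> by simp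
  note D = H1_D[OF \<Omega> u] H1_D[OF \<Omega> v]
  have part: "L2_norm ?M w \<le> H1_norm \<Omega> w" "L2_norm ?M (wgrad \<Omega> w) \<le> H1_norm \<Omega> w" for w
    unfolding H1_norm_def by (auto intro!: real_le_rsqrt)
  have "L2_norm ?M (wgrad \<Omega> (\<lambda>x. u x - v x)) = L2_norm ?M (\<lambda>x. wgrad \<Omega> u x - wgrad \<Omega> v x)"
    by (rule L2_cong_AE_lebesgue_on(2)[OF \<Omega>s L2_diff(1)[OF D(3) D(6)] H1_diff(2)[OF \<Omega> u v]])
  also have "\<dots> \<le> L2_norm ?M (wgrad \<Omega> u) + L2_norm ?M (wgrad \<Omega> v)" by (rule L2_diff(2)[OF D(3) D(6)])
  finally have 1: "L2_norm ?M (wgrad \<Omega> (\<lambda>x. u x - v x)) \<le> H1_norm \<Omega> u + H1_norm \<Omega> v"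
    using part[of u] part[of v] by linarith
  have 2: "L2_norm ?M (\<lambda>x. u x - v x) \<le> H1_norm \<Omega> u + H1_norm \<Omega> v"
    using L2_diff(2)[OF D(1) D(4)] part[of u] part[of v] by linarith
  have "H1_norm \<Omega> (\<lambda>x. u x - v x) \<le> L2_norm ?M (\<lambda>x. u x - v x) + L2_norm ?M (wgrad \<Omega> (\<lambda>x. u x - v x))"
    unfolding H1_norm_def by (rule sqrt_sum_squares_le_sum) auto
  also have "\<dots> \<le> (H1_norm \<Omega> u + H1_norm \<Omega> v) + (H1_norm \<Omega> u + H1_norm \<Omega> v)"
    by (rule add_mono[OF 2 1])
  finally show ?thesis by simp
qed

section \<open>Integration by parts and smooth elements of H1\<close>

lemma continuous_compact_support:
  fixes f :: "'a::euclidean_space \<Rightarrow> 'b::euclidean_space"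
  assumes f: "continuous_on UNIV f" and C: "compact C" "\<And>x. x \<notin> C \<Longrightarrow> f x = 0"
  shows "integrable lborel f" "\<exists>B. \<forall>x. norm (f x) \<le> B"
proof -
  have cC: "continuous_on C f" using f by (rule continuous_on_subset) simp
  have "indicator C x *\<^sub>R f x = f x" for x using C(2)[of x] by (auto simp: indicator_def)
  thus "integrable lborel f" using borel_integrable_compact[OF C(1) cC] by simp
  obtain B where B: "\<And>x. x \<in> C \<Longrightarrow> norm (f x) \<le> B" "B > 0"
    using compact_imp_bounded[OF compact_continuous_image[OF cC C(1)]] by (auto simp: bounded_pos)
  have "norm (f x) \<le> B" for x using B C(2)[of x] by (cases "x \<in> C") auto
  thus "\<exists>B. \<forall>x. norm (f x) \<le> B" by blast
qed

text \<open>Difference quotients of \<eta> integrate to 0 because Lebesgue measure is translation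
  invariant. The mean value inequality bounds them by \<open>B * norm e\<close>, and dominated
  convergence passes to each directional derivative.\<close>

lemma integral_gradient_eq_0:
  fixes \<eta> :: "real^'n \<Rightarrow> real"
  assumes s: "smooth \<eta>" and C: "compact C" "\<And>x. x \<notin> C \<Longrightarrow> \<eta> x = 0" "\<And>x. x \<notin> C \<Longrightarrow> gradient \<eta> x = 0"
  shows "(\<integral>x. gradient \<eta> x \<partial>lborel) = 0"
proof -
  note cont = smooth_continuous_on[OF s] smooth_continuous_on_gradient[OF s]
  obtain B where B: "\<And>x. norm (gradient \<eta> x) \<le> B"
    using continuous_compact_support(2)[OF cont(2) C(1,3)] by blast
  obtain R where R: "\<And>x. x \<in> C \<Longrightarrow> norm x \<le> R"
    using compact_imp_bounded[OF C(1)] by (auto simp: bounded_iff)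
  have meas [measurable]: "\<eta> \<in> borel_measurable borel" "gradient \<eta> \<in> borel_measurable borel"
    using cont by (auto intro: borel_measurable_continuous_onI)
  have int: "integrable lborel (gradient \<eta>)" by (rule continuous_compact_support(1)[OF cont(2) C(1,3)])
  have zero: "(\<integral>x. gradient \<eta> x \<bullet> e \<partial>lborel) = 0" for e
  proof -
    define D where "D m x = (\<eta> (x + inverse (real (Suc m)) *\<^sub>R e) - \<eta> x) / inverse (real (Suc m))" for m x
    \<comment> \<open>The step sizes are at most 1, so outside this ball both \<open>x\<close> and
      the shifted point avoid \<open>C\<close> and every difference quotient vanishes.\<close>
    define S where "S = cball (0::real^'n) (R + norm e)"
    have h: "0 < inverse (real (Suc m))" "inverse (real (Suc m)) \<le> 1" for m
      by (auto simp: field_simps)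
    have eta_int: "integrable lborel \<eta>" by (rule continuous_compact_support(1)[OF cont(1) C(1,2)])
    have D0: "(\<integral>x. D m x \<partial>lborel) = 0" for m
    proof -
      let ?v = "inverse (real (Suc m)) *\<^sub>R e"
      have d: "distr lborel borel (\<lambda>x. x + ?v) = lborel"
      proof -
        have "(\<lambda>x. x + ?v) = (+) ?v" by (simp add: fun_eq_iff add.commute)
        thus ?thesis using lborel_distr_plus[of ?v] by (simp only:)
      qed
      have 1: "(\<integral>x. \<eta> (x + ?v) \<partial>lborel) = (\<integral>x. \<eta> x \<partial>lborel)"
        by (subst (2) d[symmetric], subst integral_distr) auto
      have "integrable lborel (\<lambda>x. \<eta> (x + ?v))"
        using eta_int by (subst (asm) d[symmetric], subst (asm) integrable_distr_eq) auto
      thus ?thesis unfolding D_def using eta_int 1 by simp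
    qed
    have "(\<lambda>m. \<integral>x. D m x \<partial>lborel) \<longlonglongrightarrow> (\<integral>x. gradient \<eta> x \<bullet> e \<partial>lborel)"
    proof (rule integral_dominated_convergence[where w = "\<lambda>x. (B * norm e) * indicator S x"])
      show "integrable lborel (\<lambda>x. (B * norm e) * indicator S x)"
        unfolding S_def
        by (intro integrable_mult_right integrable_real_indicator) (use emeasure_compact_finite[OF compact_cball] in auto)
      show "AE x in lborel. (\<lambda>m. D m x) \<longlonglongrightarrow> gradient \<eta> x \<bullet> e"
      proof (rule AE_I2)
        fix x
        have "((\<lambda>t. \<eta> (x + t *\<^sub>R e)) has_derivative (\<lambda>t. gradient \<eta> (x + 0 *\<^sub>R e) \<bullet> (t *\<^sub>R e))) (at 0)"
          by (rule has_derivative_compose[OF _ smooth_has_gradient[OF s]])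
             (auto intro!: derivative_eq_intros)
        hence "((\<lambda>t. \<eta> (x + t *\<^sub>R e)) has_real_derivative gradient \<eta> x \<bullet> e) (at 0)"
          by (simp add: has_field_derivative_def mult.commute[of _ "gradient \<eta> x \<bullet> e"])
        hence "((\<lambda>t. (\<eta> (x + t *\<^sub>R e) - \<eta> x) / t) \<longlongrightarrow> gradient \<eta> x \<bullet> e) (at 0)"
          by (simp add: DERIV_def)
        moreover have "filterlim (\<lambda>m. inverse (real (Suc m))) (at 0) sequentially"
          using LIMSEQ_inverse_real_of_nat by (simp add: filterlim_at)
        ultimately show "(\<lambda>m. D m x) \<longlonglongrightarrow> gradient \<eta> x \<bullet> e"
          unfolding D_def by (rule filterlim_compose)
      qed
      show "AE x in lborel. norm (D m x) \<le> (B * norm e) * indicator S x" for m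
      proof (rule AE_I2)
        fix x
        let ?t = "inverse (real (Suc m))"
        show "norm (D m x) \<le> (B * norm e) * indicator S x"
        proof (cases "x \<in> S")
          case True
          have "norm (\<eta> (x + ?t *\<^sub>R e) - \<eta> x) \<le> B * norm ((x + ?t *\<^sub>R e) - x)"
          proof (rule differentiable_bound[of UNIV \<eta> "\<lambda>x h. gradient \<eta> x \<bullet> h"])
            show "onorm (\<lambda>h. gradient \<eta> x \<bullet> h) \<le> B" for x
            proof (rule onorm_le)
              fix y
              have "norm (gradient \<eta> x \<bullet> y) \<le> norm (gradient \<eta> x) * norm y"
                by (simp add: Cauchy_Schwarz_ineq2)
              also have "\<dots> \<le> B * norm y" by (intro mult_right_mono B) simp
              finally show "norm (gradient \<eta> x \<bullet> y) \<le> B * norm y" .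
            qed
          qed (use smooth_has_gradient[OF s] in auto)
          also have "\<dots> = (B * norm e) * ?t" using h[of m] by simp
          finally have "norm (\<eta> (x + ?t *\<^sub>R e) - \<eta> x) / ?t \<le> B * norm e"
            using h[of m] by (subst pos_divide_le_eq) auto
          thus ?thesis using True h[of m] by (simp add: D_def)
        next
          case False
          hence x: "norm x > R + norm e" by (simp add: S_def)
          have "norm (?t *\<^sub>R e) \<le> 1 * norm e" unfolding norm_scaleR using h[of m] by (intro mult_right_mono) auto
          hence "norm (x + ?t *\<^sub>R e) > R" using x norm_diff_ineq[of x "?t *\<^sub>R e"] by linarith
          hence "\<eta> (x + ?t *\<^sub>R e) = 0" using R C(2) by force
          moreover have "\<eta> x = 0" using x R[of x] C(2)[of x] norm_ge_zero[of e] by (meson add_increasing2 leD order_refl)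
          ultimately show ?thesis using False by (simp add: D_def)
        qed
      qed
    qed (simp_all add: D_def)
    thus ?thesis using D0 by (simp add: LIMSEQ_const_iff)
  qed
  have "(\<integral>x. gradient \<eta> x \<partial>lborel) \<bullet> e = 0" for e
    using zero[of e] int by (simp add: integral_inner_left)
  thus ?thesis by (metis inner_eq_zero_iff)
qed

lemma gradient_mult:
  assumes "smooth f" "smooth g"
  shows "gradient (\<lambda>x. f x * g x) x = f x *\<^sub>R gradient g x + g x *\<^sub>R gradient f x"
proof (rule gradient_eqI, rule has_derivative_eq_rhs)
  show "((\<lambda>x. f x * g x) has_derivative (\<lambda>h. f x * (gradient g x \<bullet> h) + (gradient f x \<bullet> h) * g x)) (at x)"
    by (intro has_derivative_mult smooth_has_gradient assms)
qed (simp add: fun_eq_iff inner_add_left mult.commute)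

lemma continuous_locally_integrable:
  fixes u :: "real^'n \<Rightarrow> 'b::euclidean_space"
  assumes "continuous_on UNIV u" shows "locally_integrable \<Omega> u"
  unfolding locally_integrable_def
proof (intro allI impI)
  fix C :: "(real^'n) set" assume C: "compact C \<and> C \<subseteq> \<Omega>"
  hence "integrable lborel (\<lambda>x. indicator C x *\<^sub>R u x)"
    using assms by (intro borel_integrable_compact) (auto elim: continuous_on_subset)
  thus "u absolutely_integrable_on C"
    unfolding set_integrable_def by (subst integrable_completion) (rule borel_measurable_integrable)
qed

lemma has_weak_gradient_smooth:
  assumes \<Omega>: "open \<Omega>" and u: "smooth u"
  shows "has_weak_gradient \<Omega> u (gradient u)"
proof -
  have l: "locally_integrable \<Omega> u" "locally_integrable \<Omega> (gradient u)"
    using smooth_continuous_on[OF u] smooth_continuous_on_gradient[OF u]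
    by (auto intro: continuous_locally_integrable)
  have "(\<integral>x. u x *\<^sub>R gradient \<phi> x \<partial>lebesgue_on \<Omega>) = - (\<integral>x. \<phi> x *\<^sub>R gradient u x \<partial>lebesgue_on \<Omega>)"
    if \<phi>: "\<phi> \<in> test_functions \<Omega>" for \<phi>
  proof -
    have s: "smooth \<phi>" using \<phi> by (simp add: test_functions_def)
    obtain C where C: "compact C" "C \<subseteq> \<Omega>" "\<And>x. x \<notin> C \<Longrightarrow> \<phi> x = 0" "\<And>x. x \<notin> C \<Longrightarrow> gradient \<phi> x = 0"
      using test_function_support[OF \<phi>] by metis
    let ?\<eta> = "\<lambda>x. u x * \<phi> x"
    have g: "gradient ?\<eta> x = u x *\<^sub>R gradient \<phi> x + \<phi> x *\<^sub>R gradient u x" for x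
      by (rule gradient_mult[OF u s])
    note i = integrable_weak_gradient_terms[OF \<Omega> \<phi>]
    have "(\<integral>x. u x *\<^sub>R gradient \<phi> x \<partial>lebesgue_on \<Omega>) + (\<integral>x. \<phi> x *\<^sub>R gradient u x \<partial>lebesgue_on \<Omega>)
      = (\<integral>x. gradient ?\<eta> x \<partial>lebesgue_on \<Omega>)"
      unfolding g using i l by (intro Bochner_Integration.integral_add[symmetric])
    also have "\<dots> = (\<integral>x. gradient ?\<eta> x \<partial>lebesgue)"
    proof (rule integral_lebesgue_on_supported)
      fix x assume "x \<notin> \<Omega>"
      hence "x \<notin> C" using C(2) by blast
      thus "gradient ?\<eta> x = 0" using C(3,4) by (simp add: g)
    qed (use \<Omega> in simp)
    also have "\<dots> = (\<integral>x. gradient ?\<eta> x \<partial>lborel)"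
      using smooth_continuous_on_gradient[OF smooth_mult[OF u s]]
      by (intro integral_completion) (simp add: borel_measurable_continuous_onI)
    also have "\<dots> = 0"
      using C by (intro integral_gradient_eq_0[of _ C] smooth_mult u s) (auto simp: g)
    finally show ?thesis by (simp add: eq_neg_iff_add_eq_0)
  qed
  thus ?thesis using l by (simp add: has_weak_gradient_def)
qed

text \<open>Stated for a general finite measure because it serves Lebesgue measure on \<Omega> as
  well as surface measure on the frontier.\<close>

lemma continuous_L2:
  fixes f :: "real^'n \<Rightarrow> 'b::euclidean_space"
  assumes f: "continuous_on UNIV f" and \<Omega>: "bounded \<Omega>"
    and M: "finite_measure M" "space M = \<Omega>" "f \<in> borel_measurable M"
  shows "f \<in> L2 M"
proof -
  interpret finite_measure M by (rule M)
  have "compact (f ` closure \<Omega>)"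
    using \<Omega> f by (intro compact_continuous_image) (auto intro: continuous_on_subset)
  then obtain B where B: "\<And>x. x \<in> closure \<Omega> \<Longrightarrow> norm (f x) \<le> B"
    using compact_imp_bounded[of "f ` closure \<Omega>"] by (auto simp: bounded_pos)
  have "(norm (f x))\<^sup>2 \<le> B\<^sup>2" if "x \<in> \<Omega>" for x
    using B[of x] that closure_subset[of \<Omega>] by (intro power_mono) auto
  hence "integrable M (\<lambda>x. (norm (f x))\<^sup>2)"
    using M by (intro integrable_const_bound[where B="B\<^sup>2"]) auto
  thus ?thesis using M by (simp add: L2_def)
qed

lemma smooth_H1:
  assumes \<Omega>: "open \<Omega>" "bounded \<Omega>" and u: "smooth u"
  shows "u \<in> H1 \<Omega>" "AE x in lebesgue_on \<Omega>. wgrad \<Omega> u x = gradient u x"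
    "u \<in> L2 (lebesgue_on \<Omega>)" "gradient u \<in> L2 (lebesgue_on \<Omega>)"
proof -
  have fin: "finite_measure (lebesgue_on \<Omega>)"
    using \<Omega> by (intro finite_measure_lebesgue_on bounded_set_imp_lmeasurable) auto
  note cont = smooth_continuous_on[OF u] smooth_continuous_on_gradient[OF u]
  have "u \<in> borel_measurable (lebesgue_on \<Omega>)" "gradient u \<in> borel_measurable (lebesgue_on \<Omega>)"
    by (intro measurable_restrict_space1 measurable_completion; simp add: borel_measurable_continuous_onI cont)+
  thus 1: "u \<in> L2 (lebesgue_on \<Omega>)" "gradient u \<in> L2 (lebesgue_on \<Omega>)"
    using \<Omega> fin cont by (auto intro!: continuous_L2[of _ \<Omega>])
  show "u \<in> H1 \<Omega>" unfolding H1_def using 1 has_weak_gradient_smooth[OF \<Omega>(1) u] by blast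
  show "AE x in lebesgue_on \<Omega>. wgrad \<Omega> u x = gradient u x"
    by (rule wgrad_eq_AE[OF \<Omega>(1) has_weak_gradient_smooth[OF \<Omega>(1) u]])
qed

section \<open>Lipschitz charts\<close>

abbreviation orth_part :: "'a::real_inner \<Rightarrow> 'a \<Rightarrow> 'a" where
  "orth_part e w \<equiv> w - (w \<bullet> e) *\<^sub>R e"

text \<open>Extracts from the chart the two facts used later, after which the graph function never
  reappears: the frontier satisfies the cone condition, and moving from a point of the closure in a
  direction steeper than \<open>L\<close> leads into \<Omega>, as long as both endpoints lie in the
  chart ball.\<close>

lemma lipschitz_chart:
  fixes \<Omega> :: "(real^'n) set"
  assumes \<Omega>: "open \<Omega>" "lipschitz_boundary \<Omega>" and x0: "x0 \<in> frontier \<Omega>"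
  obtains r e L where "r > 0" "norm e = 1" "L \<ge> 0" "cone_set e L (frontier \<Omega> \<inter> ball x0 r)"
    "\<And>y w. y \<in> closure \<Omega> \<Longrightarrow> y \<in> ball x0 r \<Longrightarrow> L * norm (orth_part e w) < w \<bullet> e \<Longrightarrow>
       y + w \<in> ball x0 r \<Longrightarrow> y + w \<in> \<Omega>"
proof -
  obtain r e \<gamma> L where r: "r > 0" and e: "norm e = 1" and lip: "L-lipschitz_on {z. z \<bullet> e = 0} \<gamma>"
    and graph: "\<Omega> \<inter> ball x0 r = {y \<in> ball x0 r. \<gamma> (orth_part e y) < y \<bullet> e}"
    using \<Omega>(2) x0 unfolding lipschitz_boundary_def by blast
  have L: "L \<ge> 0" using lip by (rule lipschitz_on_nonneg)
  have ee: "e \<bullet> e = 1" using e by (simp add: dot_square_norm)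
  have g: "\<bar>\<gamma> (orth_part e y) - \<gamma> (orth_part e z)\<bar> \<le> L * norm (orth_part e (y - z))" for y z
  proof -
    have "dist (\<gamma> (orth_part e y)) (\<gamma> (orth_part e z)) \<le> L * dist (orth_part e y) (orth_part e z)"
      by (rule lipschitz_onD[OF lip]) (simp_all add: inner_diff ee)
    moreover have "orth_part e y - orth_part e z = orth_part e (y - z)"
      by (simp add: inner_diff algebra_simps)
    ultimately show ?thesis by (simp add: dist_norm)
  qed
  have above: "\<gamma> (orth_part e y) \<le> y \<bullet> e" if y: "y \<in> closure \<Omega>" "y \<in> ball x0 r" for y
  proof (rule ccontr)
    assume neg: "\<not> \<gamma> (orth_part e y) \<le> y \<bullet> e"
    define d where "d = \<gamma> (orth_part e y) - y \<bullet> e"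
    \<comment> \<open>The first term keeps the approximating point \<open>z\<close> in the chart
      ball. With the second, height and graph value together change by less than \<open>d\<close>
      between \<open>y\<close> and \<open>z\<close>, too little to lift \<open>z\<close> above the
      graph.\<close>
    define \<eta> where "\<eta> = min (r - dist x0 y) (d / (1 + L))"
    have "d > 0" using neg by (simp add: d_def)
    hence \<eta>: "\<eta> > 0" using y(2) L by (simp add: \<eta>_def)
    obtain z where z: "z \<in> \<Omega>" "dist z y < \<eta>"
      using y(1)[unfolded closure_approachable, rule_format, OF \<eta>] by (elim bexE)
    have "dist z y < r - dist x0 y" using z(2) unfolding \<eta>_def by linarith
    hence "dist x0 z < r" using dist_triangle[of x0 z y] dist_commute[of y z] by linarith
    hence "z \<in> \<Omega> \<inter> ball x0 r" using z(1) by simp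
    hence "\<gamma> (orth_part e z) < z \<bullet> e" unfolding graph by simp
    moreover have "\<bar>\<gamma> (orth_part e y) - \<gamma> (orth_part e z)\<bar> \<le> L * norm (y - z)"
      using g[of y z] mult_left_mono[OF norm_orthogonal_part_le[OF e, of "y - z"] L] by linarith
    moreover have "\<bar>(y - z) \<bullet> e\<bar> \<le> norm (y - z)"
      using Cauchy_Schwarz_ineq2[of "y - z" e] e by simp
    hence "\<bar>y \<bullet> e - z \<bullet> e\<bar> \<le> norm (y - z)" by (simp add: inner_diff)
    moreover have "norm (y - z) < d / (1 + L)" using z(2) by (simp add: \<eta>_def dist_norm norm_minus_commute)
    hence "norm (y - z) + L * norm (y - z) < d" using L by (simp add: field_simps)
    ultimately show False unfolding d_def by linarith
  qed
  have eq: "\<gamma> (orth_part e y) = y \<bullet> e" if y: "y \<in> frontier \<Omega>" "y \<in> ball x0 r" for y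
  proof -
    have "y \<notin> \<Omega>" "y \<in> closure \<Omega>" using y(1) \<Omega>(1) by (auto simp: frontier_def interior_open)
    thus ?thesis using above[of y] graph y(2) by force
  qed
  have "cone_set e L (frontier \<Omega> \<inter> ball x0 r)"
    unfolding cone_set_def
  proof (intro conjI ballI)
    fix x y assume "x \<in> frontier \<Omega> \<inter> ball x0 r" "y \<in> frontier \<Omega> \<inter> ball x0 r"
    thus "\<bar>(x - y) \<bullet> e\<bar> \<le> L * norm (orth_part e (x - y))"
      using eq[of x] eq[of y] g[of x y] by (simp add: inner_diff)
  qed (use e L in auto)
  moreover have "y + w \<in> \<Omega>" if "y \<in> closure \<Omega>" "y \<in> ball x0 r" "L * norm (orth_part e w) < w \<bullet> e"
       "y + w \<in> ball x0 r" for y w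
  proof -
    have "\<gamma> (orth_part e (y + w)) \<le> \<gamma> (orth_part e y) + L * norm (orth_part e w)"
      using g[of "y + w" y] by simp
    also have "\<dots> < (y + w) \<bullet> e" using above[OF that(1,2)] that(3) by (simp add: inner_add)
    finally show ?thesis using graph that(4) by blast
  qed
  ultimately show ?thesis using r e L that by blast
qed

section \<open>Finiteness of the surface measure on a Lipschitz boundary\<close>

lemma measurable_boundary_borel:
  "f \<in> borel_measurable borel \<Longrightarrow> f \<in> borel_measurable (hausdorff_measure k :: 'a::metric_space measure)"
  using borel_subset_hausdorff[where 'a='a] by (auto simp: measurable_def space_borel)

lemma cone_set_boundary_measure:
  fixes S :: "(real^'n) set"
  assumes cs: "cone_set e L S" and \<delta>: "\<delta> > 0" and A: "A \<subseteq> S \<inter> ball z \<delta>" "A \<in> sets boundary_measure"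
  shows "emeasure boundary_measure A
    \<le> ennreal (unit_ball_vol (real (CARD('n) - 1)) * (6 * (1 + L)) ^ CARD('n) * \<delta> ^ (CARD('n) - 1))"
proof -
  have "emeasure boundary_measure A = hausdorff_outer (CARD('n) - 1) A"
    by (rule emeasure_hausdorff_measure[OF A(2)])
  also have "\<dots> \<le> hausdorff_outer (CARD('n) - 1) (S \<inter> ball z \<delta>)"
    by (rule outer_measure_spaceD(2)[OF outer_measure_space_hausdorff A(1)])
  also have "\<dots> \<le> ennreal (unit_ball_vol (real (CARD('n) - 1)) * (6 * (1 + L)) ^ CARD('n) * \<delta> ^ (CARD('n) - 1))"
    using cone_set_hausdorff[OF cs \<delta>, of z] by simp
  finally show ?thesis .
qed

lemma boundary_measure_frontier_finite:
  fixes \<Omega> :: "(real^'n) set"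
  assumes \<Omega>: "lipschitz_domain \<Omega>"
  shows "emeasure boundary_measure (frontier \<Omega>) < \<infinity>"
proof -
  have o: "open \<Omega>" "bounded \<Omega>" "lipschitz_boundary \<Omega>" using \<Omega> by (auto simp: lipschitz_domain_def)
  have bor: "frontier \<Omega> \<inter> ball x r \<in> sets boundary_measure" for x r
    by (rule subsetD[OF borel_subset_hausdorff]) (intro sets.Int borel_closed frontier_closed borel_open open_ball)
  have "\<exists>r>0. emeasure boundary_measure (frontier \<Omega> \<inter> ball x r) < \<infinity>" if x: "x \<in> frontier \<Omega>" for x
  proof -
    obtain r e L where c: "r > 0" "L \<ge> 0" "cone_set e L (frontier \<Omega> \<inter> ball x r)"
      using lipschitz_chart[OF o(1,3) x] by metis
    have "emeasure boundary_measure (frontier \<Omega> \<inter> ball x r) \<le>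
      ennreal (unit_ball_vol (real (CARD('n) - 1)) * (6 * (1 + L)) ^ CARD('n) * r ^ (CARD('n) - 1))"
      by (rule cone_set_boundary_measure[OF c(3,1), where z = x]) (use bor in auto)
    thus ?thesis using c(1) by (auto intro!: exI[of _ r] order.strict_trans1[OF _ ennreal_less_top])
  qed
  then obtain r where r: "\<And>x. x \<in> frontier \<Omega> \<Longrightarrow> r x > 0"
    "\<And>x. x \<in> frontier \<Omega> \<Longrightarrow> emeasure boundary_measure (frontier \<Omega> \<inter> ball x (r x)) < \<infinity>"
    by metis
  have "compact (frontier \<Omega>)" using o by (simp add: compact_frontier_bounded)
  moreover have "frontier \<Omega> \<subseteq> (\<Union>x\<in>frontier \<Omega>. ball x (r x))" using r(1) by force
  ultimately obtain X where X: "X \<subseteq> frontier \<Omega>" "finite X" "frontier \<Omega> \<subseteq> (\<Union>x\<in>X. ball x (r x))"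
    by (elim compactE_image) auto
  have "frontier \<Omega> = (\<Union>x\<in>X. frontier \<Omega> \<inter> ball x (r x))" using X(3) by blast
  hence "emeasure boundary_measure (frontier \<Omega>) = emeasure boundary_measure (\<Union>x\<in>X. frontier \<Omega> \<inter> ball x (r x))"
    by simp
  also have "\<dots> \<le> (\<Sum>x\<in>X. emeasure boundary_measure (frontier \<Omega> \<inter> ball x (r x)))"
    using X(2) by (intro emeasure_subadditive_finite) (use bor in auto)
  also have "\<dots> < \<infinity>" using X r(2) by (auto simp: less_top)
  finally show ?thesis .
qed

lemma finite_measure_boundary_on:
  fixes \<Omega> :: "(real^'n) set"
  assumes \<Omega>: "lipschitz_domain \<Omega>" and G: "\<Gamma> \<subseteq> frontier \<Omega>" "\<Gamma> \<in> sets boundary_measure"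
  shows "finite_measure (boundary_measure_on \<Gamma>)"
proof
  have fr: "frontier \<Omega> \<in> sets (boundary_measure :: (real^'n) measure)"
    by (rule subsetD[OF borel_subset_hausdorff borel_closed[OF frontier_closed]])
  have "emeasure (boundary_measure_on \<Gamma>) (space (boundary_measure_on \<Gamma>)) = emeasure boundary_measure \<Gamma>"
    using G(2) by (simp add: emeasure_restrict_space space_restrict_space)
  also have "\<dots> \<le> emeasure boundary_measure (frontier \<Omega>)" by (rule emeasure_mono[OF G(1) fr])
  also have "\<dots> < \<infinity>" by (rule boundary_measure_frontier_finite[OF \<Omega>])
  finally show "emeasure (boundary_measure_on \<Gamma>) (space (boundary_measure_on \<Gamma>)) \<noteq> \<infinity>" by simp
qed

section \<open>Controlled sets\<close>

abbreviation mass :: "(real^'n) measure \<Rightarrow> (real^'n) set \<Rightarrow> (real^'n \<Rightarrow> real) \<Rightarrow> ennreal" where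
  "mass M S \<phi> \<equiv> \<integral>\<^sup>+x. ennreal ((\<phi> x)\<^sup>2) * indicator S x \<partial>M"

text \<open>The open interval matters: in the surface estimate \<open>x\<close> lies on the
  frontier, and only the points with \<open>t > 0\<close> belong to \<Omega>.\<close>

abbreviation line_energy :: "(real^'n \<Rightarrow> real) \<Rightarrow> real^'n \<Rightarrow> real^'n \<Rightarrow> ennreal" where
  "line_energy \<phi> x v \<equiv>
     \<integral>\<^sup>+t. ennreal ((norm (gradient \<phi> (x + t *\<^sub>R v)))\<^sup>2) * indicator {0<..<1} t \<partial>lborel"

text \<open>The increment \<open>a\<close> is the mean of the directional derivative
  \<open>g\<close> over [0, 1]. The integral of \<open>(g t - a)^2\<close> is nonnegative, which
  bounds \<open>a^2\<close> by the integral of \<open>(g t)^2\<close>; Cauchy-Schwarz then separates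
  \<open>v\<close> from the gradient.\<close>

lemma power2_increment_le:
  fixes \<phi> :: "real^'n \<Rightarrow> real"
  assumes s: "smooth \<phi>"
  shows "ennreal ((\<phi> (x + v) - \<phi> x)\<^sup>2) \<le> ennreal ((norm v)\<^sup>2) *
    line_energy \<phi> x v"
proof -
  define g where "g t = gradient \<phi> (x + t *\<^sub>R v) \<bullet> v" for t :: real
  define a where "a = \<phi> (x + v) - \<phi> x"
  have contG: "continuous_on UNIV (\<lambda>t::real. gradient \<phi> (x + t *\<^sub>R v))"
    by (rule continuous_on_compose2[OF smooth_continuous_on_gradient[OF s, of UNIV]])
       (auto intro!: continuous_intros)
  have contg: "continuous_on S g" for S unfolding g_def
    by (intro continuous_intros continuous_on_subset[OF contG]) auto
  have "((\<lambda>t. \<phi> (x + t *\<^sub>R v)) has_derivative (\<lambda>h. g t * h)) (at t)" for t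
  proof -
    have "((\<lambda>t. \<phi> (x + t *\<^sub>R v)) has_derivative (\<lambda>h. gradient \<phi> (x + t *\<^sub>R v) \<bullet> (h *\<^sub>R v))) (at t)"
      by (rule has_derivative_compose[OF _ smooth_has_gradient[OF s]]) (auto intro!: derivative_eq_intros)
    thus ?thesis by (simp add: g_def mult.commute)
  qed
  hence "(g has_integral (\<phi> (x + 1 *\<^sub>R v) - \<phi> (x + 0 *\<^sub>R v))) {0..1}"
    by (intro fundamental_theorem_of_calculus)
       (auto simp: has_real_derivative_iff_has_vector_derivative[symmetric] has_field_derivative_def
         intro: has_derivative_at_withinI)
  hence g: "(g has_integral a) {0..1}" by (simp add: a_def)
  define I where "I = integral {0..1} (\<lambda>t. (norm (gradient \<phi> (x + t *\<^sub>R v)))\<^sup>2)"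
  have hI: "((\<lambda>t. (norm (gradient \<phi> (x + t *\<^sub>R v)))\<^sup>2) has_integral I) {0..1}"
    unfolding I_def
    by (intro integrable_integral integrable_continuous_real continuous_intros continuous_on_subset[OF contG]) auto
  have hJ: "((\<lambda>t. (g t)\<^sup>2) has_integral integral {0..1} (\<lambda>t. (g t)\<^sup>2)) {0..1}"
    by (intro integrable_integral integrable_continuous_real continuous_intros contg)
  have "((\<lambda>t. (g t)\<^sup>2 - (2 * a) * g t + a\<^sup>2) has_integral (integral {0..1} (\<lambda>t. (g t)\<^sup>2) - (2 * a) * a + a\<^sup>2)) {0..1}"
    using has_integral_const_real[of "a\<^sup>2" 0 1] by (intro has_integral_add has_integral_diff hJ has_integral_mult_right g) simp
  moreover have "(g t)\<^sup>2 - (2 * a) * g t + a\<^sup>2 \<ge> 0" for t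
    using zero_le_power2[of "g t - a"] by (simp add: power2_diff mult_ac)
  ultimately have "0 \<le> integral {0..1} (\<lambda>t. (g t)\<^sup>2) - (2 * a) * a + a\<^sup>2"
    by (rule has_integral_nonneg)
  hence "a\<^sup>2 \<le> integral {0..1} (\<lambda>t. (g t)\<^sup>2)" by (simp add: power2_eq_square)
  also have "\<dots> \<le> (norm v)\<^sup>2 * I"
  proof (rule has_integral_le[OF hJ has_integral_mult_right[OF hI]])
    fix t
    have "\<bar>g t\<bar> \<le> norm v * norm (gradient \<phi> (x + t *\<^sub>R v))"
      using Cauchy_Schwarz_ineq2[of "gradient \<phi> (x + t *\<^sub>R v)" v] by (simp add: g_def mult.commute)
    from power_mono[OF this, of 2]
    show "(g t)\<^sup>2 \<le> (norm v)\<^sup>2 * (norm (gradient \<phi> (x + t *\<^sub>R v)))\<^sup>2"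
      by (simp add: power_mult_distrib)
  qed
  finally have "ennreal (a\<^sup>2) \<le> ennreal ((norm v)\<^sup>2 * I)" by (rule ennreal_leI)
  also have "\<dots> = ennreal ((norm v)\<^sup>2) * ennreal I" by (rule ennreal_mult') simp
  also have "ennreal I = line_energy \<phi> x v"
  proof -
    have "((\<lambda>t. (norm (gradient \<phi> (x + t *\<^sub>R v)))\<^sup>2) has_integral I) {0<..<1}"
      using hI has_integral_open_interval[of _ I 0 "1::real"] by (simp add: cbox_interval box_real)
    hence "ennreal I = (\<integral>\<^sup>+t. indicator {0<..<1} t * (norm (gradient \<phi> (x + t *\<^sub>R v)))\<^sup>2 \<partial>lborel)"
      by (intro nn_integral_has_integral_lebesgue[symmetric]) auto
    also have "\<dots> = line_energy \<phi> x v"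
      by (intro nn_integral_cong) (simp add: indicator_def)
    finally show ?thesis .
  qed
  finally show ?thesis by (simp add: a_def)
qed

lemma ennreal_power2_le:
  "ennreal (a\<^sup>2) \<le> 2 * ennreal (b\<^sup>2) + 2 * ennreal ((a - b)\<^sup>2)"
proof -
  have "0 \<le> (a - 2 * b)\<^sup>2" by simp
  hence "a\<^sup>2 \<le> 2 * b\<^sup>2 + 2 * (a - b)\<^sup>2"
    by (simp add: power2_eq_square algebra_simps)
  hence "ennreal (a\<^sup>2) \<le> ennreal (2 * b\<^sup>2 + 2 * (a - b)\<^sup>2)" by (rule ennreal_leI)
  also have "\<dots> = 2 * ennreal (b\<^sup>2) + 2 * ennreal ((a - b)\<^sup>2)"
    by (simp add: ennreal_mult)
  finally show ?thesis .
qed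

lemma nn_integral_lborel_translate:
  fixes f :: "'a::euclidean_space \<Rightarrow> ennreal"
  assumes [measurable]: "f \<in> borel_measurable borel"
  shows "(\<integral>\<^sup>+x. f (x + v) \<partial>lborel) = (\<integral>\<^sup>+x. f x \<partial>lborel)"
proof -
  have "(\<lambda>x. x + v) = (+) v" by (simp add: fun_eq_iff add.commute)
  hence d: "distr lborel borel (\<lambda>x. x + v) = lborel" using lborel_distr_plus[of v] by (simp only:)
  show ?thesis by (subst (2) d[symmetric], subst nn_integral_distr) auto
qed

text \<open>After the two integrations are exchanged, \<open>t\<close> is fixed and \<open>x\<close>
  is merely shifted by \<open>t *\<^sub>R v\<close>. By translation invariance each \<open>t\<close>
  contributes at most the full Dirichlet integral over \<Omega>.\<close>

lemma nn_integral_increment_le: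
  fixes \<phi> :: "real^'n \<Rightarrow> real"
  assumes s: "smooth \<phi>" and [measurable]: "S \<in> sets borel" "\<Omega> \<in> sets borel"
    and tube: "\<And>x t. x \<in> S \<Longrightarrow> 0 < t \<Longrightarrow> t < 1 \<Longrightarrow> x + t *\<^sub>R v \<in> \<Omega>"
  shows "mass lborel S (\<lambda>x. \<phi> (x + v) - \<phi> x)
    \<le> ennreal ((norm v)\<^sup>2) * (\<integral>\<^sup>+x. ennreal ((norm (gradient \<phi> x))\<^sup>2) * indicator \<Omega> x \<partial>lborel)"
proof -
  define F where "F x = ennreal ((norm (gradient \<phi> x))\<^sup>2) * indicator \<Omega> x" for x
  have [measurable]: "gradient \<phi> \<in> borel_measurable borel"
    by (intro borel_measurable_continuous_onI smooth_continuous_on_gradient s)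
  have F [measurable]: "F \<in> borel_measurable borel" unfolding F_def by measurable
  have "mass lborel S (\<lambda>x. \<phi> (x + v) - \<phi> x)
    \<le> (\<integral>\<^sup>+x. (\<integral>\<^sup>+t. ennreal ((norm v)\<^sup>2) * (F (x + t *\<^sub>R v) * indicator {0<..<1} t) \<partial>lborel) \<partial>lborel)"
  proof (rule nn_integral_mono)
    fix x
    show "ennreal ((\<phi> (x + v) - \<phi> x)\<^sup>2) * indicator S x
      \<le> (\<integral>\<^sup>+t. ennreal ((norm v)\<^sup>2) * (F (x + t *\<^sub>R v) * indicator {0<..<1} t) \<partial>lborel)"
    proof (cases "x \<in> S")
      case True
      have "line_energy \<phi> x v
        = (\<integral>\<^sup>+t. F (x + t *\<^sub>R v) * indicator {0<..<1} t \<partial>lborel)"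
        by (intro nn_integral_cong) (use tube[OF True] in \<open>auto simp: F_def indicator_def\<close>)
      thus ?thesis using power2_increment_le[OF s, of x v] True by (simp add: nn_integral_cmult)
    qed simp
  qed
  also have "\<dots> = (\<integral>\<^sup>+t. (\<integral>\<^sup>+x. ennreal ((norm v)\<^sup>2) * (F (x + t *\<^sub>R v) * indicator {0<..<1} t) \<partial>lborel) \<partial>lborel)"
    by (rule lborel_pair.Fubini') measurable
  also have "\<dots> = (\<integral>\<^sup>+t. (ennreal ((norm v)\<^sup>2) * (\<integral>\<^sup>+x. F x \<partial>lborel)) * indicator {0<..<1} (t::real) \<partial>lborel)"
    by (intro nn_integral_cong) (simp add: nn_integral_cmult nn_integral_multc nn_integral_lborel_translate mult.assoc)
  also have "\<dots> = ennreal ((norm v)\<^sup>2) * (\<integral>\<^sup>+x. F x \<partial>lborel)"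
    by (subst nn_integral_cmult_indicator) auto
  finally show ?thesis by (simp add: F_def)
qed

definition energy :: "(real^'n) set \<Rightarrow> (real^'n) set \<Rightarrow> (real^'n \<Rightarrow> real) \<Rightarrow> ennreal" where
  "energy \<Omega> \<Gamma> \<phi> = (\<integral>\<^sup>+x. ennreal ((norm (gradient \<phi> x))\<^sup>2) * indicator \<Omega> x \<partial>lborel) +
     mass boundary_measure \<Gamma> \<phi>"

definition control_const :: "(real^'n) set \<Rightarrow> (real^'n) set \<Rightarrow> (real^'n) set \<Rightarrow> real \<Rightarrow> bool" where
  "control_const \<Omega> \<Gamma> S C \<longleftrightarrow> 0 \<le> C \<and> (\<forall>\<phi>. smooth \<phi> \<longrightarrow>
     mass lborel S \<phi> \<le> ennreal C * energy \<Omega> \<Gamma> \<phi>)"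

definition controlled :: "(real^'n) set \<Rightarrow> (real^'n) set \<Rightarrow> (real^'n) set \<Rightarrow> bool" where
  "controlled \<Omega> \<Gamma> S \<longleftrightarrow> (\<exists>C. control_const \<Omega> \<Gamma> S C)"

lemma control_constD:
  assumes "control_const \<Omega> \<Gamma> S C"
  shows "0 \<le> C"
    "smooth \<phi> \<Longrightarrow> mass lborel S \<phi> \<le> ennreal C * energy \<Omega> \<Gamma> \<phi>"
  using assms[unfolded control_const_def, THEN conjunct1]
    assms[unfolded control_const_def, THEN conjunct2, rule_format, of \<phi>] by auto

lemma controlledI:
  fixes S :: "(real^'n) set"
  assumes "0 \<le> C"
    and "\<And>\<phi>. smooth \<phi> \<Longrightarrow> mass lborel S \<phi> \<le> ennreal C * energy \<Omega> \<Gamma> \<phi>"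
  shows "controlled \<Omega> \<Gamma> S"
  unfolding controlled_def control_const_def using assms by (intro exI[of _ C] conjI allI impI)

lemma controlled_subset:
  assumes U: "controlled \<Omega> \<Gamma> U" and SU: "S \<subseteq> U"
  shows "controlled \<Omega> \<Gamma> S"
proof -
  obtain C where C: "control_const \<Omega> \<Gamma> U C" using U by (auto simp: controlled_def)
  show ?thesis
  proof (rule controlledI[OF control_constD(1)[OF C]])
    fix \<phi> :: "real^'a \<Rightarrow> real" assume s: "smooth \<phi>"
    have "mass lborel S \<phi> \<le> mass lborel U \<phi>"
    proof (rule nn_integral_mono)
      fix x
      have "indicator S x \<le> (indicator U x :: ennreal)" using SU by (auto simp: indicator_def)
      thus "ennreal ((\<phi> x)\<^sup>2) * indicator S x \<le> ennreal ((\<phi> x)\<^sup>2) * indicator U x" by (rule mult_left_mono) simp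
    qed
    thus "mass lborel S \<phi> \<le> ennreal C * energy \<Omega> \<Gamma> \<phi>"
      using control_constD(2)[OF C s] by (rule order_trans)
  qed
qed

lemma controlled_Un:
  assumes "controlled \<Omega> \<Gamma> S" "controlled \<Omega> \<Gamma> U" and [measurable]: "S \<in> sets borel" "U \<in> sets borel"
  shows "controlled \<Omega> \<Gamma> (S \<union> U)"
proof -
  obtain C where C': "control_const \<Omega> \<Gamma> S C" using assms(1) by (auto simp: controlled_def)
  note C = control_constD(2)[OF C']
  obtain D where D': "control_const \<Omega> \<Gamma> U D" using assms(2) by (auto simp: controlled_def)
  note D = control_constD(2)[OF D']
  have "mass lborel (S \<union> U) \<phi> \<le> ennreal (C + D) * energy \<Omega> \<Gamma> \<phi>"
    if s: "smooth \<phi>" for \<phi>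
  proof -
    have [measurable]: "\<phi> \<in> borel_measurable borel"
      by (intro borel_measurable_continuous_onI smooth_continuous_on s)
    have "mass lborel (S \<union> U) \<phi>
      \<le> (\<integral>\<^sup>+x. ennreal ((\<phi> x)\<^sup>2) * indicator S x + ennreal ((\<phi> x)\<^sup>2) * indicator U x \<partial>lborel)"
      by (intro nn_integral_mono) (auto simp: indicator_def)
    also have "\<dots> = mass lborel S \<phi> + mass lborel U \<phi>"
      by (intro nn_integral_add) measurable
    also have "\<dots> \<le> ennreal C * energy \<Omega> \<Gamma> \<phi> + ennreal D * energy \<Omega> \<Gamma> \<phi>"
      by (intro add_mono C D s)
    also have "\<dots> = ennreal (C + D) * energy \<Omega> \<Gamma> \<phi>"
      using control_constD(1)[OF C'] control_constD(1)[OF D'] by (simp add: distrib_right)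
    finally show ?thesis .
  qed
  thus ?thesis using control_constD(1)[OF C'] control_constD(1)[OF D']
    by (intro controlledI[of "C + D"]) auto
qed

lemma controlled_UN:
  "finite X \<Longrightarrow> (\<And>x. x \<in> X \<Longrightarrow> controlled \<Omega> \<Gamma> (S x) \<and> S x \<in> sets borel) \<Longrightarrow> controlled \<Omega> \<Gamma> (\<Union>x\<in>X. S x)"
proof (induction X rule: finite_induct)
  case empty
  show ?case by (rule controlledI[of 0]) simp_all
next
  case (insert x X)
  hence "(\<Union>x\<in>X. S x) \<in> sets borel" by (intro sets.finite_UN) auto
  thus ?case using insert by (simp add: controlled_Un)
qed

text \<open>Splitting \<open>\<phi> x\<close> into \<open>\<phi> (x + v)\<close> and an increment
  costs a factor 2 in the squares, whence the constant \<open>2 * C + 2 * (norm v)\<^sup>2\<close>.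
  Its growth under repetition is harmless, because only the existence of some constant is
  recorded.\<close>

lemma controlled_translate:
  assumes U: "controlled \<Omega> \<Gamma> U" and m [measurable]: "S \<in> sets borel" "U \<in> sets borel" "\<Omega> \<in> sets borel"
    and SU: "\<And>x. x \<in> S \<Longrightarrow> x + v \<in> U"
    and tube: "\<And>x t. x \<in> S \<Longrightarrow> 0 < t \<Longrightarrow> t < 1 \<Longrightarrow> x + t *\<^sub>R v \<in> \<Omega>"
  shows "controlled \<Omega> \<Gamma> S"
proof -
  obtain C where C': "control_const \<Omega> \<Gamma> U C" using U by (auto simp: controlled_def)
  note C = control_constD[OF C']
  have "mass lborel S \<phi>
      \<le> ennreal (2 * C + 2 * (norm v)\<^sup>2) * energy \<Omega> \<Gamma> \<phi>" if s: "smooth \<phi>" for \<phi>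
  proof -
    have [measurable]: "\<phi> \<in> borel_measurable borel"
      by (intro borel_measurable_continuous_onI smooth_continuous_on s)
    have "mass lborel S \<phi>
      \<le> (\<integral>\<^sup>+x. 2 * (ennreal ((\<phi> (x + v))\<^sup>2) * indicator U (x + v)) + 2 * (ennreal ((\<phi> (x + v) - \<phi> x)\<^sup>2) * indicator S x) \<partial>lborel)"
    proof (intro nn_integral_mono)
      fix x
      show "ennreal ((\<phi> x)\<^sup>2) * indicator S x
        \<le> 2 * (ennreal ((\<phi> (x + v))\<^sup>2) * indicator U (x + v)) + 2 * (ennreal ((\<phi> (x + v) - \<phi> x)\<^sup>2) * indicator S x)"
        using ennreal_power2_le[of "\<phi> x" "\<phi> (x + v)"] SU[of x]
        by (cases "x \<in> S") (simp_all add: power2_commute)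
    qed
    also have "\<dots> = 2 * (\<integral>\<^sup>+x. ennreal ((\<phi> (x + v))\<^sup>2) * indicator U (x + v) \<partial>lborel) +
        2 * mass lborel S (\<lambda>x. \<phi> (x + v) - \<phi> x)"
      by (subst nn_integral_add) (simp_all add: nn_integral_cmult)
    also have "(\<integral>\<^sup>+x. ennreal ((\<phi> (x + v))\<^sup>2) * indicator U (x + v) \<partial>lborel) = mass lborel U \<phi>"
      by (rule nn_integral_lborel_translate[of "\<lambda>x. ennreal ((\<phi> x)\<^sup>2) * indicator U x"]) measurable
    also have "2 * \<dots> + 2 * mass lborel S (\<lambda>x. \<phi> (x + v) - \<phi> x)
      \<le> 2 * (ennreal C * energy \<Omega> \<Gamma> \<phi>) + 2 * (ennreal ((norm v)\<^sup>2) * energy \<Omega> \<Gamma> \<phi>)"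
    proof (intro add_mono mult_left_mono C(2) s)
      have "mass lborel S (\<lambda>x. \<phi> (x + v) - \<phi> x)
        \<le> ennreal ((norm v)\<^sup>2) * (\<integral>\<^sup>+x. ennreal ((norm (gradient \<phi> x))\<^sup>2) * indicator \<Omega> x \<partial>lborel)"
        by (rule nn_integral_increment_le[OF s m(1,3) tube])
      also have "\<dots> \<le> ennreal ((norm v)\<^sup>2) * energy \<Omega> \<Gamma> \<phi>"
        unfolding energy_def by (intro mult_left_mono) auto
      finally show "mass lborel S (\<lambda>x. \<phi> (x + v) - \<phi> x) \<le> ennreal ((norm v)\<^sup>2) * energy \<Omega> \<Gamma> \<phi>" .
    qed auto
    also have "\<dots> = ennreal (2 * C + 2 * (norm v)\<^sup>2) * energy \<Omega> \<Gamma> \<phi>"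
      using C(1) by (simp add: distrib_right ennreal_mult mult.assoc)
    finally show ?thesis .
  qed
  thus ?thesis using C(1) by (intro controlledI[of "2 * C + 2 * (norm v)\<^sup>2"]) auto
qed

text \<open>Within a ball contained in \<Omega> control passes from any point to any other by one
  translation, convexity keeping the segments inside. The property is thus locally constant, and
  connectedness spreads it.\<close>

lemma controlled_interior_propagation:
  assumes \<Omega>: "open \<Omega>" "connected \<Omega>" and a: "a \<in> \<Omega>" "s > 0" "controlled \<Omega> \<Gamma> (ball a s)" and b: "b \<in> \<Omega>"
  shows "\<exists>s>0. controlled \<Omega> \<Gamma> (ball b s)"
proof (rule connected_induction_simple[OF \<Omega>(2), where P = "\<lambda>x. \<exists>s>0. controlled \<Omega> \<Gamma> (ball x s)" and a = a])
  fix c assume "c \<in> \<Omega>"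
  then obtain R where R: "R > 0" "ball c R \<subseteq> \<Omega>" using \<Omega>(1) openE by blast
  show "\<exists>T. openin (top_of_set \<Omega>) T \<and> c \<in> T \<and>
      (\<forall>x\<in>T. \<forall>y\<in>T. (\<exists>s>0. controlled \<Omega> \<Gamma> (ball x s)) \<longrightarrow> (\<exists>s>0. controlled \<Omega> \<Gamma> (ball y s)))"
  proof (intro exI[of _ "ball c R"] conjI ballI impI)
    show "openin (top_of_set \<Omega>) (ball c R)" using R(2) by (simp add: open_openin_trans openin_open_eq \<Omega>(1))
    show "c \<in> ball c R" using R by simp
    fix x y assume x: "x \<in> ball c R" and y: "y \<in> ball c R" and "\<exists>s>0. controlled \<Omega> \<Gamma> (ball x s)"
    then obtain s where s: "s > 0" "controlled \<Omega> \<Gamma> (ball x s)" by blast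
    \<comment> \<open>Small enough that the ball about \<open>y\<close> and its translate about
      \<open>x\<close> stay in \<open>ball c R\<close>, and the translate in the controlled
      \<open>ball x s\<close>.\<close>
    define \<sigma> where "\<sigma> = min s (min (R - dist c x) (R - dist c y))"
    have \<sigma>: "\<sigma> > 0" "\<sigma> \<le> s" "\<sigma> \<le> R - dist c x" "\<sigma> \<le> R - dist c y" using s x y by (auto simp: \<sigma>_def)
    have "controlled \<Omega> \<Gamma> (ball y \<sigma>)"
    proof (rule controlled_translate[OF s(2), of _ "x - y"])
      fix z assume z: "z \<in> ball y \<sigma>"
      have e: "dist x (z + (x - y)) = dist y z" by (simp add: dist_norm algebra_simps)
      show "z + (x - y) \<in> ball x s" using z e \<sigma>(2) by simp
      fix t :: real assume t: "0 < t" "t < 1"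
      have "z \<in> ball c R" using z \<sigma>(4) dist_triangle[of c z y] by simp
      moreover have "z + (x - y) \<in> ball c R" using z e \<sigma>(3) dist_triangle[of c "z + (x - y)" x] by simp
      ultimately have "(1 - t) *\<^sub>R z + t *\<^sub>R (z + (x - y)) \<in> ball c R"
        using t by (intro convexD_alt[OF convex_ball]) auto
      also have "(1 - t) *\<^sub>R z + t *\<^sub>R (z + (x - y)) = z + t *\<^sub>R (x - y)" by (simp add: algebra_simps)
      finally show "z + t *\<^sub>R (x - y) \<in> \<Omega>" using R(2) by blast
    qed (use \<Omega> in auto)
    thus "\<exists>s>0. controlled \<Omega> \<Gamma> (ball y s)" using \<sigma>(1) by blast
  qed
qed (use a b in auto)

section \<open>From the boundary into the interior\<close>

lemma nn_integral_scale_translate: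
  fixes f :: "'a::euclidean_space \<Rightarrow> ennreal"
  assumes [measurable]: "f \<in> borel_measurable borel" and t: "t > 0"
  shows "(\<integral>\<^sup>+v. f v \<partial>lborel) = (\<integral>\<^sup>+u. ennreal (1 / t ^ DIM('a)) * f ((1 / t) *\<^sub>R (u - x)) \<partial>lborel)"
proof -
  have "(\<integral>\<^sup>+u. ennreal (1 / t ^ DIM('a)) * f ((1 / t) *\<^sub>R (u - x)) \<partial>lborel)
    = (\<integral>\<^sup>+v. ennreal (\<bar>t\<bar> ^ DIM('a)) * (ennreal (1 / t ^ DIM('a)) * f ((1 / t) *\<^sub>R ((x + t *\<^sub>R v) - x))) \<partial>lborel)"
    by (subst lborel_affine[of t x]) (use t in \<open>simp_all add: nn_integral_density nn_integral_distr\<close>)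
  also have "\<dots> = (\<integral>\<^sup>+v. f v \<partial>lborel)"
    using t by (intro nn_integral_cong) (simp add: mult.assoc[symmetric] ennreal_mult[symmetric])
  finally show ?thesis by simp
qed

text \<open>The times \<open>t\<close> at which the ball meets the cone set lie within a factor \<open>2\<close> of each other,
  so the singularity \<open>t\<^sup>-\<^sup>1\<close> of the integrand contributes only a constant.\<close>

lemma cone_kernel_bound:
  fixes N :: "(real^'n) measure"
  assumes cs: "cone_set e L S" and A: "A \<ge> 0" and h: "h > 0" and \<rho>: "\<rho> > 0" "(1 + L) * \<rho> \<le> h / 3"
    and reg: "\<And>z \<delta>. \<delta> > 0 \<Longrightarrow> emeasure N (ball z \<delta>) \<le> ennreal (A * \<delta> ^ (CARD('n) - 1))"
    and conc: "\<And>z \<delta>. S \<inter> ball z \<delta> = {} \<Longrightarrow> emeasure N (ball z \<delta>) = 0"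
  shows "(\<integral>\<^sup>+t. ennreal (1 / t ^ CARD('n)) * emeasure N (ball (u - (t * h) *\<^sub>R e) (t * \<rho>)) * indicator {0<..<1} t \<partial>lborel)
    \<le> ennreal (3 * A * \<rho> ^ (CARD('n) - 1))" (is "?J \<le> _")
proof -
  define n where "n = CARD('n) - 1"
  have n: "CARD('n) = Suc n" by (simp add: n_def)
  have e: "norm e = 1" and L: "L \<ge> 0"
    and cone: "\<And>x y. x \<in> S \<Longrightarrow> y \<in> S \<Longrightarrow> \<bar>(x - y) \<bullet> e\<bar> \<le> L * norm (orth_part e (x - y))"
    using cs by (auto simp: cone_set_def)
  have ee: "e \<bullet> e = 1" using e by (simp add: dot_square_norm)
  define T where "T = {t. 0 < t \<and> t < 1 \<and> S \<inter> ball (u - (t * h) *\<^sub>R e) (t * \<rho>) \<noteq> {}}"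
  \<comment> \<open>Points of \<open>S\<close> met at times \<open>t\<close> and \<open>t0\<close>
    differ by \<open>(t - t0) * h\<close> along \<open>e\<close>, up to an error \<open>b\<close> of
    size \<open>(t + t0) * \<rho>\<close>, and orthogonally to \<open>e\<close> by \<open>b\<close>
    alone. The cone condition bounds \<open>(t - t0) * h\<close> by \<open>(1 + L) * norm b\<close>,
    and the hypothesis with \<open>h / 3\<close> turns this into
    \<open>3 * (t - t0) \<le> t + t0\<close>.\<close>
  have close: "t \<le> 2 * t0" if tT: "t \<in> T" "t0 \<in> T" for t t0
  proof -
    obtain x y where x: "x \<in> S" "dist (u - (t * h) *\<^sub>R e) x < t * \<rho>"
      and y: "y \<in> S" "dist (u - (t0 * h) *\<^sub>R e) y < t0 * \<rho>"
      using tT unfolding T_def by auto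
    have pos: "t > 0" "t0 > 0" using tT by (auto simp: T_def)
    define b where "b = (x - (u - (t * h) *\<^sub>R e)) - (y - (u - (t0 * h) *\<^sub>R e))"
    have nb: "norm b \<le> (t + t0) * \<rho>"
    proof -
      have "norm b \<le> norm (x - (u - (t * h) *\<^sub>R e)) + norm (y - (u - (t0 * h) *\<^sub>R e))"
        unfolding b_def by (rule norm_triangle_ineq4)
      thus ?thesis using x(2) y(2) by (simp add: dist_norm norm_minus_commute algebra_simps)
    qed
    have xy: "x - y = b - ((t - t0) * h) *\<^sub>R e" by (simp add: b_def algebra_simps)
    have 1: "(x - y) \<bullet> e = b \<bullet> e - (t - t0) * h" by (simp add: xy inner_diff ee)
    have "orth_part e (x - y) = orth_part e b" unfolding 1 by (simp add: xy algebra_simps)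
    hence 2: "norm (orth_part e (x - y)) \<le> norm b" using norm_orthogonal_part_le[OF e, of b] by simp
    have 3: "\<bar>b \<bullet> e\<bar> \<le> norm b" using Cauchy_Schwarz_ineq2[of b e] e by simp
    have "\<bar>(x - y) \<bullet> e\<bar> \<le> L * norm b" using cone[OF x(1) y(1)] mult_left_mono[OF 2 L] by linarith
    hence "(t - t0) * h \<le> norm b + L * norm b" using 1 3 by linarith
    also have "\<dots> = (1 + L) * norm b" by (simp add: algebra_simps)
    also have "\<dots> \<le> (1 + L) * ((t + t0) * \<rho>)" using nb L by (intro mult_left_mono) auto
    also have "\<dots> = (t + t0) * ((1 + L) * \<rho>)" by simp
    also have "\<dots> \<le> (t + t0) * (h / 3)" using \<rho>(2) pos by (intro mult_left_mono) auto
    also have "\<dots> = ((t + t0) / 3) * h" by simp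
    finally have "t - t0 \<le> (t + t0) / 3" using h by (rule mult_right_le_imp_le)
    hence "3 * (t - t0) \<le> t + t0" by simp
    thus ?thesis by simp
  qed
  show ?thesis
  proof (cases "T = {}")
    case True
    have "?J
      = (\<integral>\<^sup>+t. 0 \<partial>(lborel :: real measure))"
      using True conc by (intro nn_integral_cong) (auto simp: indicator_def T_def)
    thus ?thesis by simp
  next
    case False
    then obtain t0 where t0: "t0 \<in> T" by blast
    have t0p: "t0 > 0" using t0 by (simp add: T_def)
    \<comment> \<open>The measure bound leaves \<open>A * \<rho> ^ n / t\<close>. On the interval,
      \<open>1 / t\<close> is at most \<open>2 / t0\<close>, and the length is
      \<open>3 * t0 / 2\<close>; the product of the two is the 3 of the final bound.\<close>
    have "?J
      \<le> (\<integral>\<^sup>+t. ennreal (A * \<rho> ^ n * (2 / t0)) * indicator {t0/2..2*t0} t \<partial>lborel)"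
    proof (intro nn_integral_mono)
      fix t :: real
      show "ennreal (1 / t ^ CARD('n)) * emeasure N (ball (u - (t * h) *\<^sub>R e) (t * \<rho>)) * indicator {0<..<1} t
        \<le> ennreal (A * \<rho> ^ n * (2 / t0)) * indicator {t0/2..2*t0} t"
      proof (cases "t \<in> T")
        case True
        hence t: "t > 0" "t < 1" by (auto simp: T_def)
        have c: "t0 / 2 \<le> t" "t \<le> 2 * t0" using close[OF True t0] close[OF t0 True] by auto
        have "ennreal (1 / t ^ CARD('n)) * emeasure N (ball (u - (t * h) *\<^sub>R e) (t * \<rho>))
          \<le> ennreal (1 / t ^ CARD('n)) * ennreal (A * (t * \<rho>) ^ n)"
          unfolding n_def using t \<rho> by (intro mult_left_mono reg) auto
        also have "\<dots> = ennreal (A * \<rho> ^ n * (1 / t))"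
          using t A \<rho> by (subst ennreal_mult[symmetric]) (auto simp: n power_mult_distrib field_simps)
        also have "\<dots> \<le> ennreal (A * \<rho> ^ n * (2 / t0))"
          using t t0p c A \<rho> by (intro ennreal_leI mult_left_mono) (auto simp: field_simps)
        finally show ?thesis using t c by simp
      next
        case False
        thus ?thesis using conc[of "u - (t * h) *\<^sub>R e" "t * \<rho>"] by (auto simp: T_def indicator_def)
      qed
    qed
    also have "\<dots> = ennreal (A * \<rho> ^ n * (2 / t0)) * ennreal (2 * t0 - t0 / 2)"
      using t0p by (subst nn_integral_cmult_indicator) auto
    also have "\<dots> = ennreal (3 * A * \<rho> ^ n)"
      using t0p A \<rho> by (subst ennreal_mult[symmetric]) (auto simp: field_simps)
    finally show ?thesis by (simp add: n_def)
  qed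
qed

text \<open>For fixed \<open>x\<close> and \<open>t\<close> the substitution \<open>u = x + t v\<close> turns the average over \<open>v\<close> into an integral over
  \<open>u\<close>; the kernel of \<open>cone_kernel_bound\<close> is what remains after integrating over \<open>x\<close> and \<open>t\<close>.\<close>

lemma surface_increment_bound:
  fixes N :: "(real^'n) measure" and F :: "real^'n \<Rightarrow> ennreal"
  assumes fin: "finite_measure N" and sets [measurable_cong]: "sets N = sets borel"
    and cs: "cone_set e L S" and A: "A \<ge> 0" and h: "h > 0" and \<rho>: "\<rho> > 0" "(1 + L) * \<rho> \<le> h / 3"
    and reg: "\<And>z \<delta>. \<delta> > 0 \<Longrightarrow> emeasure N (ball z \<delta>) \<le> ennreal (A * \<delta> ^ (CARD('n) - 1))"
    and conc: "\<And>z \<delta>. S \<inter> ball z \<delta> = {} \<Longrightarrow> emeasure N (ball z \<delta>) = 0"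
    and F [measurable]: "F \<in> borel_measurable borel"
  shows "(\<integral>\<^sup>+x. \<integral>\<^sup>+v. indicator (ball (h *\<^sub>R e) \<rho>) v * (\<integral>\<^sup>+t. F (x + t *\<^sub>R v) * indicator {0<..<1} t \<partial>lborel) \<partial>lborel \<partial>N)
    \<le> ennreal (3 * A * \<rho> ^ (CARD('n) - 1)) * (\<integral>\<^sup>+x. F x \<partial>lborel)"
proof -
  interpret N: finite_measure N by (rule fin)
  interpret P: pair_sigma_finite N "lborel :: real measure" ..
  interpret Q: pair_sigma_finite N "lborel :: (real^'n) measure" ..
  let ?V = "ball (h *\<^sub>R e) \<rho>"
  have [measurable]: "?V \<in> sets borel" by simp
  define n where "n = CARD('n)"
  \<comment> \<open>With \<open>u = x + t v\<close> the condition that \<open>v\<close> lies within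
    \<rho> of \<open>h *\<^sub>R e\<close> becomes one on \<open>x\<close>, namely that
    \<open>x\<close> lies within \<open>t * \<rho>\<close> of
    \<open>u - (t * h) *\<^sub>R e\<close>; \<open>1 / t ^ n\<close> is the Jacobian.\<close>
  define W where "W x t u = ennreal (1 / t ^ n) * F u * indicator {0<..<1} t *
    (if dist (u - (t * h) *\<^sub>R e) x < t * \<rho> then 1 else 0)" for x u :: "real^'n" and t :: real
  have inner: "(\<integral>\<^sup>+v. indicator ?V v * (F (x + t *\<^sub>R v) * indicator {0<..<1} t) \<partial>lborel) = (\<integral>\<^sup>+u. W x t u \<partial>lborel)"
    for x and t :: real
  proof (cases "0 < t \<and> t < 1")
    case True
    have "(\<integral>\<^sup>+v. indicator ?V v * (F (x + t *\<^sub>R v) * indicator {0<..<1} t) \<partial>lborel)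
      = (\<integral>\<^sup>+u. ennreal (1 / t ^ DIM(real^'n)) * (indicator ?V ((1/t) *\<^sub>R (u - x)) * (F (x + t *\<^sub>R ((1/t) *\<^sub>R (u - x))) * indicator {0<..<1} t)) \<partial>lborel)"
    proof (rule nn_integral_scale_translate[where x = x])
      show "(\<lambda>v. indicator ?V v * (F (x + t *\<^sub>R v) * indicator {0<..<1} t)) \<in> borel_measurable borel"
        by measurable
    qed (use True in simp)
    also have "\<dots> = (\<integral>\<^sup>+u. W x t u \<partial>lborel)"
    proof (intro nn_integral_cong)
      fix u
      have "dist (h *\<^sub>R e) ((1/t) *\<^sub>R (u - x)) = (1/t) * dist (u - (t * h) *\<^sub>R e) x"
      proof -
        have "h *\<^sub>R e - (1/t) *\<^sub>R (u - x) = (-1/t) *\<^sub>R ((u - (t * h) *\<^sub>R e) - x)"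
          using True by (simp add: algebra_simps)
        thus ?thesis unfolding dist_norm using True by (simp only: norm_scaleR) simp
      qed
      hence "dist (h *\<^sub>R e) ((1/t) *\<^sub>R (u - x)) < \<rho> \<longleftrightarrow> dist (u - (t * h) *\<^sub>R e) x < t * \<rho>"
        using True by (simp only:) (simp add: pos_divide_less_eq mult.commute)
      thus "ennreal (1 / t ^ DIM(real^'n)) * (indicator ?V ((1/t) *\<^sub>R (u - x)) * (F (x + t *\<^sub>R ((1/t) *\<^sub>R (u - x))) * indicator {0<..<1} t))
        = W x t u" using True by (simp add: W_def n_def indicator_def)
    qed
    finally show ?thesis .
  next
    case False
    hence "indicator {0<..<1} t = (0::ennreal)" by auto
    thus ?thesis by (simp add: W_def)
  qed
  have "(\<integral>\<^sup>+x. \<integral>\<^sup>+v. indicator ?V v * (\<integral>\<^sup>+t. F (x + t *\<^sub>R v) * indicator {0<..<1} t \<partial>lborel) \<partial>lborel \<partial>N)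
    = (\<integral>\<^sup>+x. \<integral>\<^sup>+v. (\<integral>\<^sup>+t. indicator ?V v * (F (x + t *\<^sub>R v) * indicator {0<..<1} t) \<partial>lborel) \<partial>lborel \<partial>N)"
    by (intro nn_integral_cong nn_integral_cmult[symmetric]) measurable
  also have "\<dots> = (\<integral>\<^sup>+x. \<integral>\<^sup>+t. (\<integral>\<^sup>+v. indicator ?V v * (F (x + t *\<^sub>R v) * indicator {0<..<1} t) \<partial>lborel) \<partial>lborel \<partial>N)"
    by (intro nn_integral_cong lborel_pair.Fubini') measurable
  also have "\<dots> = (\<integral>\<^sup>+x. \<integral>\<^sup>+t. \<integral>\<^sup>+u. W x t u \<partial>lborel \<partial>lborel \<partial>N)"
    by (simp only: inner)
  also have "\<dots> = (\<integral>\<^sup>+x. \<integral>\<^sup>+u. \<integral>\<^sup>+t. W x t u \<partial>lborel \<partial>lborel \<partial>N)"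
    unfolding W_def by (intro nn_integral_cong lborel_pair.Fubini') measurable
  also have "\<dots> = (\<integral>\<^sup>+u. \<integral>\<^sup>+x. \<integral>\<^sup>+t. W x t u \<partial>lborel \<partial>N \<partial>lborel)"
    unfolding W_def by (rule Q.Fubini'[symmetric]) measurable
  also have "\<dots> = (\<integral>\<^sup>+u. \<integral>\<^sup>+t. \<integral>\<^sup>+x. W x t u \<partial>N \<partial>lborel \<partial>lborel)"
    unfolding W_def by (intro nn_integral_cong P.Fubini'[symmetric]) measurable
  also have "\<dots> \<le> (\<integral>\<^sup>+u. ennreal (3 * A * \<rho> ^ (CARD('n) - 1)) * F u \<partial>lborel)"
  proof (intro nn_integral_mono)
    fix u
    have "(\<integral>\<^sup>+x. W x t u \<partial>N) = F u * (ennreal (1 / t ^ CARD('n)) * emeasure N (ball (u - (t * h) *\<^sub>R e) (t * \<rho>)) * indicator {0<..<1} t)"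
      for t :: real
    proof -
      have "(\<integral>\<^sup>+x. W x t u \<partial>N) = (\<integral>\<^sup>+x. (ennreal (1 / t ^ n) * F u * indicator {0<..<1} t) * indicator (ball (u - (t * h) *\<^sub>R e) (t * \<rho>)) x \<partial>N)"
        unfolding W_def by (intro nn_integral_cong) (simp add: indicator_def)
      also have "\<dots> = (ennreal (1 / t ^ n) * F u * indicator {0<..<1} t) * emeasure N (ball (u - (t * h) *\<^sub>R e) (t * \<rho>))"
        by (subst nn_integral_cmult_indicator) (auto simp: sets)
      finally show ?thesis by (simp add: n_def mult_ac)
    qed
    hence "(\<integral>\<^sup>+t. \<integral>\<^sup>+x. W x t u \<partial>N \<partial>lborel) =
      (\<integral>\<^sup>+t. F u * (ennreal (1 / t ^ CARD('n)) * emeasure N (ball (u - (t * h) *\<^sub>R e) (t * \<rho>)) * indicator {0<..<1} t) \<partial>lborel)"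
      by simp
    also have "\<dots> = F u * (\<integral>\<^sup>+t. ennreal (1 / t ^ CARD('n)) * emeasure N (ball (u - (t * h) *\<^sub>R e) (t * \<rho>)) * indicator {0<..<1} t \<partial>lborel)"
    proof (rule nn_integral_cmult)
      \<comment> \<open>Measurability in \<open>t\<close> of the measure of a moving ball comes from
        writing it as an integral with a parameter.\<close>
      have m: "(\<lambda>t::real. \<integral>\<^sup>+x. (if dist (u - (t * h) *\<^sub>R e) x < t * \<rho> then 1 else 0) \<partial>N) \<in> borel_measurable lborel"
        by measurable
      have "(\<integral>\<^sup>+x. (if dist (u - (t * h) *\<^sub>R e) x < t * \<rho> then 1 else 0) \<partial>N) = emeasure N (ball (u - (t * h) *\<^sub>R e) (t * \<rho>))" for t
      proof -
        have "(\<integral>\<^sup>+x. (if dist (u - (t * h) *\<^sub>R e) x < t * \<rho> then 1 else 0) \<partial>N) = (\<integral>\<^sup>+x. indicator (ball (u - (t * h) *\<^sub>R e) (t * \<rho>)) x \<partial>N)"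
          by (intro nn_integral_cong) (simp add: indicator_def)
        thus ?thesis by (simp add: sets)
      qed
      hence [measurable]: "(\<lambda>t::real. emeasure N (ball (u - (t * h) *\<^sub>R e) (t * \<rho>))) \<in> borel_measurable borel"
        using m by simp
      show "(\<lambda>t. ennreal (1 / t ^ CARD('n)) * emeasure N (ball (u - (t * h) *\<^sub>R e) (t * \<rho>)) * indicator {0<..<1} t) \<in> borel_measurable lborel"
        by measurable
    qed
    also have "\<dots> \<le> F u * ennreal (3 * A * \<rho> ^ (CARD('n) - 1))"
      by (intro mult_left_mono cone_kernel_bound[OF cs A h \<rho> reg conc]) auto
    finally show "(\<integral>\<^sup>+t. \<integral>\<^sup>+x. W x t u \<partial>N \<partial>lborel) \<le> ennreal (3 * A * \<rho> ^ (CARD('n) - 1)) * F u"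
      by (simp add: mult.commute)
  qed
  also have "\<dots> = ennreal (3 * A * \<rho> ^ (CARD('n) - 1)) * (\<integral>\<^sup>+u. F u \<partial>lborel)"
    by (rule nn_integral_cmult) measurable
  finally show ?thesis .
qed

lemma ennreal_le_of_mult_le:
  assumes c: "0 < c" and le: "ennreal c * X \<le> Y"
  shows "X \<le> ennreal (1 / c) * Y"
proof -
  have "X = ennreal (1 / c) * (ennreal c * X)"
    using c by (simp add: mult.assoc[symmetric] ennreal_mult[symmetric])
  also have "\<dots> \<le> ennreal (1 / c) * Y" by (rule mult_left_mono[OF le]) simp
  finally show ?thesis .
qed

text \<open>The choice \<open>(1 + L) * \<rho> = h / 3\<close> has two uses: it makes every vector
  within \<rho> of \<open>h *\<^sub>R e\<close> steeper than \<open>L\<close>, so that segments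
  starting on the frontier enter \<Omega>, and it is the smallness required by
  \<open>cone_kernel_bound\<close>. With \<open>h = r / 4\<close> the reach
  \<open>\<rho> / 2 + h + \<rho>\<close> stays below \<open>r\<close>.\<close>

lemma controlled_seed_chart:
  fixes \<Omega> \<Gamma> \<Gamma>' :: "(real^'n) set"
  assumes dom: "lipschitz_domain \<Omega>" and x0: "x0 \<in> frontier \<Omega>"
    and r: "r > 0" and cs: "cone_set e L (frontier \<Omega> \<inter> ball x0 r)"
    and above: "\<And>y w. y \<in> closure \<Omega> \<Longrightarrow> y \<in> ball x0 r \<Longrightarrow> L * norm (orth_part e w) < w \<bullet> e \<Longrightarrow>
       y + w \<in> ball x0 r \<Longrightarrow> y + w \<in> \<Omega>"
    and h: "h = r / 4" and \<rho>: "\<rho> = h / (3 * (1 + L))"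
    and \<Gamma>': "\<Gamma>' \<subseteq> frontier \<Omega> \<inter> ball x0 (\<rho> / 2)" "\<Gamma>' \<in> sets boundary_measure" "\<Gamma>' \<subseteq> \<Gamma>"
      "emeasure boundary_measure \<Gamma>' > 0"
  shows "x0 + h *\<^sub>R e \<in> \<Omega>" "controlled \<Omega> \<Gamma> (ball (x0 + h *\<^sub>R e) (\<rho> / 2))"
proof -
  have \<Omega>: "open \<Omega>" using dom by (simp add: lipschitz_domain_def)
  have e: "norm e = 1" and L: "L \<ge> 0" using cs by (auto simp: cone_set_def)
  have ee: "e \<bullet> e = 1" using e by (simp add: dot_square_norm)
  have h0: "h > 0" using r h by simp
  have \<rho>0: "\<rho> > 0" using h0 L by (simp add: \<rho>)
  have \<rho>L: "(1 + L) * \<rho> \<le> h / 3" using L by (simp add: \<rho> field_simps)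
  have \<rho>h: "\<rho> + L * \<rho> \<le> h / 3" "L * \<rho> \<ge> 0" using \<rho>L L \<rho>0 by (auto simp: algebra_simps)
  have fcl: "frontier \<Omega> \<subseteq> closure \<Omega>" by (simp add: frontier_def)
  show "x0 + h *\<^sub>R e \<in> \<Omega>"
    using x0 fcl r h0 h e by (intro above) (auto simp: ee dist_norm)
  define Z where "Z = frontier \<Omega> \<inter> ball x0 (\<rho> / 2)"
  have up: "x + t *\<^sub>R v \<in> \<Omega>" if x: "x \<in> Z" and v: "v \<in> ball (h *\<^sub>R e) \<rho>" and t: "0 < t" "t < 1" for x v t
  proof (rule above)
    have xf: "x \<in> frontier \<Omega>" "dist x0 x < \<rho> / 2" using x by (auto simp: Z_def)
    show "x \<in> closure \<Omega>" using xf fcl by blast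
    have "\<rho> \<le> h" using \<rho>h h0 by linarith
    show "x \<in> ball x0 r" using xf(2) \<open>\<rho> \<le> h\<close> h h0 by simp
    define u where "u = v - h *\<^sub>R e"
    have u: "norm u < \<rho>" "v = h *\<^sub>R e + u" using v by (auto simp: u_def dist_norm norm_minus_commute)
    have ue: "\<bar>u \<bullet> e\<bar> \<le> norm u" using Cauchy_Schwarz_ineq2[of u e] e by simp
    have ve: "v \<bullet> e = h + u \<bullet> e" by (simp add: u(2) inner_add ee)
    have "orth_part e (t *\<^sub>R v) = t *\<^sub>R orth_part e u"
      by (simp add: ve inner_scaleR_left) (simp add: u(2) algebra_simps)
    hence "norm (orth_part e (t *\<^sub>R v)) \<le> t * norm u"
      using norm_orthogonal_part_le[OF e, of u] t by (simp add: mult_left_mono)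
    also have "\<dots> \<le> t * \<rho>" using u(1) t by (intro mult_left_mono) auto
    finally have "L * norm (orth_part e (t *\<^sub>R v)) \<le> L * (t * \<rho>)" using L by (rule mult_left_mono)
    also have "\<dots> = t * (L * \<rho>)" by simp
    also have "\<dots> < t * (v \<bullet> e)"
    proof (rule mult_strict_left_mono[OF _ t(1)])
      show "L * \<rho> < v \<bullet> e" using \<rho>h ue u(1) ve h0 by linarith
    qed
    finally show "L * norm (orth_part e (t *\<^sub>R v)) < (t *\<^sub>R v) \<bullet> e" by simp
    have "norm v \<le> h + norm u" using norm_triangle_ineq[of "h *\<^sub>R e" u] e h0 by (simp add: u(2))
    hence "norm (t *\<^sub>R v) \<le> 1 * (h + \<rho>)" unfolding norm_scaleR using t u(1) by (intro mult_mono) auto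
    hence "dist x0 (x + t *\<^sub>R v) < \<rho> / 2 + (h + \<rho>)"
      using xf(2) norm_triangle_ineq[of "x - x0" "t *\<^sub>R v"]
      by (simp add: dist_norm norm_minus_commute[of x0] algebra_simps)
    thus "x + t *\<^sub>R v \<in> ball x0 r" using \<open>\<rho> \<le> h\<close> h h0 \<rho>h by simp
  qed
  \<comment> \<open>Fubini calls for a sigma-finite measure and joint Borel measurability.
    Restriction to \<open>\<Gamma>'\<close> makes the surface measure finite, and the image under
    the identity replaces the Caratheodory sets by Borel sets.\<close>
  define N where "N = distr (boundary_measure_on \<Gamma>') borel (\<lambda>x. x)"
  have idm: "(\<lambda>x. x) \<in> boundary_measure_on \<Gamma>' \<rightarrow>\<^sub>M borel"
    using measurable_boundary_borel[of "\<lambda>x. x"] by (intro measurable_restrict_space1) auto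
  have sN [measurable_cong]: "sets N = sets borel" by (simp add: N_def)
  have fr: "\<Gamma>' \<subseteq> frontier \<Omega>" using \<Gamma>'(1) by blast
  have finN: "finite_measure N"
    unfolding N_def by (rule finite_measure.finite_measure_distr[OF finite_measure_boundary_on[OF dom fr \<Gamma>'(2)] idm])
  interpret N: finite_measure N by (rule finN)
  have nnN: "(\<integral>\<^sup>+x. f x \<partial>N) = (\<integral>\<^sup>+x. f x * indicator \<Gamma>' x \<partial>boundary_measure)" if "f \<in> borel_measurable borel" for f
    unfolding N_def using that idm \<Gamma>'(2) by (simp add: nn_integral_distr nn_integral_restrict_space)
  have emN: "emeasure N B = emeasure boundary_measure (B \<inter> \<Gamma>')" if B: "B \<in> sets borel" for B
  proof -
    have "emeasure N B = emeasure (boundary_measure_on \<Gamma>') (B \<inter> \<Gamma>')"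
      unfolding N_def using B by (subst emeasure_distr[OF idm]) (auto simp: space_restrict_space)
    also have "\<dots> = emeasure boundary_measure (B \<inter> \<Gamma>')"
      using \<Gamma>'(2) by (intro emeasure_restrict_space) auto
    finally show ?thesis .
  qed
  have bor: "B \<in> sets borel \<Longrightarrow> B \<inter> \<Gamma>' \<in> sets boundary_measure" for B
    by (rule sets.Int[OF subsetD[OF borel_subset_hausdorff] \<Gamma>'(2)])
  define S where "S = frontier \<Omega> \<inter> ball x0 r"
  have "\<rho> \<le> r" using \<rho>h h0 h by linarith
  have \<Gamma>S: "\<Gamma>' \<subseteq> S" using \<Gamma>'(1) \<open>\<rho> \<le> r\<close> \<rho>0 by (auto simp: S_def)
  define A where "A = unit_ball_vol (real (CARD('n) - 1)) * (6 * (1 + L)) ^ CARD('n)"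
  have A: "A \<ge> 0" using L by (simp add: A_def)
  have reg: "emeasure N (ball z \<delta>) \<le> ennreal (A * \<delta> ^ (CARD('n) - 1))" if "\<delta> > 0" for z \<delta>
    unfolding A_def
    using cone_set_boundary_measure[OF cs that, of "ball z \<delta> \<inter> \<Gamma>'" z] \<Gamma>S bor[of "ball z \<delta>"]
    by (auto simp: emN S_def)
  have conc: "emeasure N (ball z \<delta>) = 0" if "S \<inter> ball z \<delta> = {}" for z \<delta>
  proof -
    have "ball z \<delta> \<inter> \<Gamma>' = {}" using that \<Gamma>S by blast
    thus ?thesis by (simp add: emN)
  qed
  define c where "c = measure N (space N)"
  have c: "emeasure N (space N) = ennreal c" by (simp add: c_def N.emeasure_eq_measure)
  have "emeasure N (space N) > 0" using \<Gamma>'(4) by (simp add: emN sets_eq_imp_space_eq[OF sN])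
  hence c0: "c > 0" by (simp add: c)
  define V where "V = ball (h *\<^sub>R e) \<rho>"
  have [measurable]: "V \<in> sets borel" by (simp add: V_def)
  define vol where "vol = unit_ball_vol (real CARD('n)) * \<rho> ^ CARD('n)"
  have vol: "vol \<ge> 0" "emeasure lborel V = ennreal vol"
    using \<rho>0 by (simp_all add: vol_def V_def emeasure_ball)
  define B where "B = ball (x0 + h *\<^sub>R e) (\<rho> / 2)"
  have [measurable]: "B \<in> sets borel" by (simp add: B_def)
  define D where "D = 3 * A * \<rho> ^ (CARD('n) - 1)"
  have D: "D \<ge> 0" using A \<rho>0 by (simp add: D_def)
  show "controlled \<Omega> \<Gamma> (ball (x0 + h *\<^sub>R e) (\<rho> / 2))"
  proof (rule controlledI)
    \<comment> \<open>\<open>c\<close> is the surface measure of \<open>\<Gamma>'\<close>, the total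
      weight of the average. \<open>2 * vol\<close> comes from the boundary values spread over
      \<open>V\<close>, \<open>h + \<rho>\<close> bounds the length of the vectors, and
      \<open>D\<close> is the constant of the sweeping estimate.\<close>
    show "0 \<le> (1 / c) * (2 * vol + 2 * ((h + \<rho>)\<^sup>2 * D))" using c0 vol D by simp
    fix \<phi> :: "real^'n \<Rightarrow> real" assume s: "smooth \<phi>"
    have [measurable]: "\<phi> \<in> borel_measurable borel" "gradient \<phi> \<in> borel_measurable borel"
      by (intro borel_measurable_continuous_onI smooth_continuous_on smooth_continuous_on_gradient s)+
    have [measurable]: "\<Omega> \<in> sets borel" using \<Omega> by simp
    define F where "F x = ennreal ((norm (gradient \<phi> x))\<^sup>2) * indicator \<Omega> x" for x
    have F [measurable]: "F \<in> borel_measurable borel" unfolding F_def by measurable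
    define I where "I x v = (\<integral>\<^sup>+t. F (x + t *\<^sub>R v) * indicator {0<..<1} t \<partial>lborel)" for x v
    have I [measurable]: "case_prod I \<in> borel_measurable (borel \<Otimes>\<^sub>M borel)"
      unfolding I_def by measurable
    have I' [measurable]: "(\<lambda>v. I x v) \<in> borel_measurable borel" for x
      unfolding I_def by measurable
    have AEN: "AE x in N. x \<in> Z"
    proof -
      have "Z \<in> sets borel" unfolding Z_def by (intro sets.Int borel_closed borel_open) auto
      hence "(AE x in N. x \<in> Z) \<longleftrightarrow> (AE x in boundary_measure_on \<Gamma>'. x \<in> Z)"
        unfolding N_def by (intro AE_distr_iff[OF idm]) auto
      moreover have "AE x in boundary_measure_on \<Gamma>'. x \<in> Z"
        using \<Gamma>'(1) by (intro AE_I2) (auto simp: space_restrict_space Z_def)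
      ultimately show ?thesis by blast
    qed
    let ?X = "\<integral>\<^sup>+z. ennreal ((\<phi> z)\<^sup>2) * indicator B z \<partial>lborel"
    \<comment> \<open>The average starts from a constant. For every \<open>x\<close> in
      \<open>Z\<close> the ball \<open>B\<close> is contained in \<open>x + V\<close>, because the
      radii \<open>\<rho> / 2\<close> of \<open>Z\<close> and \<open>B\<close> add up to \<rho>; so
      each \<open>x\<close> bounds all of \<open>?X\<close>.\<close>
    have "ennreal c * ?X = (\<integral>\<^sup>+x. ?X \<partial>N)" by (simp add: c mult.commute)
    also have "\<dots> \<le> (\<integral>\<^sup>+x. \<integral>\<^sup>+v. indicator V v * ennreal ((\<phi> (x + v))\<^sup>2) \<partial>lborel \<partial>N)"
    proof (rule nn_integral_mono_AE, rule eventually_mono[OF AEN])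
      fix x assume x: "x \<in> Z"
      have "?X \<le> (\<integral>\<^sup>+z. indicator V (z - x) * ennreal ((\<phi> z)\<^sup>2) \<partial>lborel)"
      proof (rule nn_integral_mono)
        fix z
        have "z - x \<in> V" if z: "z \<in> B"
        proof -
          have "h *\<^sub>R e - (z - x) = (x0 + h *\<^sub>R e - z) + (x - x0)" by simp
          hence "norm (h *\<^sub>R e - (z - x)) \<le> norm (x0 + h *\<^sub>R e - z) + norm (x - x0)" by (metis norm_triangle_ineq)
          also have "\<dots> < \<rho> / 2 + \<rho> / 2"
            using z x by (intro add_strict_mono) (auto simp: B_def Z_def dist_norm norm_minus_commute)
          finally show ?thesis by (simp add: V_def dist_norm)
        qed
        thus "ennreal ((\<phi> z)\<^sup>2) * indicator B z \<le> indicator V (z - x) * ennreal ((\<phi> z)\<^sup>2)"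
          by (auto simp: indicator_def)
      qed
      also have "\<dots> = (\<integral>\<^sup>+v. indicator V v * ennreal ((\<phi> (v + x))\<^sup>2) \<partial>lborel)"
        using nn_integral_lborel_translate[of "\<lambda>z. indicator V (z - x) * ennreal ((\<phi> z)\<^sup>2)" x] by simp
      finally show "?X \<le> (\<integral>\<^sup>+v. indicator V v * ennreal ((\<phi> (x + v))\<^sup>2) \<partial>lborel)" by (simp add: add.commute)
    qed
    also have "\<dots> \<le> (\<integral>\<^sup>+x. \<integral>\<^sup>+v. (2 * ennreal ((\<phi> x)\<^sup>2)) * indicator V v + ennreal (2 * (h + \<rho>)\<^sup>2) * (indicator V v * I x v) \<partial>lborel \<partial>N)"
    proof (rule nn_integral_mono_AE, rule eventually_mono[OF AEN], rule nn_integral_mono)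
      fix x v assume x: "x \<in> Z"
      show "indicator V v * ennreal ((\<phi> (x + v))\<^sup>2)
        \<le> (2 * ennreal ((\<phi> x)\<^sup>2)) * indicator V v + ennreal (2 * (h + \<rho>)\<^sup>2) * (indicator V v * I x v)"
      proof (cases "v \<in> V")
        case True
        have nv: "norm v \<le> h + \<rho>"
          using True norm_triangle_ineq2[of v "h *\<^sub>R e"] e h0 by (simp add: V_def dist_norm norm_minus_commute)
        have "ennreal ((\<phi> (x + v))\<^sup>2) \<le> 2 * ennreal ((\<phi> x)\<^sup>2) + 2 * ennreal ((\<phi> (x + v) - \<phi> x)\<^sup>2)"
          by (rule ennreal_power2_le)
        also have "\<dots> \<le> 2 * ennreal ((\<phi> x)\<^sup>2) + 2 * (ennreal ((norm v)\<^sup>2) *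
            line_energy \<phi> x v)"
          by (intro add_left_mono mult_left_mono power2_increment_le s) simp
        also have "line_energy \<phi> x v = I x v"
          unfolding I_def
          by (intro nn_integral_cong) (use up[OF x True[unfolded V_def]] in \<open>auto simp: F_def indicator_def\<close>)
        also have "2 * ennreal ((\<phi> x)\<^sup>2) + 2 * (ennreal ((norm v)\<^sup>2) * I x v)
          \<le> 2 * ennreal ((\<phi> x)\<^sup>2) + 2 * (ennreal ((h + \<rho>)\<^sup>2) * I x v)"
          using nv by (intro add_left_mono mult_left_mono mult_right_mono ennreal_leI power_mono) auto
        finally show ?thesis using True by (simp add: ennreal_mult mult.assoc)
      qed simp
    qed
    also have "\<dots> = (\<integral>\<^sup>+x. (2 * ennreal ((\<phi> x)\<^sup>2)) * emeasure lborel V + ennreal (2 * (h + \<rho>)\<^sup>2) * (\<integral>\<^sup>+v. indicator V v * I x v \<partial>lborel) \<partial>N)"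
      by (intro nn_integral_cong) (simp add: nn_integral_add nn_integral_cmult nn_integral_cmult_indicator)
    also have "\<dots> = (\<integral>\<^sup>+x. (2 * ennreal ((\<phi> x)\<^sup>2)) * emeasure lborel V \<partial>N) +
        (\<integral>\<^sup>+x. ennreal (2 * (h + \<rho>)\<^sup>2) * (\<integral>\<^sup>+v. indicator V v * I x v \<partial>lborel) \<partial>N)"
      by (rule nn_integral_add) measurable
    also have "(\<integral>\<^sup>+x. ennreal (2 * (h + \<rho>)\<^sup>2) * (\<integral>\<^sup>+v. indicator V v * I x v \<partial>lborel) \<partial>N)
      = ennreal (2 * (h + \<rho>)\<^sup>2) * (\<integral>\<^sup>+x. (\<integral>\<^sup>+v. indicator V v * I x v \<partial>lborel) \<partial>N)"
      by (rule nn_integral_cmult) measurable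
    also have "(\<integral>\<^sup>+x. (2 * ennreal ((\<phi> x)\<^sup>2)) * emeasure lborel V \<partial>N) = ennreal (2 * vol) * (\<integral>\<^sup>+x. ennreal ((\<phi> x)\<^sup>2) \<partial>N)"
      using vol by (subst nn_integral_cmult[symmetric]) (auto simp: ennreal_mult mult_ac)
    also have "(\<integral>\<^sup>+x. ennreal ((\<phi> x)\<^sup>2) \<partial>N) = mass boundary_measure \<Gamma>' \<phi>"
      by (rule nnN) measurable
    also have "ennreal (2 * vol) * mass boundary_measure \<Gamma>' \<phi> +
        ennreal (2 * (h + \<rho>)\<^sup>2) * (\<integral>\<^sup>+x. (\<integral>\<^sup>+v. indicator V v * I x v \<partial>lborel) \<partial>N)
      \<le> ennreal (2 * vol) * energy \<Omega> \<Gamma> \<phi> + ennreal (2 * (h + \<rho>)\<^sup>2) * (ennreal D * energy \<Omega> \<Gamma> \<phi>)"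
    proof (intro add_mono mult_left_mono)
      have "mass boundary_measure \<Gamma>' \<phi>
        \<le> mass boundary_measure \<Gamma> \<phi>"
        using \<Gamma>'(3) by (intro nn_integral_mono) (auto simp: indicator_def)
      also have "\<dots> \<le> energy \<Omega> \<Gamma> \<phi>" by (simp add: energy_def)
      finally show "mass boundary_measure \<Gamma>' \<phi> \<le> energy \<Omega> \<Gamma> \<phi>" .
      have "(\<integral>\<^sup>+x. (\<integral>\<^sup>+v. indicator V v * I x v \<partial>lborel) \<partial>N) \<le> ennreal D * (\<integral>\<^sup>+x. F x \<partial>lborel)"
        unfolding I_def V_def D_def
        by (rule surface_increment_bound[OF finN sN cs A h0 \<rho>0 \<rho>L reg conc[unfolded S_def] F])
      also have "\<dots> \<le> ennreal D * energy \<Omega> \<Gamma> \<phi>" by (intro mult_left_mono) (auto simp: energy_def F_def)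
      finally show "(\<integral>\<^sup>+x. (\<integral>\<^sup>+v. indicator V v * I x v \<partial>lborel) \<partial>N) \<le> ennreal D * energy \<Omega> \<Gamma> \<phi>" .
    qed auto
    also have "\<dots> = ennreal (2 * vol + 2 * ((h + \<rho>)\<^sup>2 * D)) * energy \<Omega> \<Gamma> \<phi>"
      using vol D by (subst ennreal_plus) (auto simp: distrib_right ennreal_mult mult.assoc)
    finally have "ennreal c * ?X \<le> ennreal (2 * vol + 2 * ((h + \<rho>)\<^sup>2 * D)) * energy \<Omega> \<Gamma> \<phi>" .
    from ennreal_le_of_mult_le[OF c0 this]
    show "(\<integral>\<^sup>+z. ennreal ((\<phi> z)\<^sup>2) * indicator (ball (x0 + h *\<^sub>R e) (\<rho> / 2)) z \<partial>lborel)
      \<le> ennreal ((1 / c) * (2 * vol + 2 * ((h + \<rho>)\<^sup>2 * D))) * energy \<Omega> \<Gamma> \<phi>"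
      unfolding B_def using c0 vol D by (subst ennreal_mult) (auto simp: mult.assoc)
  qed
qed

text \<open>Finitely many chart balls cover the frontier, and since \<Gamma> has positive measure at
  least one of them carries a part of \<Gamma> of positive measure.\<close>

lemma controlled_seed:
  fixes \<Omega> \<Gamma> :: "(real^'n) set"
  assumes dom: "lipschitz_domain \<Omega>" and \<Gamma>: "\<Gamma> \<subseteq> frontier \<Omega>" "\<Gamma> \<in> sets boundary_measure"
      "emeasure boundary_measure \<Gamma> > 0"
  obtains a s where "a \<in> \<Omega>" "s > 0" "controlled \<Omega> \<Gamma> (ball a s)"
proof -
  have o: "open \<Omega>" "bounded \<Omega>" "lipschitz_boundary \<Omega>" using dom by (auto simp: lipschitz_domain_def)
  have bor: "\<Gamma> \<inter> ball x r \<in> sets boundary_measure" for x r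
    by (rule sets.Int[OF \<Gamma>(2) subsetD[OF borel_subset_hausdorff borel_open[OF open_ball]]])
  \<comment> \<open>The radius is fixed at every frontier point, before it is known where the mass
    of \<Gamma> sits; compactness can then be applied to all these balls.\<close>
  have "\<exists>\<eta>>0. emeasure boundary_measure (\<Gamma> \<inter> ball x \<eta>) > 0 \<longrightarrow> (\<exists>a\<in>\<Omega>. \<exists>s>0. controlled \<Omega> \<Gamma> (ball a s))"
    if x: "x \<in> frontier \<Omega>" for x
  proof -
    obtain r e L where ch: "r > 0" "norm e = 1" "L \<ge> 0" "cone_set e L (frontier \<Omega> \<inter> ball x r)"
      "\<And>y w. y \<in> closure \<Omega> \<Longrightarrow> y \<in> ball x r \<Longrightarrow> L * norm (orth_part e w) < w \<bullet> e \<Longrightarrow>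
         y + w \<in> ball x r \<Longrightarrow> y + w \<in> \<Omega>"
      using lipschitz_chart[OF o(1,3) x] by metis
    define h where "h = r / 4"
    define \<rho> where "\<rho> = h / (3 * (1 + L))"
    have "\<rho> > 0" using ch(1,3) by (simp add: \<rho>_def h_def)
    moreover have "x + h *\<^sub>R e \<in> \<Omega> \<and> controlled \<Omega> \<Gamma> (ball (x + h *\<^sub>R e) (\<rho> / 2))"
      if "emeasure boundary_measure (\<Gamma> \<inter> ball x (\<rho> / 2)) > 0"
      using controlled_seed_chart[OF dom x ch(1,4,5) h_def \<rho>_def, of "\<Gamma> \<inter> ball x (\<rho> / 2)" \<Gamma>] that \<Gamma>(1) bor
      by blast
    ultimately show ?thesis by (intro exI[of _ "\<rho> / 2"]) (auto intro!: exI[of _ "\<rho> / 2"])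
  qed
  then obtain \<eta> where \<eta>: "\<And>x. x \<in> frontier \<Omega> \<Longrightarrow> \<eta> x > 0"
    "\<And>x. x \<in> frontier \<Omega> \<Longrightarrow> emeasure boundary_measure (\<Gamma> \<inter> ball x (\<eta> x)) > 0 \<Longrightarrow>
       \<exists>a\<in>\<Omega>. \<exists>s>0. controlled \<Omega> \<Gamma> (ball a s)"
    by metis
  have "compact (frontier \<Omega>)" using o by (simp add: compact_frontier_bounded)
  moreover have "frontier \<Omega> \<subseteq> (\<Union>x\<in>frontier \<Omega>. ball x (\<eta> x))" using \<eta>(1) by force
  ultimately obtain X where X: "X \<subseteq> frontier \<Omega>" "finite X" "frontier \<Omega> \<subseteq> (\<Union>x\<in>X. ball x (\<eta> x))"
    by (elim compactE_image) auto
  have "\<exists>x\<in>X. emeasure boundary_measure (\<Gamma> \<inter> ball x (\<eta> x)) > 0"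
  proof (rule ccontr)
    assume "\<not> ?thesis"
    hence 0: "emeasure boundary_measure (\<Gamma> \<inter> ball x (\<eta> x)) = 0" if "x \<in> X" for x using that by auto
    have "\<Gamma> = (\<Union>x\<in>X. \<Gamma> \<inter> ball x (\<eta> x))" using X(3) \<Gamma>(1) by blast
    hence "emeasure boundary_measure \<Gamma> = emeasure boundary_measure (\<Union>x\<in>X. \<Gamma> \<inter> ball x (\<eta> x))"
      by simp
    also have "\<dots> \<le> (\<Sum>x\<in>X. emeasure boundary_measure (\<Gamma> \<inter> ball x (\<eta> x)))"
      using X(2) by (intro emeasure_subadditive_finite) (use bor in auto)
    also have "\<dots> = 0" using 0 by simp
    finally show False using \<Gamma>(3) by simp
  qed
  then obtain x where "x \<in> X" "emeasure boundary_measure (\<Gamma> \<inter> ball x (\<eta> x)) > 0" by blast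
  with \<eta>(2)[of x] X(1) show ?thesis using that by blast
qed

lemma poincare_smooth:
  fixes \<Omega> \<Gamma> :: "(real^'n) set"
  assumes dom: "lipschitz_domain \<Omega>" and \<Gamma>: "\<Gamma> \<subseteq> frontier \<Omega>" "\<Gamma> \<in> sets boundary_measure"
      "emeasure boundary_measure \<Gamma> > 0"
  shows "controlled \<Omega> \<Gamma> \<Omega>"
proof -
  have o: "open \<Omega>" "bounded \<Omega>" "connected \<Omega>" "lipschitz_boundary \<Omega>" using dom by (auto simp: lipschitz_domain_def)
  have inner: "\<exists>s>0. controlled \<Omega> \<Gamma> (ball b s)" if "b \<in> \<Omega>" for b
  proof -
    obtain a s where "a \<in> \<Omega>" "s > 0" "controlled \<Omega> \<Gamma> (ball a s)" using controlled_seed[OF dom \<Gamma>] .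
    thus ?thesis using controlled_interior_propagation[OF o(1,3)] that by blast
  qed
  have "\<exists>s>0. controlled \<Omega> \<Gamma> (\<Omega> \<inter> ball x s)" if x: "x \<in> closure \<Omega>" for x
  proof (cases "x \<in> \<Omega>")
    case True
    thus ?thesis using inner[OF True] controlled_subset by (meson Int_lower2)
  next
    case False
    hence xf: "x \<in> frontier \<Omega>" using x o(1) by (simp add: frontier_def interior_open)
    obtain r e L where ch: "r > 0" "norm e = 1" "L \<ge> 0"
      "\<And>y w. y \<in> closure \<Omega> \<Longrightarrow> y \<in> ball x r \<Longrightarrow> L * norm (orth_part e w) < w \<bullet> e \<Longrightarrow>
         y + w \<in> ball x r \<Longrightarrow> y + w \<in> \<Omega>"
      using lipschitz_chart[OF o(1,4) xf] by metis
    have ee: "e \<bullet> e = 1" using ch(2) by (simp add: dot_square_norm)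
    \<comment> \<open>Parallel to \<open>e\<close>, hence with vanishing orthogonal part and steeper
      than any \<open>L\<close>. It carries the boundary point \<open>x\<close> to an interior point
      with a controlled ball about it, and points near \<open>x\<close> into that ball.\<close>
    define v where "v = (r / 2) *\<^sub>R e"
    have up: "y + t *\<^sub>R v \<in> \<Omega>" if "y \<in> closure \<Omega>" "dist x y < r / 2" "0 < t" "t \<le> 1" for y t
    proof (rule ch(4))
      show "y \<in> ball x r" using that ch(1) by simp
      show "L * norm (orth_part e (t *\<^sub>R v)) < (t *\<^sub>R v) \<bullet> e" using that ch(1) by (simp add: v_def ee)
      have "norm (t *\<^sub>R v) \<le> 1 * (r / 2)" using that ch(1,2) by (simp add: v_def)
      thus "y + t *\<^sub>R v \<in> ball x r"
        using that(2) norm_triangle_ineq[of "y - x" "t *\<^sub>R v"]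
        by (simp add: dist_norm norm_minus_commute[of x] algebra_simps)
    qed (use that in auto)
    have "x + v \<in> \<Omega>" using up[of x 1] x ch(1) by simp
    then obtain s where s: "s > 0" "controlled \<Omega> \<Gamma> (ball (x + v) s)" using inner by blast
    define \<rho> where "\<rho> = min s (r / 2)"
    have "controlled \<Omega> \<Gamma> (\<Omega> \<inter> ball x \<rho>)"
    proof (rule controlled_translate[OF s(2), of _ v])
      fix y assume y: "y \<in> \<Omega> \<inter> ball x \<rho>"
      show "y + v \<in> ball (x + v) s" using y by (simp add: \<rho>_def)
      show "y + t *\<^sub>R v \<in> \<Omega>" if "0 < t" "t < 1" for t
        using y that closure_subset[of \<Omega>] by (intro up) (auto simp: \<rho>_def)
    qed (use o(1) in auto)
    moreover have "\<rho> > 0" using s ch(1) by (simp add: \<rho>_def)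
    ultimately show ?thesis by blast
  qed
  then obtain s where s: "\<And>x. x \<in> closure \<Omega> \<Longrightarrow> s x > 0"
    "\<And>x. x \<in> closure \<Omega> \<Longrightarrow> controlled \<Omega> \<Gamma> (\<Omega> \<inter> ball x (s x))" by metis
  have "compact (closure \<Omega>)" using o(2) by simp
  moreover have "closure \<Omega> \<subseteq> (\<Union>x\<in>closure \<Omega>. ball x (s x))" using s(1) by force
  ultimately obtain X where X: "X \<subseteq> closure \<Omega>" "finite X" "closure \<Omega> \<subseteq> (\<Union>x\<in>X. ball x (s x))"
    by (elim compactE_image) auto
  have "controlled \<Omega> \<Gamma> (\<Union>x\<in>X. \<Omega> \<inter> ball x (s x))"
    using X s(2) o(1) by (intro controlled_UN) auto
  thus ?thesis
    by (rule controlled_subset) (use X(3) closure_subset[of \<Omega>] in blast)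
qed

section \<open>Traces and the Poincare inequality\<close>

lemma nn_integral_continuous_lebesgue_on:
  fixes f :: "real^'n \<Rightarrow> 'b::euclidean_space"
  assumes \<Omega>: "open \<Omega>" and c: "continuous_on UNIV f" and f: "f \<in> L2 (lebesgue_on \<Omega>)"
  shows "(\<integral>\<^sup>+x. ennreal ((norm (f x))\<^sup>2) * indicator \<Omega> x \<partial>lborel) = ennreal ((L2_norm (lebesgue_on \<Omega>) f)\<^sup>2)"
proof -
  have [measurable]: "f \<in> borel_measurable borel" "\<Omega> \<in> sets borel"
    using c \<Omega> by (auto intro: borel_measurable_continuous_onI)
  have "(\<integral>\<^sup>+x. ennreal ((norm (f x))\<^sup>2) * indicator \<Omega> x \<partial>lborel)
    = (\<integral>\<^sup>+x. ennreal ((norm (f x))\<^sup>2) * indicator \<Omega> x \<partial>lebesgue)"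
    by (rule nn_integral_completion[symmetric])
  also have "\<dots> = (\<integral>\<^sup>+x. ennreal ((norm (f x))\<^sup>2) \<partial>lebesgue_on \<Omega>)"
    using \<Omega> by (subst nn_integral_restrict_space) auto
  also have "\<dots> = ennreal ((L2_norm (lebesgue_on \<Omega>) f)\<^sup>2)"
    unfolding L2_norm_power2 using L2_D(2)[OF f] by (intro nn_integral_eq_integral) auto
  finally show ?thesis .
qed

text \<open>Outside \<open>L2\<close> the function \<open>L2_norm\<close> takes the junk value \<open>0\<close>, and convergence to the trace would
  carry no information; this is where finiteness of the boundary measure enters.\<close>

lemma smooth_L2_boundary:
  fixes \<Omega> :: "(real^'n) set"
  assumes dom: "lipschitz_domain \<Omega>" and s: "smooth \<phi>"
  shows "\<phi> \<in> L2 (boundary_measure_on (frontier \<Omega>))"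
proof (rule continuous_L2[of _ "frontier \<Omega>"])
  have fr: "frontier \<Omega> \<in> sets (boundary_measure :: (real^'n) measure)"
    by (rule subsetD[OF borel_subset_hausdorff borel_closed[OF frontier_closed]])
  show "finite_measure (boundary_measure_on (frontier \<Omega>))"
    by (rule finite_measure_boundary_on[OF dom subset_refl fr])
  show "bounded (frontier \<Omega>)" using dom by (auto simp: lipschitz_domain_def frontier_def intro: bounded_subset[OF bounded_closure])
  show "\<phi> \<in> borel_measurable (boundary_measure_on (frontier \<Omega>))"
    by (intro measurable_restrict_space1 measurable_boundary_borel borel_measurable_continuous_onI smooth_continuous_on s)
qed (simp_all add: smooth_continuous_on s space_restrict_space)

lemma H1_norm_ge:
  "L2_norm (lebesgue_on \<Omega>) u \<le> H1_norm \<Omega> u" "L2_norm (lebesgue_on \<Omega>) (wgrad \<Omega> u) \<le> H1_norm \<Omega> u"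
  unfolding H1_norm_def by (auto intro!: real_le_rsqrt)

lemma has_trace_diff:
  fixes \<Omega> :: "(real^'n) set"
  assumes dom: "lipschitz_domain \<Omega>" and u: "has_trace \<Omega> u a" and v: "has_trace \<Omega> v b"
  shows "has_trace \<Omega> (\<lambda>x. u x - v x) (\<lambda>x. a x - b x)"
proof -
  let ?B = "boundary_measure_on (frontier \<Omega>)"
  have o: "open \<Omega>" "bounded \<Omega>" using dom by (auto simp: lipschitz_domain_def)
  obtain \<phi> where \<phi>: "\<forall>k. smooth (\<phi> k)" "(\<lambda>k. H1_norm \<Omega> (\<lambda>x. \<phi> k x - u x)) \<longlonglongrightarrow> 0"
    "(\<lambda>k. L2_norm ?B (\<lambda>x. \<phi> k x - a x)) \<longlonglongrightarrow> 0" and ua: "u \<in> H1 \<Omega>" "a \<in> L2 ?B"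
    using u unfolding has_trace_def by blast
  obtain \<psi> where \<psi>: "\<forall>k. smooth (\<psi> k)" "(\<lambda>k. H1_norm \<Omega> (\<lambda>x. \<psi> k x - v x)) \<longlonglongrightarrow> 0"
    "(\<lambda>k. L2_norm ?B (\<lambda>x. \<psi> k x - b x)) \<longlonglongrightarrow> 0" and vb: "v \<in> H1 \<Omega>" "b \<in> L2 ?B"
    using v unfolding has_trace_def by blast
  have h: "(\<lambda>x. \<phi> k x - u x) \<in> H1 \<Omega>" "(\<lambda>x. \<psi> k x - v x) \<in> H1 \<Omega>" for k
    by (rule H1_diff(1)[OF o(1) smooth_H1(1)[OF o \<phi>(1)[rule_format]] ua(1)],
        rule H1_diff(1)[OF o(1) smooth_H1(1)[OF o \<psi>(1)[rule_format]] vb(1)])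
  have l: "(\<lambda>x. \<phi> k x - a x) \<in> L2 ?B" "(\<lambda>x. \<psi> k x - b x) \<in> L2 ?B" for k
    by (rule L2_diff(1)[OF smooth_L2_boundary[OF dom \<phi>(1)[rule_format]] ua(2)],
        rule L2_diff(1)[OF smooth_L2_boundary[OF dom \<psi>(1)[rule_format]] vb(2)])
  have re: "\<phi> k x - \<psi> k x - (p - q) = (\<phi> k x - p) - (\<psi> k x - q)" for k x p q by simp
  have "(\<lambda>k. H1_norm \<Omega> (\<lambda>x. \<phi> k x - \<psi> k x - (u x - v x))) \<longlonglongrightarrow> 0"
  proof (rule tendsto_sandwich[OF _ _ tendsto_const])
    show "\<forall>\<^sub>F k in sequentially. 0 \<le> H1_norm \<Omega> (\<lambda>x. \<phi> k x - \<psi> k x - (u x - v x))"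
      by (simp add: H1_norm_def)
    show "\<forall>\<^sub>F k in sequentially. H1_norm \<Omega> (\<lambda>x. \<phi> k x - \<psi> k x - (u x - v x))
        \<le> 2 * (H1_norm \<Omega> (\<lambda>x. \<phi> k x - u x) + H1_norm \<Omega> (\<lambda>x. \<psi> k x - v x))"
      unfolding re by (intro always_eventually allI H1_norm_diff_le[OF o(1)] h)
    show "(\<lambda>k. 2 * (H1_norm \<Omega> (\<lambda>x. \<phi> k x - u x) + H1_norm \<Omega> (\<lambda>x. \<psi> k x - v x))) \<longlonglongrightarrow> 0"
      using tendsto_mult[OF tendsto_const tendsto_add[OF \<phi>(2) \<psi>(2)], of 2] by simp
  qed
  moreover have "(\<lambda>k. L2_norm ?B (\<lambda>x. \<phi> k x - \<psi> k x - (a x - b x))) \<longlonglongrightarrow> 0"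
  proof (rule tendsto_sandwich[OF _ _ tendsto_const])
    show "\<forall>\<^sub>F k in sequentially. 0 \<le> L2_norm ?B (\<lambda>x. \<phi> k x - \<psi> k x - (a x - b x))" by simp
    show "\<forall>\<^sub>F k in sequentially. L2_norm ?B (\<lambda>x. \<phi> k x - \<psi> k x - (a x - b x))
        \<le> L2_norm ?B (\<lambda>x. \<phi> k x - a x) + L2_norm ?B (\<lambda>x. \<psi> k x - b x)"
      unfolding re by (intro always_eventually allI L2_diff(2) l)
    show "(\<lambda>k. L2_norm ?B (\<lambda>x. \<phi> k x - a x) + L2_norm ?B (\<lambda>x. \<psi> k x - b x)) \<longlonglongrightarrow> 0"
      using tendsto_add[OF \<phi>(3) \<psi>(3)] by simp
  qed
  moreover have "\<forall>k. smooth (\<lambda>x. \<phi> k x - \<psi> k x)" using \<phi>(1) \<psi>(1) by (simp add: smooth_diff)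
  ultimately show ?thesis
    unfolding has_trace_def
    by (intro conjI H1_diff(1)[OF o(1) ua(1) vb(1)] L2_diff(1)[OF ua(2) vb(2)]
        exI[of _ "\<lambda>k x. \<phi> k x - \<psi> k x"])
qed

text \<open>Makes \<open>p2 - p1\<close> an admissible test function.\<close>

lemma H1_Dir_diff:
  assumes dom: "lipschitz_domain \<Omega>" and u: "u \<in> H1_Dir \<Omega> \<Gamma>" and v: "v \<in> H1_Dir \<Omega> \<Gamma>"
  shows "(\<lambda>x. u x - v x) \<in> H1_Dir \<Omega> \<Gamma>"
proof -
  obtain a where a: "has_trace \<Omega> u a" "AE x in boundary_measure_on \<Gamma>. a x = 0"
    using u by (auto simp: H1_Dir_def)
  obtain b where b: "has_trace \<Omega> v b" "AE x in boundary_measure_on \<Gamma>. b x = 0"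
    using v by (auto simp: H1_Dir_def)
  have t: "has_trace \<Omega> (\<lambda>x. u x - v x) (\<lambda>x. a x - b x)" by (rule has_trace_diff[OF dom a(1) b(1)])
  moreover have "AE x in boundary_measure_on \<Gamma>. a x - b x = 0" using a(2) b(2) by eventually_elim simp
  moreover have "(\<lambda>x. u x - v x) \<in> H1 \<Omega>" using t by (simp add: has_trace_def)
  ultimately show ?thesis unfolding H1_Dir_def by (intro CollectI conjI exI[of _ "\<lambda>x. a x - b x"])
qed

text \<open>Let smooth \<open>\<phi> k\<close> approximate \<open>q\<close> and its trace
  \<open>w\<close>. As \<open>w\<close> vanishes on \<Gamma>, the norm of \<open>\<phi> k\<close> on
  \<Gamma> is at most the norm of \<open>\<phi> k - w\<close> on the frontier, which tends to 0; the
  boundary term of the smooth estimate is lost in the limit.\<close>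

lemma poincare_H1_Dir:
  fixes \<Omega> \<Gamma> :: "(real^'n) set"
  assumes dom: "lipschitz_domain \<Omega>" and \<Gamma>: "\<Gamma> \<subseteq> frontier \<Omega>" "\<Gamma> \<in> sets boundary_measure"
      "emeasure boundary_measure \<Gamma> > 0"
  shows "\<exists>C\<ge>0. \<forall>q \<in> H1_Dir \<Omega> \<Gamma>.
    L2_norm (lebesgue_on \<Omega>) q \<le> C * L2_norm (lebesgue_on \<Omega>) (wgrad \<Omega> q)"
proof -
  let ?M = "lebesgue_on \<Omega>"
  let ?B = "boundary_measure_on (frontier \<Omega>)"
  have o: "open \<Omega>" "bounded \<Omega>" using dom by (auto simp: lipschitz_domain_def)
  have \<Omega>s: "\<Omega> \<in> sets lebesgue" using o(1) by simp
  have frs: "frontier \<Omega> \<in> sets (boundary_measure :: (real^'n) measure)"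
    by (rule subsetD[OF borel_subset_hausdorff borel_closed[OF frontier_closed]])
  obtain C where C: "control_const \<Omega> \<Gamma> \<Omega> C" using poincare_smooth[OF dom \<Gamma>] by (auto simp: controlled_def)
  have C0: "C \<ge> 0" by (rule control_constD(1)[OF C])
  have smooth_est: "L2_norm ?M \<phi> \<le> sqrt C * (L2_norm ?M (gradient \<phi>) + L2_norm ?B (\<lambda>x. \<phi> x - w x))"
    if s: "smooth \<phi>" and w: "w \<in> L2 ?B" "AE x in boundary_measure_on \<Gamma>. w x = 0" for \<phi> w
  proof -
    let ?g = "L2_norm ?M (gradient \<phi>)" and ?b = "L2_norm ?B (\<lambda>x. \<phi> x - w x)"
    have L: "(\<lambda>x. \<phi> x - w x) \<in> L2 ?B" by (rule L2_diff(1)[OF smooth_L2_boundary[OF dom s] w(1)])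
    have AEw: "AE x in boundary_measure. x \<in> \<Gamma> \<longrightarrow> w x = 0"
      using w(2) \<Gamma>(2) by (simp add: AE_restrict_space_iff)
    have "mass boundary_measure \<Gamma> \<phi>
      \<le> (\<integral>\<^sup>+x. ennreal ((norm (\<phi> x - w x))\<^sup>2) * indicator (frontier \<Omega>) x \<partial>boundary_measure)"
      by (intro nn_integral_mono_AE eventually_mono[OF AEw]) (use \<Gamma>(1) in \<open>auto simp: indicator_def\<close>)
    also have "\<dots> = (\<integral>\<^sup>+x. ennreal ((norm (\<phi> x - w x))\<^sup>2) \<partial>?B)"
      using frs by (subst nn_integral_restrict_space) auto
    also have "\<dots> = ennreal (?b\<^sup>2)"
      unfolding L2_norm_power2 using L2_D(2)[OF L] by (intro nn_integral_eq_integral) auto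
    finally have bd: "mass boundary_measure \<Gamma> \<phi> \<le> ennreal (?b\<^sup>2)" .
    have "ennreal ((L2_norm ?M \<phi>)\<^sup>2) = mass lborel \<Omega> \<phi>"
      using nn_integral_continuous_lebesgue_on[OF o(1) smooth_continuous_on[OF s] smooth_H1(3)[OF o s]] by simp
    also have "\<dots> \<le> ennreal C * energy \<Omega> \<Gamma> \<phi>" by (rule control_constD(2)[OF C s])
    also have "energy \<Omega> \<Gamma> \<phi> \<le> ennreal (?g\<^sup>2) + ennreal (?b\<^sup>2)"
      unfolding energy_def
      by (rule add_mono[OF eq_refl bd])
         (rule nn_integral_continuous_lebesgue_on[OF o(1) smooth_continuous_on_gradient[OF s] smooth_H1(4)[OF o s]])
    finally have "ennreal ((L2_norm ?M \<phi>)\<^sup>2) \<le> ennreal (C * (?g\<^sup>2 + ?b\<^sup>2))"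
      using C0 by (simp add: ennreal_mult mult_left_mono)
    hence "(L2_norm ?M \<phi>)\<^sup>2 \<le> C * (?g\<^sup>2 + ?b\<^sup>2)" using C0 by (subst (asm) ennreal_le_iff) auto
    also have "\<dots> \<le> C * (?g + ?b)\<^sup>2" using C0 by (intro mult_left_mono) (auto simp: power2_sum)
    also have "\<dots> = (sqrt C * (?g + ?b))\<^sup>2" using C0 by (simp add: power_mult_distrib)
    finally show ?thesis by (rule power2_le_imp_le) (simp add: C0)
  qed
  have "L2_norm ?M q \<le> sqrt C * L2_norm ?M (wgrad \<Omega> q)" if q: "q \<in> H1_Dir \<Omega> \<Gamma>" for q
  proof -
    obtain w where w: "has_trace \<Omega> q w" "AE x in boundary_measure_on \<Gamma>. w x = 0"
      using q by (auto simp: H1_Dir_def)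
    obtain \<phi> where \<phi>: "\<forall>k. smooth (\<phi> k)" "(\<lambda>k. H1_norm \<Omega> (\<lambda>x. \<phi> k x - q x)) \<longlonglongrightarrow> 0"
      "(\<lambda>k. L2_norm ?B (\<lambda>x. \<phi> k x - w x)) \<longlonglongrightarrow> 0" and qw: "q \<in> H1 \<Omega>" "w \<in> L2 ?B"
      using w(1) unfolding has_trace_def by blast
    let ?a = "\<lambda>k. H1_norm \<Omega> (\<lambda>x. \<phi> k x - q x)" and ?b = "\<lambda>k. L2_norm ?B (\<lambda>x. \<phi> k x - w x)"
    let ?g = "L2_norm ?M (wgrad \<Omega> q)"
    have bound: "L2_norm ?M q \<le> ?a k + sqrt C * ((?a k + ?g) + ?b k)" for k
    proof -
      have s: "smooth (\<phi> k)" using \<phi>(1) by blast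
      note S = smooth_H1[OF o s] and Q = H1_D[OF o(1) qw(1)]
      have "L2_norm ?M q \<le> L2_norm ?M (\<lambda>x. q x - \<phi> k x) + L2_norm ?M (\<phi> k)"
        by (rule L2_norm_triangle[OF Q(1) S(3)])
      also have "L2_norm ?M (\<lambda>x. q x - \<phi> k x) \<le> ?a k"
        using H1_norm_ge(1)[of \<Omega> "\<lambda>x. \<phi> k x - q x"] by (simp add: L2_norm_commute)
      also have "L2_norm ?M (\<phi> k) \<le> sqrt C * (L2_norm ?M (gradient (\<phi> k)) + ?b k)"
        by (rule smooth_est[OF s qw(2) w(2)])
      also have "L2_norm ?M (gradient (\<phi> k)) \<le> ?a k + ?g"
      proof -
        have ae: "AE x in ?M. wgrad \<Omega> (\<lambda>x. \<phi> k x - q x) x = gradient (\<phi> k) x - wgrad \<Omega> q x"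
          using H1_diff(2)[OF o(1) S(1) qw(1)] S(2) by eventually_elim simp
        have "L2_norm ?M (\<lambda>x. gradient (\<phi> k) x - wgrad \<Omega> q x) = L2_norm ?M (wgrad \<Omega> (\<lambda>x. \<phi> k x - q x))"
          by (rule L2_cong_AE_lebesgue_on(2)[OF \<Omega>s L2_diff(1)[OF S(4) Q(3)] ae, symmetric])
        also have "\<dots> \<le> ?a k" by (rule H1_norm_ge(2))
        finally show ?thesis using L2_norm_triangle[OF S(4) Q(3)] by linarith
      qed
      finally show ?thesis using C0 by (simp add: mult_left_mono)
    qed
    have "(\<lambda>k. ?a k + sqrt C * ((?a k + ?g) + ?b k)) \<longlonglongrightarrow> 0 + sqrt C * ((0 + ?g) + 0)"
      by (intro tendsto_intros \<phi>)
    from LIMSEQ_le_const[OF this] bound show ?thesis by auto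
  qed
  thus ?thesis using C0 by (intro exI[of _ "sqrt C"]) auto
qed

section \<open>Matrix fields in the Frobenius norm and the essential supremum\<close>

lemma norm_matrix_vector_le:
  fixes A :: "real^'n^'m" shows "norm (A *v x) \<le> norm A * norm x"
proof -
  have "norm (A *v x) = L2_set (\<lambda>i. \<bar>A $ i \<bullet> x\<bar>) UNIV"
    by (simp add: norm_vec_def matrix_vector_mul_component)
  also have "\<dots> \<le> L2_set (\<lambda>i. norm x * norm (A $ i)) UNIV"
    by (intro L2_set_mono) (auto simp: mult.commute[of "norm x"] Cauchy_Schwarz_ineq2)
  also have "\<dots> = norm x * norm A" by (simp add: L2_set_right_distrib norm_vec_def)
  finally show ?thesis by (simp add: mult.commute)
qed

lemma borel_measurable_matrix_vector:
  fixes K :: "'a \<Rightarrow> real^'n^'m"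
  assumes "K \<in> borel_measurable M" "G \<in> borel_measurable M"
  shows "(\<lambda>x. K x *v G x) \<in> borel_measurable M"
  using assms(1,2)
proof (rule borel_measurable_continuous_Pair)
  show "continuous_on UNIV (\<lambda>z :: (real^'n^'m) \<times> (real^'n). fst z *v snd z)"
    unfolding matrix_vector_mult_def by (intro continuous_intros)
qed

lemma L2_matrix_vector:
  fixes K :: "'a \<Rightarrow> real^'n^'m"
  assumes K: "K \<in> borel_measurable M" "AE x in M. norm (K x) \<le> c" "0 \<le> c" and G: "G \<in> L2 M"
  shows "(\<lambda>x. K x *v G x) \<in> L2 M" "L2_norm M (\<lambda>x. K x *v G x) \<le> c * L2_norm M G"
proof -
  have "AE x in M. norm (K x *v G x) \<le> c * norm (G x)"
    using K(2)
  proof eventually_elim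
    case (elim x)
    have "norm (K x *v G x) \<le> norm (K x) * norm (G x)" by (rule norm_matrix_vector_le)
    also have "\<dots> \<le> c * norm (G x)" using elim by (intro mult_right_mono) auto
    finally show ?case .
  qed
  from L2_bounded_by[OF G borel_measurable_matrix_vector[OF K(1) L2_D(1)[OF G]] K(3) this]
  show "(\<lambda>x. K x *v G x) \<in> L2 M" "L2_norm M (\<lambda>x. K x *v G x) \<le> c * L2_norm M G" .
qed

text \<open>\<open>real_of_ereal\<close> reflects the essential supremum only where that is finite.
  The bound \<open>c\<close> excludes the value plus infinity; minus infinity forces a null space,
  where the norm reads 0 and almost everywhere statements are vacuous.\<close>

lemma Linfty_norm_bound:
  fixes F :: "'a \<Rightarrow> 'b::euclidean_space"
  assumes F: "F \<in> borel_measurable M" and c: "AE x in M. norm (F x) \<le> c"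
  shows "0 \<le> Linfty_norm M F" "AE x in M. norm (F x) \<le> Linfty_norm M F"
proof -
  have m: "(\<lambda>x. ereal (norm (F x))) \<in> borel_measurable M" using F by measurable
  have le: "esssup M (\<lambda>x. ereal (norm (F x))) \<le> ereal c"
    using c by (intro esssup_I[OF m]) auto
  have ae: "AE x in M. ereal (norm (F x)) \<le> esssup M (\<lambda>x. ereal (norm (F x)))" by (rule esssup_AE)
  have "0 \<le> Linfty_norm M F \<and> (AE x in M. norm (F x) \<le> Linfty_norm M F)"
  proof (cases "esssup M (\<lambda>x. ereal (norm (F x)))")
    case (real r)
    have r: "AE x in M. norm (F x) \<le> r" using ae by (simp add: real)
    \<comment> \<open>A negative bound on a norm would make the space null, and then the essential
      supremum would be minus infinity rather than \<open>r\<close>.\<close>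
    have "0 \<le> r"
    proof (rule ccontr)
      assume "\<not> 0 \<le> r"
      have "AE x in M. False"
        using r by (rule eventually_mono) (use \<open>\<not> 0 \<le> r\<close> norm_ge_zero in \<open>auto dest: order_trans[OF norm_ge_zero]\<close>)
      hence "emeasure M (space M) = 0" by (simp add: AE_iff_measurable[of "space M"])
      hence "esssup M (\<lambda>x. ereal (norm (F x))) = - \<infinity>" by (intro esssup_zero_space m)
      thus False by (simp add: real)
    qed
    thus ?thesis using r by (simp add: Linfty_norm_def real)
  next
    case PInf thus ?thesis using le by simp
  next
    case MInf
    have "AE x in M. False" using ae by (simp add: MInf)
    hence "AE x in M. norm (F x) \<le> Linfty_norm M F" by (rule eventually_mono) simp
    thus ?thesis by (simp add: Linfty_norm_def MInf)
  qed
  thus "0 \<le> Linfty_norm M F" "AE x in M. norm (F x) \<le> Linfty_norm M F" by auto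
qed

section \<open>Stability of solutions of the Darcy equation\<close>

text \<open>The absolute value of \<open>Kmax\<close> gives a factor that is nonnegative without
  inspecting the sign, as \<open>L2_matrix_vector\<close> requires.\<close>

lemma permeability_D:
  assumes "permeability \<Omega> lam Kmax K"
  shows "K \<in> borel_measurable (lebesgue_on \<Omega>)" "AE x in lebesgue_on \<Omega>. norm (K x) \<le> \<bar>Kmax\<bar>"
    "AE x in lebesgue_on \<Omega>. \<forall>\<xi>. (K x *v \<xi>) \<bullet> \<xi> \<ge> lam * (norm \<xi>)\<^sup>2"
proof -
  show "K \<in> borel_measurable (lebesgue_on \<Omega>)" "AE x in lebesgue_on \<Omega>. \<forall>\<xi>. (K x *v \<xi>) \<bullet> \<xi> \<ge> lam * (norm \<xi>)\<^sup>2"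
    using assms by (auto simp: permeability_def Linfty_def)
  have "AE x in lebesgue_on \<Omega>. norm (K x) \<le> Kmax" using assms by (simp add: permeability_def)
  thus "AE x in lebesgue_on \<Omega>. norm (K x) \<le> \<bar>Kmax\<bar>" by (rule eventually_mono) linarith
qed

lemma permeability_coercive:
  assumes K: "permeability \<Omega> lam Kmax K" and G: "G \<in> L2 (lebesgue_on \<Omega>)"
  shows "lam * (L2_norm (lebesgue_on \<Omega>) G)\<^sup>2 \<le> (\<integral>x. (K x *v G x) \<bullet> G x \<partial>lebesgue_on \<Omega>)"
proof -
  let ?M = "lebesgue_on \<Omega>"
  note k = permeability_D[OF K]
  have "(\<integral>x. lam * (norm (G x))\<^sup>2 \<partial>?M) \<le> (\<integral>x. (K x *v G x) \<bullet> G x \<partial>?M)"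
  proof (rule integral_mono_AE)
    show "integrable ?M (\<lambda>x. lam * (norm (G x))\<^sup>2)" using L2_D(2)[OF G] by simp
    show "integrable ?M (\<lambda>x. (K x *v G x) \<bullet> G x)"
      by (rule L2_inner(1)[OF L2_matrix_vector(1)[OF k(1,2) _ G] G]) simp
    show "AE x in ?M. lam * (norm (G x))\<^sup>2 \<le> (K x *v G x) \<bullet> G x"
      using k(3) by (rule eventually_mono) simp
  qed
  thus ?thesis by (simp add: L2_norm_power2)
qed

text \<open>The source and flux terms depend on \<open>q\<close> alone, whichever representative
  \<open>boundary_trace\<close> picks, so they cancel between the two solutions.\<close>

lemma darcy_test_eq:
  assumes "darcy_solution \<Omega> \<Gamma>D \<Gamma>flux K1 f g v1 p1" "darcy_solution \<Omega> \<Gamma>D \<Gamma>flux K2 f g v2 p2"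
    and "q \<in> H1_Dir \<Omega> \<Gamma>D"
  shows "(\<integral>x. (K1 x *v wgrad \<Omega> p1 x) \<bullet> wgrad \<Omega> q x \<partial>lebesgue_on \<Omega>)
    = (\<integral>x. (K2 x *v wgrad \<Omega> p2 x) \<bullet> wgrad \<Omega> q x \<partial>lebesgue_on \<Omega>)"
proof -
  have "(\<integral>x. (K1 x *v wgrad \<Omega> p1 x) \<bullet> wgrad \<Omega> q x \<partial>lebesgue_on \<Omega>)
          - (\<integral>x. g x * boundary_trace \<Omega> q x \<partial>boundary_measure_on \<Gamma>flux)
        = (\<integral>x. f x * q x \<partial>lebesgue_on \<Omega>)"
    "(\<integral>x. (K2 x *v wgrad \<Omega> p2 x) \<bullet> wgrad \<Omega> q x \<partial>lebesgue_on \<Omega>)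
          - (\<integral>x. g x * boundary_trace \<Omega> q x \<partial>boundary_measure_on \<Gamma>flux)
        = (\<integral>x. f x * q x \<partial>lebesgue_on \<Omega>)"
    using assms unfolding darcy_solution_def by blast+
  thus ?thesis by linarith
qed

lemma darcy_solution_D:
  assumes "open \<Omega>" "darcy_solution \<Omega> \<Gamma>D \<Gamma>flux K f g v p"
  shows "p \<in> H1_Dir \<Omega> \<Gamma>D" "p \<in> H1 \<Omega>" "wgrad \<Omega> p \<in> L2 (lebesgue_on \<Omega>)" "v \<in> L2 (lebesgue_on \<Omega>)"
    "AE x in lebesgue_on \<Omega>. v x = - (K x *v wgrad \<Omega> p x)"
proof -
  show p: "p \<in> H1_Dir \<Omega> \<Gamma>D" and "v \<in> L2 (lebesgue_on \<Omega>)"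
    and "AE x in lebesgue_on \<Omega>. v x = - (K x *v wgrad \<Omega> p x)"
    using assms(2) by (auto simp: darcy_solution_def)
  show h: "p \<in> H1 \<Omega>" using p by (simp add: H1_Dir_def)
  show "wgrad \<Omega> p \<in> L2 (lebesgue_on \<Omega>)" by (rule H1_D(3)[OF assms(1) h])
qed

text \<open>Any one solution \<open>p0\<close> represents the load functional as \<open>q \<mapsto> \<integral> K0 \<nabla>p0 \<bullet> \<nabla>q\<close>, which bounds it
  by \<open>\<parallel>\<nabla>q\<parallel>\<close> without recourse to a trace inequality.\<close>

lemma darcy_gradient_bound:
  assumes \<Omega>: "open \<Omega>" and lam: "lam > 0"
    and K0: "permeability \<Omega> lam Kmax K0" and s0: "darcy_solution \<Omega> \<Gamma>D \<Gamma>flux K0 f g v0 p0"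
    and K: "permeability \<Omega> lam Kmax K" and s: "darcy_solution \<Omega> \<Gamma>D \<Gamma>flux K f g v p"
  shows "L2_norm (lebesgue_on \<Omega>) (wgrad \<Omega> p) \<le> \<bar>Kmax\<bar> * L2_norm (lebesgue_on \<Omega>) (wgrad \<Omega> p0) / lam"
proof -
  let ?M = "lebesgue_on \<Omega>" and ?G = "wgrad \<Omega> p" and ?H = "wgrad \<Omega> p0"
  note d = darcy_solution_D[OF \<Omega> s] and d0 = darcy_solution_D[OF \<Omega> s0]
  note L0 = L2_matrix_vector[OF permeability_D(1,2)[OF K0] abs_ge_zero d0(3)]
  have "lam * (L2_norm ?M ?G)\<^sup>2 \<le> (\<integral>x. (K x *v ?G x) \<bullet> ?G x \<partial>?M)"
    by (rule permeability_coercive[OF K d(3)])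
  also have "\<dots> = (\<integral>x. (K0 x *v ?H x) \<bullet> ?G x \<partial>?M)" by (rule darcy_test_eq[OF s s0 d(1)])
  also have "\<dots> \<le> L2_norm ?M (\<lambda>x. K0 x *v ?H x) * L2_norm ?M ?G"
    using L2_inner(2)[OF L0(1) d(3)] by linarith
  also have "\<dots> \<le> (\<bar>Kmax\<bar> * L2_norm ?M ?H) * L2_norm ?M ?G" by (intro mult_right_mono L0(2)) simp
  finally have le: "(lam * L2_norm ?M ?G) * L2_norm ?M ?G \<le> (\<bar>Kmax\<bar> * L2_norm ?M ?H) * L2_norm ?M ?G"
    by (simp add: power2_eq_square mult.assoc)
  show ?thesis
  proof (cases "L2_norm ?M ?G = 0")
    case True thus ?thesis using lam by simp
  next
    case False
    hence "L2_norm ?M ?G > 0" using L2_norm_nonneg[of ?M ?G] by linarith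
    with le have "lam * L2_norm ?M ?G \<le> \<bar>Kmax\<bar> * L2_norm ?M ?H" by (rule mult_right_le_imp_le)
    thus ?thesis using lam by (simp add: pos_le_divide_eq mult.commute)
  qed
qed

text \<open>The flux estimate uses the splitting
  \<open>v1 - v2 = K2 \<nabla>(p2 - p1) + (K2 - K1) \<nabla>p1\<close>: the first term is bounded by
  \<open>\<bar>Kmax\<bar>\<close> times the gradient estimate, the second by
  \<open>\<kappa> * B\<close>.\<close>

lemma darcy_difference_bound:
  assumes dom: "lipschitz_domain \<Omega>" and lam: "lam > 0"
    and K1: "permeability \<Omega> lam Kmax K1" and s1: "darcy_solution \<Omega> \<Gamma>D \<Gamma>flux K1 f g v1 p1"
    and K2: "permeability \<Omega> lam Kmax K2" and s2: "darcy_solution \<Omega> \<Gamma>D \<Gamma>flux K2 f g v2 p2"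
    and B: "L2_norm (lebesgue_on \<Omega>) (wgrad \<Omega> p1) \<le> B"
  defines "\<kappa> \<equiv> Linfty_norm (lebesgue_on \<Omega>) (\<lambda>x. K2 x - K1 x)"
  shows "L2_norm (lebesgue_on \<Omega>) (wgrad \<Omega> (\<lambda>x. p2 x - p1 x)) \<le> \<kappa> * B / lam"
    and "L2_norm (lebesgue_on \<Omega>) (\<lambda>x. v2 x - v1 x) \<le> (\<bar>Kmax\<bar> * B / lam + B) * \<kappa>"
    and "0 \<le> \<kappa>"
proof -
  let ?M = "lebesgue_on \<Omega>"
  have \<Omega>: "open \<Omega>" using dom by (simp add: lipschitz_domain_def)
  have \<Omega>s: "\<Omega> \<in> sets lebesgue" using \<Omega> by simp
  note d1 = darcy_solution_D[OF \<Omega> s1] and d2 = darcy_solution_D[OF \<Omega> s2]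
  note k1 = permeability_D[OF K1] and k2 = permeability_D[OF K2]
  let ?G1 = "wgrad \<Omega> p1" and ?G2 = "wgrad \<Omega> p2" and ?D = "wgrad \<Omega> (\<lambda>x. p2 x - p1 x)"
  let ?dK = "\<lambda>x. K2 x - K1 x"
  have dK: "?dK \<in> borel_measurable ?M" using k1(1) k2(1) by measurable
  have "AE x in ?M. norm (?dK x) \<le> \<bar>Kmax\<bar> + \<bar>Kmax\<bar>"
    using k1(2) k2(2)
  proof eventually_elim
    case (elim x)
    thus ?case using norm_triangle_ineq4[of "K2 x" "K1 x"] by linarith
  qed
  from Linfty_norm_bound[OF dK this] have \<kappa>: "0 \<le> \<kappa>" "AE x in ?M. norm (?dK x) \<le> \<kappa>"
    by (auto simp: \<kappa>_def)
  show "0 \<le> \<kappa>" by (rule \<kappa>(1))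
  have q: "(\<lambda>x. p2 x - p1 x) \<in> H1_Dir \<Omega> \<Gamma>D" by (rule H1_Dir_diff[OF dom d2(1) d1(1)])
  have D: "?D \<in> L2 ?M" by (rule H1_D(3)[OF \<Omega>]) (use q in \<open>simp add: H1_Dir_def\<close>)
  have aeD: "AE x in ?M. ?D x = ?G2 x - ?G1 x" by (rule H1_diff(2)[OF \<Omega> d2(2) d1(2)])
  note L11 = L2_matrix_vector[OF k1(1,2) abs_ge_zero d1(3)]
    and L21 = L2_matrix_vector[OF k2(1,2) abs_ge_zero d1(3)]
    and L22 = L2_matrix_vector[OF k2(1,2) abs_ge_zero d2(3)]
    and L2D = L2_matrix_vector[OF k2(1,2) abs_ge_zero D]
    and LdK = L2_matrix_vector[OF dK \<kappa>(2,1) d1(3)]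
  have "lam * (L2_norm ?M ?D)\<^sup>2 \<le> (\<integral>x. (K2 x *v ?D x) \<bullet> ?D x \<partial>?M)"
    by (rule permeability_coercive[OF K2 D])
  also have "\<dots> = (\<integral>x. (K2 x *v ?G2 x) \<bullet> ?D x - (K2 x *v ?G1 x) \<bullet> ?D x \<partial>?M)"
  proof (rule integral_cong_AE)
    show "AE x in ?M. (K2 x *v ?D x) \<bullet> ?D x = (K2 x *v ?G2 x) \<bullet> ?D x - (K2 x *v ?G1 x) \<bullet> ?D x"
      using aeD by (rule eventually_mono) (simp add: matrix_vector_mult_diff_distrib inner_diff_left)
  qed (use L2_inner(1)[OF L2D(1) D] L2_inner(1)[OF L22(1) D] L2_inner(1)[OF L21(1) D] in auto)
  also have "\<dots> = (\<integral>x. (K2 x *v ?G2 x) \<bullet> ?D x \<partial>?M) - (\<integral>x. (K2 x *v ?G1 x) \<bullet> ?D x \<partial>?M)"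
    by (rule Bochner_Integration.integral_diff[OF L2_inner(1)[OF L22(1) D] L2_inner(1)[OF L21(1) D]])
  also have "\<dots> = (\<integral>x. (K1 x *v ?G1 x) \<bullet> ?D x \<partial>?M) - (\<integral>x. (K2 x *v ?G1 x) \<bullet> ?D x \<partial>?M)"
    using darcy_test_eq[OF s1 s2 q] by simp
  also have "\<dots> = (\<integral>x. (K1 x *v ?G1 x) \<bullet> ?D x - (K2 x *v ?G1 x) \<bullet> ?D x \<partial>?M)"
    by (rule Bochner_Integration.integral_diff[OF L2_inner(1)[OF L11(1) D] L2_inner(1)[OF L21(1) D], symmetric])
  also have "\<dots> = - (\<integral>x. (?dK x *v ?G1 x) \<bullet> ?D x \<partial>?M)"
    unfolding Bochner_Integration.integral_minus[symmetric]
    by (intro Bochner_Integration.integral_cong) (simp_all add: matrix_vector_mult_diff_rdistrib inner_diff_left)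
  also have "\<dots> \<le> L2_norm ?M (\<lambda>x. ?dK x *v ?G1 x) * L2_norm ?M ?D"
    using L2_inner(2)[OF LdK(1) D] by linarith
  also have "\<dots> \<le> (\<kappa> * B) * L2_norm ?M ?D"
    using LdK(2) mult_left_mono[OF B \<kappa>(1)] by (intro mult_right_mono) auto
  finally have le: "(lam * L2_norm ?M ?D) * L2_norm ?M ?D \<le> (\<kappa> * B) * L2_norm ?M ?D"
    by (simp add: power2_eq_square mult.assoc)
  have B0: "0 \<le> B" using B L2_norm_nonneg[of ?M ?G1] by linarith
  show Dle: "L2_norm ?M ?D \<le> \<kappa> * B / lam"
  proof (cases "L2_norm ?M ?D = 0")
    case True thus ?thesis using lam B0 \<kappa>(1) by simp
  next
    case False
    hence "L2_norm ?M ?D > 0" using L2_norm_nonneg[of ?M ?D] by linarith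
    with le have "lam * L2_norm ?M ?D \<le> \<kappa> * B" by (rule mult_right_le_imp_le)
    thus ?thesis using lam by (simp add: pos_le_divide_eq mult.commute)
  qed
  \<comment> \<open>The sum is written as a difference so that the triangle inequality
    \<open>L2_diff\<close> applies.\<close>
  have ae: "AE x in ?M. v1 x - v2 x = (K2 x *v ?D x) - (- (?dK x *v ?G1 x))"
    using d1(5) d2(5) aeD
  proof eventually_elim
    case (elim x)
    show ?case unfolding elim by (simp add: matrix_vector_mult_diff_distrib matrix_vector_mult_diff_rdistrib)
  qed
  have neg: "(\<lambda>x. - (?dK x *v ?G1 x)) \<in> L2 ?M" "L2_norm ?M (\<lambda>x. - (?dK x *v ?G1 x)) = L2_norm ?M (\<lambda>x. ?dK x *v ?G1 x)"
    using LdK(1) by (auto simp: L2_def L2_norm_def)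
  have "L2_norm ?M (\<lambda>x. v2 x - v1 x) = L2_norm ?M (\<lambda>x. v1 x - v2 x)" by (rule L2_norm_commute)
  also have "\<dots> = L2_norm ?M (\<lambda>x. (K2 x *v ?D x) - (- (?dK x *v ?G1 x)))"
    by (rule L2_cong_AE_lebesgue_on(2)[OF \<Omega>s L2_diff(1)[OF L2D(1) neg(1)] ae])
  also have "\<dots> \<le> L2_norm ?M (\<lambda>x. K2 x *v ?D x) + L2_norm ?M (\<lambda>x. ?dK x *v ?G1 x)"
    using L2_diff(2)[OF L2D(1) neg(1)] by (simp only: neg(2))
  also have "\<dots> \<le> \<bar>Kmax\<bar> * (\<kappa> * B / lam) + \<kappa> * B"
    using order_trans[OF L2D(2) mult_left_mono[OF Dle abs_ge_zero]]
      order_trans[OF LdK(2) mult_left_mono[OF B \<kappa>(1)]] by (rule add_mono)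
  also have "\<dots> = (\<bar>Kmax\<bar> * B / lam + B) * \<kappa>" by (simp add: algebra_simps)
  finally show "L2_norm ?M (\<lambda>x. v2 x - v1 x) \<le> (\<bar>Kmax\<bar> * B / lam + B) * \<kappa>" .
qed

theorem lemma4p3:
  fixes \<Omega> \<Gamma>D \<Gamma>flux :: "(real^'n) set"
    and f g :: "real^'n \<Rightarrow> real"
    and lam Kmax :: real
  assumes "CARD('n) = 2 \<or> CARD('n) = 3"
    and "lipschitz_domain \<Omega>"
    and "frontier \<Omega> = \<Gamma>D \<union> \<Gamma>flux"
    and "\<Gamma>D \<in> sets boundary_measure" and "\<Gamma>flux \<in> sets boundary_measure"
    and "emeasure boundary_measure \<Gamma>D > 0"
    and "g \<in> L2 (boundary_measure_on \<Gamma>flux)"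
    and "f \<in> L2 (lebesgue_on \<Omega>)"
    and "lam > 0"
  shows "\<exists>C > 0. \<forall>K1 K2 v1 v2 p1 p2.
           permeability \<Omega> lam Kmax K1 \<and> permeability \<Omega> lam Kmax K2 \<and>
           darcy_solution \<Omega> \<Gamma>D \<Gamma>flux K1 f g v1 p1 \<and>
           darcy_solution \<Omega> \<Gamma>D \<Gamma>flux K2 f g v2 p2 \<longrightarrow>
           H1_norm \<Omega> (\<lambda>x. p2 x - p1 x)
             \<le> C * Linfty_norm (lebesgue_on \<Omega>) (\<lambda>x. K2 x - K1 x) \<and>
           L2_norm (lebesgue_on \<Omega>) (\<lambda>x. v2 x - v1 x)
             \<le> C * Linfty_norm (lebesgue_on \<Omega>) (\<lambda>x. K2 x - K1 x)"
\<comment> \<open>If no admissible coefficient has a solution, the claim is vacuous. Otherwise one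
  reference solution is fixed from the data alone, before \<open>K1\<close> and \<open>K2\<close>
  are given, which keeps \<open>C\<close> independent of them.\<close>
proof (cases "\<exists>K0 v0 p0. permeability \<Omega> lam Kmax K0 \<and> darcy_solution \<Omega> \<Gamma>D \<Gamma>flux K0 f g v0 p0")
  case False
  thus ?thesis by (intro exI[of _ 1]) auto
next
  case True
  then obtain K0 v0 p0 where K0: "permeability \<Omega> lam Kmax K0"
    and s0: "darcy_solution \<Omega> \<Gamma>D \<Gamma>flux K0 f g v0 p0" by blast
  have \<Omega>: "open \<Omega>" using assms(2) by (simp add: lipschitz_domain_def)
  let ?M = "lebesgue_on \<Omega>"
  define B where "B = \<bar>Kmax\<bar> * L2_norm ?M (wgrad \<Omega> p0) / lam"
  have B0: "0 \<le> B" using assms(9) by (simp add: B_def)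
  have "\<Gamma>D \<subseteq> frontier \<Omega>" using assms(3) by simp
  from poincare_H1_Dir[OF assms(2) this assms(4,6)] obtain P where P: "P \<ge> 0"
    "\<forall>q \<in> H1_Dir \<Omega> \<Gamma>D. L2_norm ?M q \<le> P * L2_norm ?M (wgrad \<Omega> q)" by blast
  \<comment> \<open>\<open>P\<close> pays for the function itself and 1 for its gradient;
    \<open>B / lam\<close> is the gradient estimate per unit of coefficient difference.\<close>
  define C1 where "C1 = (P + 1) * (B / lam)"
  define C2 where "C2 = \<bar>Kmax\<bar> * B / lam + B"
  have C: "C1 \<ge> 0" "C2 \<ge> 0" using B0 P(1) assms(9) by (simp_all add: C1_def C2_def)
  show ?thesis
  \<comment> \<open>\<open>C1\<close> and \<open>C2\<close> may both be 0, for instance for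
    vanishing data; the summand 1 ensures strict positivity.\<close>
  proof (intro exI[of _ "C1 + C2 + 1"] conjI allI impI)
    show "C1 + C2 + 1 > 0" using C by linarith
    fix K1 K2 :: "real^'n \<Rightarrow> real^'n^'n" and v1 v2 :: "real^'n \<Rightarrow> real^'n" and p1 p2 :: "real^'n \<Rightarrow> real"
    let ?\<kappa> = "Linfty_norm ?M (\<lambda>x. K2 x - K1 x)"
    let ?q = "\<lambda>x. p2 x - p1 x"
    assume "permeability \<Omega> lam Kmax K1 \<and> permeability \<Omega> lam Kmax K2 \<and>
           darcy_solution \<Omega> \<Gamma>D \<Gamma>flux K1 f g v1 p1 \<and>
           darcy_solution \<Omega> \<Gamma>D \<Gamma>flux K2 f g v2 p2"
    hence K1: "permeability \<Omega> lam Kmax K1" and K2: "permeability \<Omega> lam Kmax K2"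
      and s1: "darcy_solution \<Omega> \<Gamma>D \<Gamma>flux K1 f g v1 p1"
      and s2: "darcy_solution \<Omega> \<Gamma>D \<Gamma>flux K2 f g v2 p2" by blast+
    have G1: "L2_norm ?M (wgrad \<Omega> p1) \<le> B"
      unfolding B_def by (rule darcy_gradient_bound[OF \<Omega> assms(9) K0 s0 K1 s1])
    note bd = darcy_difference_bound[OF assms(2,9) K1 s1 K2 s2 G1]
    have q: "?q \<in> H1_Dir \<Omega> \<Gamma>D"
      by (rule H1_Dir_diff[OF assms(2) darcy_solution_D(1)[OF \<Omega> s2] darcy_solution_D(1)[OF \<Omega> s1]])
    have "H1_norm \<Omega> ?q \<le> L2_norm ?M ?q + L2_norm ?M (wgrad \<Omega> ?q)"
      unfolding H1_norm_def by (rule sqrt_sum_squares_le_sum) auto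
    also have "\<dots> \<le> (P + 1) * L2_norm ?M (wgrad \<Omega> ?q)" using bspec[OF P(2) q] by (simp add: distrib_right)
    also have "\<dots> \<le> (P + 1) * (?\<kappa> * B / lam)" using bd(1) P(1) by (intro mult_left_mono) auto
    also have "\<dots> = C1 * ?\<kappa>" by (simp add: C1_def)
    also have "\<dots> \<le> (C1 + C2 + 1) * ?\<kappa>" using C bd(3) by (intro mult_right_mono) auto
    finally show "H1_norm \<Omega> ?q \<le> (C1 + C2 + 1) * ?\<kappa>" .
    have "L2_norm ?M (\<lambda>x. v2 x - v1 x) \<le> C2 * ?\<kappa>" unfolding C2_def by (rule bd(2))
    also have "\<dots> \<le> (C1 + C2 + 1) * ?\<kappa>" using C bd(3) by (intro mult_right_mono) auto
    finally show "L2_norm ?M (\<lambda>x. v2 x - v1 x) \<le> (C1 + C2 + 1) * ?\<kappa>" .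
  qed
qed

end
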